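(* Let $G$ be a finitely generated nilpotent group, let $\alpha \in Z^2(G,\mathbb{C}^\times)$ be a $2$-cocycle, and let $(\rho,V)$ be an irreducible $\alpha$-representation of $G$. Then $\rho$ is monomial if and only if $\rho$ has finite weight.
   Context: All vector spaces are complex and may be infinite dimensional. $\mathbb{C}^\times$ is a trivial $G$-module. A $2$-cocycle $\alpha\in Z^2(G,\mathbb{C}^\times)$ is a map $\alpha:G\times G\to\mathbb{C}^\times$ with $\alpha(x,y)\alpha(xy,z)=\alpha(x,yz)\alpha(y,z)$ for all $x,y,z\in G$. An $\alpha$-representation of $G$ on a complex vector space $V$ is a map $\rho:G\to \mathrm{GL}(V)$ with $\rho(x)\rho(y)=\alpha(x,y)\rho(xy)$ for all $x,y\in G$. It is irreducible if $V\neq 0$ and the only subspaces of $V$ invariant under all $\rho(g)$ are $0$ and $V$. Two $\alpha$-representations $(\rho_1,V)$, $(\rho_2,W)$ of $G$ are equivalent if there is an invertible linear map $T:V\to W$ with $T\rho_1(g)T^{-1}=\rho_2(g)$ for all $g\in G$. For a subgroup $H\subseteq G$, an $\alpha$-representation of $H$ means an $\alpha|_{H\times H}$-representation of $H$; a one-dimensional one is a map $\psi:H\to\mathbb{C}^\times$ with $\psi(x)\psi(y)=\alpha(x,y)\psi(xy)$ for all $x,y\in H$. Induction: given a subgroup $H\subseteq G$ and an $\alpha$-representation $(\phi,W)$ of $H$, the induced $\alpha$-representation $\mathrm{Ind}_H^G(\phi)=(\widetilde{\phi},V)$ of $G$ is defined as follows. $V$ is the space of functions $f:G\to W$ such that (i)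 $f(hg)=\alpha(h,g)^{-1}\phi(h)f(g)$ for all $h\in H$, $g\in G$, and (ii) the support of $f$ is contained in a union of finitely many right cosets of $H$ in $G$. The action is $(\widetilde{\phi}(g)f)(x)=\alpha(x,g)f(xg)$ for $x,g\in G$. Monomial: an $\alpha$-representation $\rho$ of $G$ is monomial if there exist a subgroup $H\subseteq G$ and a one-dimensional $\alpha$-representation $\psi:H\to\mathbb{C}^\times$ such that $\rho$ is equivalent to $\mathrm{Ind}_H^G(\psi)$. Finite weight: an $\alpha$-representation $(\rho,V)$ of $G$ has finite weight if there exist a subgroup $H\subseteq G$ and a one-dimensional $\alpha$-representation $\psi:H\to\mathbb{C}^\times$ such that $V_H(\psi)=\{v\in V:\rho(h)v=\psi(h)v \text{ for all } h\in H\}$ is nonzero and finite dimensional. *)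

theory Defs
  imports Complex_Main "HOL-Algebra.Generated_Groups" "HOL-Library.Function_Algebras"
begin

section \<open>Finitely generated nilpotent groups\<close>

definition finitely_generated_group :: "('g, 'm) monoid_scheme \<Rightarrow> bool" where
  "finitely_generated_group G \<longleftrightarrow>
     group G \<and> (\<exists>S. finite S \<and> S \<subseteq> carrier G \<and> generate G S = carrier G)"

text \<open>The lower central series, indexed so that the term with index \<open>0\<close> is the whole group.\<close>

fun lower_central :: "('g, 'm) monoid_scheme \<Rightarrow> nat \<Rightarrow> 'g set" where
  "lower_central G 0 = carrier G"
| "lower_central G (Suc n) =
     generate G {x \<otimes>\<^bsub>G\<^esub> y \<otimes>\<^bsub>G\<^esub> inv\<^bsub>G\<^esub> x \<otimes>\<^bsub>G\<^esub> inv\<^bsub>G\<^esub> y | x y. x \<in> lower_central G n \<and> y \<in> carrier G}"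

definition nilpotent_group :: "('g, 'm) monoid_scheme \<Rightarrow> bool" where
  "nilpotent_group G \<longleftrightarrow> group G \<and> (\<exists>n. lower_central G n = {\<one>\<^bsub>G\<^esub>})"


section \<open>Cocycles and projective representations\<close>

text \<open>
  Cocycles are not assumed to be normalized. Only their values on the carrier matter.
\<close>

definition cocycle2 :: "('g, 'm) monoid_scheme \<Rightarrow> ('g \<Rightarrow> 'g \<Rightarrow> complex) \<Rightarrow> bool" where
  "cocycle2 G \<alpha> \<longleftrightarrow>
     (\<forall>x\<in>carrier G. \<forall>y\<in>carrier G. \<alpha> x y \<noteq> 0) \<and>
     (\<forall>x\<in>carrier G. \<forall>y\<in>carrier G. \<forall>z\<in>carrier G.
        \<alpha> x y * \<alpha> (x \<otimes>\<^bsub>G\<^esub> y) z = \<alpha> x (y \<otimes>\<^bsub>G\<^esub> z) * \<alpha> y z)"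

text \<open>
  A complex vector space is given by a subspace \<open>V\<close> of an ambient space, which consists of a
  type and a scalar multiplication \<open>s\<close>; \<open>V = UNIV\<close> is allowed. Only the values on
  \<open>V\<close> of a map defined on \<open>V\<close> matter.
\<close>

definition complex_space :: "(complex \<Rightarrow> 'v \<Rightarrow> 'v::ab_group_add) \<Rightarrow> 'v set \<Rightarrow> bool" where
  "complex_space s V \<longleftrightarrow> vector_space s \<and> module.subspace s V"

definition linear_iso_on ::
  "(complex \<Rightarrow> 'v \<Rightarrow> 'v::ab_group_add) \<Rightarrow> 'v set \<Rightarrow>
   (complex \<Rightarrow> 'w \<Rightarrow> 'w::ab_group_add) \<Rightarrow> 'w set \<Rightarrow> ('v \<Rightarrow> 'w) \<Rightarrow> bool" where
  "linear_iso_on s V t W T \<longleftrightarrow>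
     bij_betw T V W \<and>
     (\<forall>u\<in>V. \<forall>v\<in>V. T (u + v) = T u + T v) \<and>
     (\<forall>c. \<forall>v\<in>V. T (s c v) = t c (T v))"

text \<open>
  An \<open>\<alpha>\<close>-representation of a subgroup \<open>H\<close> is obtained by taking
  \<open>G\<lparr>carrier := H\<rparr>\<close> for the group.
\<close>

definition alpha_rep ::
  "('g, 'm) monoid_scheme \<Rightarrow> ('g \<Rightarrow> 'g \<Rightarrow> complex) \<Rightarrow>
   (complex \<Rightarrow> 'v \<Rightarrow> 'v::ab_group_add) \<Rightarrow> 'v set \<Rightarrow> ('g \<Rightarrow> 'v \<Rightarrow> 'v) \<Rightarrow> bool" where
  "alpha_rep G \<alpha> s V \<rho> \<longleftrightarrow>
     complex_space s V \<and>
     (\<forall>g\<in>carrier G. linear_iso_on s V s V (\<rho> g)) \<and>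
     (\<forall>x\<in>carrier G. \<forall>y\<in>carrier G. \<forall>v\<in>V. \<rho> x (\<rho> y v) = s (\<alpha> x y) (\<rho> (x \<otimes>\<^bsub>G\<^esub> y) v))"

definition irreducible_alpha_rep ::
  "('g, 'm) monoid_scheme \<Rightarrow> ('g \<Rightarrow> 'g \<Rightarrow> complex) \<Rightarrow>
   (complex \<Rightarrow> 'v \<Rightarrow> 'v::ab_group_add) \<Rightarrow> 'v set \<Rightarrow> ('g \<Rightarrow> 'v \<Rightarrow> 'v) \<Rightarrow> bool" where
  "irreducible_alpha_rep G \<alpha> s V \<rho> \<longleftrightarrow>
     alpha_rep G \<alpha> s V \<rho> \<and> V \<noteq> {0} \<and>
     (\<forall>U. module.subspace s U \<and> U \<subseteq> V \<and> (\<forall>g\<in>carrier G. \<rho> g ` U \<subseteq> U) \<longrightarrow> U = {0} \<or> U = V)"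

definition equivalent_reps ::
  "('g, 'm) monoid_scheme \<Rightarrow>
   (complex \<Rightarrow> 'v \<Rightarrow> 'v::ab_group_add) \<Rightarrow> 'v set \<Rightarrow> ('g \<Rightarrow> 'v \<Rightarrow> 'v) \<Rightarrow>
   (complex \<Rightarrow> 'w \<Rightarrow> 'w::ab_group_add) \<Rightarrow> 'w set \<Rightarrow> ('g \<Rightarrow> 'w \<Rightarrow> 'w) \<Rightarrow> bool" where
  "equivalent_reps G s V \<rho>\<^sub>1 t W \<rho>\<^sub>2 \<longleftrightarrow>
     (\<exists>T. linear_iso_on s V t W T \<and>
          (\<forall>g\<in>carrier G. \<forall>w\<in>W. T (\<rho>\<^sub>1 g (the_inv_into V T w)) = \<rho>\<^sub>2 g w))"

definition one_dim_alpha_rep ::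
  "('g, 'm) monoid_scheme \<Rightarrow> ('g \<Rightarrow> 'g \<Rightarrow> complex) \<Rightarrow> ('g \<Rightarrow> complex) \<Rightarrow> bool" where
  "one_dim_alpha_rep H \<alpha> \<psi> \<longleftrightarrow>
     (\<forall>x\<in>carrier H. \<psi> x \<noteq> 0) \<and>
     (\<forall>x\<in>carrier H. \<forall>y\<in>carrier H. \<psi> x * \<psi> y = \<alpha> x y * \<psi> (x \<otimes>\<^bsub>H\<^esub> y))"


section \<open>Induction\<close>

text \<open>
  A function on the group is encoded as a total function that vanishes off the carrier, so that
  the induced representation lives in the function space with pointwise operations.
\<close>

definition fun_scale :: "(complex \<Rightarrow> 'w \<Rightarrow> 'w) \<Rightarrow> complex \<Rightarrow> ('g \<Rightarrow> 'w) \<Rightarrow> 'g \<Rightarrow> 'w" where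
  "fun_scale t c f = (\<lambda>x. t c (f x))"

definition ind_space ::
  "('g, 'm) monoid_scheme \<Rightarrow> ('g \<Rightarrow> 'g \<Rightarrow> complex) \<Rightarrow> 'g set \<Rightarrow>
   (complex \<Rightarrow> 'w \<Rightarrow> 'w::ab_group_add) \<Rightarrow> 'w set \<Rightarrow> ('g \<Rightarrow> 'w \<Rightarrow> 'w) \<Rightarrow> ('g \<Rightarrow> 'w) set" where
  "ind_space G \<alpha> H t W \<phi> =
     {f. (\<forall>x\<in>carrier G. f x \<in> W) \<and> (\<forall>x. x \<notin> carrier G \<longrightarrow> f x = 0) \<and>
         (\<forall>h\<in>H. \<forall>g\<in>carrier G. f (h \<otimes>\<^bsub>G\<^esub> g) = t (inverse (\<alpha> h g)) (\<phi> h (f g))) \<and>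
         (\<exists>C. finite C \<and> C \<subseteq> rcosets\<^bsub>G\<^esub> H \<and> {x \<in> carrier G. f x \<noteq> 0} \<subseteq> \<Union>C)}"

definition ind_action ::
  "('g, 'm) monoid_scheme \<Rightarrow> ('g \<Rightarrow> 'g \<Rightarrow> complex) \<Rightarrow>
   (complex \<Rightarrow> 'w \<Rightarrow> 'w::ab_group_add) \<Rightarrow> 'g \<Rightarrow> ('g \<Rightarrow> 'w) \<Rightarrow> 'g \<Rightarrow> 'w" where
  "ind_action G \<alpha> t g f = (\<lambda>x. if x \<in> carrier G then t (\<alpha> x g) (f (x \<otimes>\<^bsub>G\<^esub> g)) else 0)"


subsection \<open>The induced representation is an \<open>\<alpha>\<close>-representation\<close>

lemma cocycle2_one:
  assumes G: "group G" and c: "cocycle2 G \<alpha>" and x: "x \<in> carrier G"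
  shows "\<alpha> x \<one>\<^bsub>G\<^esub> = \<alpha> \<one>\<^bsub>G\<^esub> \<one>\<^bsub>G\<^esub>"
proof -
  interpret group G by (rule G)
  have "\<alpha> x \<one>\<^bsub>G\<^esub> * \<alpha> (x \<otimes>\<^bsub>G\<^esub> \<one>\<^bsub>G\<^esub>) \<one>\<^bsub>G\<^esub> = \<alpha> x (\<one>\<^bsub>G\<^esub> \<otimes>\<^bsub>G\<^esub> \<one>\<^bsub>G\<^esub>) * \<alpha> \<one>\<^bsub>G\<^esub> \<one>\<^bsub>G\<^esub>"
    using c x unfolding cocycle2_def by blast
  moreover have "\<alpha> x \<one>\<^bsub>G\<^esub> \<noteq> 0" using c x unfolding cocycle2_def by blast
  ultimately show ?thesis using x by simp
qed

lemma vector_space_fun_scale: "vector_space t \<Longrightarrow> vector_space (fun_scale t)"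
  unfolding vector_space_def fun_scale_def by (auto simp: fun_eq_iff)

lemma subspace_ind_space:
  assumes G: "group G" and H: "subgroup H G"
    and \<phi>: "alpha_rep (G\<lparr>carrier := H\<rparr>) \<alpha> t W \<phi>"
  shows "module.subspace (fun_scale t) (ind_space G \<alpha> H t W \<phi>)"
proof -
  interpret group G by (rule G)
  interpret H: subgroup H G by (rule H)
  have vs: "vector_space t" and sub: "module.subspace t W"
    using \<phi> by (auto simp: alpha_rep_def complex_space_def)
  interpret vector_space t by (rule vs)
  interpret F: vector_space "fun_scale t" by (rule vector_space_fun_scale[OF vs])
  have lin: "\<phi> h (u + v) = \<phi> h u + \<phi> h v" "\<phi> h (t c u) = t c (\<phi> h u)"
    if "h \<in> H" "u \<in> W" "v \<in> W" for h u v c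
    using \<phi> that by (auto simp: alpha_rep_def linear_iso_on_def)
  have z: "\<phi> h 0 = 0" if "h \<in> H" for h
    using lin(2)[OF that, of 0 0 0] sub subspace_0 by simp
  show ?thesis
  proof (rule F.subspaceI)
    show "0 \<in> ind_space G \<alpha> H t W \<phi>"
      using sub subspace_0 z by (auto simp: ind_space_def intro!: exI[of _ "{}"])
  next
    fix f f' assume f: "f \<in> ind_space G \<alpha> H t W \<phi>" and f': "f' \<in> ind_space G \<alpha> H t W \<phi>"
    obtain C where C: "finite C" "C \<subseteq> rcosets\<^bsub>G\<^esub> H" "{x \<in> carrier G. f x \<noteq> 0} \<subseteq> \<Union>C"
      using f by (auto simp: ind_space_def)
    obtain C' where C': "finite C'" "C' \<subseteq> rcosets\<^bsub>G\<^esub> H" "{x \<in> carrier G. f' x \<noteq> 0} \<subseteq> \<Union>C'"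
      using f' by (auto simp: ind_space_def)
    have "\<exists>C. finite C \<and> C \<subseteq> rcosets\<^bsub>G\<^esub> H \<and> {x \<in> carrier G. (f + f') x \<noteq> 0} \<subseteq> \<Union>C"
    proof (intro exI conjI)
      show "finite (C \<union> C')" "C \<union> C' \<subseteq> rcosets\<^bsub>G\<^esub> H" using C C' by blast+
      have "f x \<noteq> 0 \<or> f' x \<noteq> 0" if "(f + f') x \<noteq> 0" for x
        using that by auto
      then show "{x \<in> carrier G. (f + f') x \<noteq> 0} \<subseteq> \<Union>(C \<union> C')" using C(3) C'(3) by blast
    qed
    then show "f + f' \<in> ind_space G \<alpha> H t W \<phi>"
      using f f' sub lin(1) by (auto simp: ind_space_def subspace_add scale_right_distrib)
  next
    fix c f assume f: "f \<in> ind_space G \<alpha> H t W \<phi>"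
    obtain C where C: "finite C" "C \<subseteq> rcosets\<^bsub>G\<^esub> H" "{x \<in> carrier G. f x \<noteq> 0} \<subseteq> \<Union>C"
      using f by (auto simp: ind_space_def)
    have "\<exists>C. finite C \<and> C \<subseteq> rcosets\<^bsub>G\<^esub> H \<and> {x \<in> carrier G. fun_scale t c f x \<noteq> 0} \<subseteq> \<Union>C"
      using C by (intro exI[of _ C]) (auto simp: fun_scale_def)
    then show "fun_scale t c f \<in> ind_space G \<alpha> H t W \<phi>"
      using f sub lin(2) by (auto simp: ind_space_def fun_scale_def subspace_scale scale_left_commute)
  qed
qed

lemma ind_action_closed:
  assumes G: "group G" and c: "cocycle2 G \<alpha>" and H: "subgroup H G"
    and \<phi>: "alpha_rep (G\<lparr>carrier := H\<rparr>) \<alpha> t W \<phi>"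
    and g: "g \<in> carrier G" and f: "f \<in> ind_space G \<alpha> H t W \<phi>"
  shows "ind_action G \<alpha> t g f \<in> ind_space G \<alpha> H t W \<phi>"
proof -
  interpret group G by (rule G)
  interpret H: subgroup H G by (rule H)
  have vs: "vector_space t" and sub: "module.subspace t W"
    using \<phi> by (auto simp: alpha_rep_def complex_space_def)
  interpret vector_space t by (rule vs)
  have lin: "\<phi> h (t c u) = t c (\<phi> h u)" if "h \<in> H" "u \<in> W" for h u c
    using \<phi> that by (auto simp: alpha_rep_def linear_iso_on_def)
  obtain C where C: "finite C" "C \<subseteq> rcosets\<^bsub>G\<^esub> H" "{x \<in> carrier G. f x \<noteq> 0} \<subseteq> \<Union>C"
    using f by (auto simp: ind_space_def)
  have supp: "{x \<in> carrier G. ind_action G \<alpha> t g f x \<noteq> 0} \<subseteq> \<Union>((\<lambda>K. K #>\<^bsub>G\<^esub> inv\<^bsub>G\<^esub> g) ` C)"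
  proof
    fix x assume "x \<in> {x \<in> carrier G. ind_action G \<alpha> t g f x \<noteq> 0}"
    then have x: "x \<in> carrier G" and "f (x \<otimes>\<^bsub>G\<^esub> g) \<noteq> 0"
      by (auto simp: ind_action_def)
    then obtain K where K: "K \<in> C" "x \<otimes>\<^bsub>G\<^esub> g \<in> K" using C g by blast
    have "x = x \<otimes>\<^bsub>G\<^esub> g \<otimes>\<^bsub>G\<^esub> inv\<^bsub>G\<^esub> g" using x g by (simp add: m_assoc)
    then have "x \<in> K #>\<^bsub>G\<^esub> inv\<^bsub>G\<^esub> g" using K(2) unfolding r_coset_def by blast
    then show "x \<in> \<Union>((\<lambda>K. K #>\<^bsub>G\<^esub> inv\<^bsub>G\<^esub> g) ` C)" using K(1) by blast
  qed
  have cos: "(\<lambda>K. K #>\<^bsub>G\<^esub> inv\<^bsub>G\<^esub> g) ` C \<subseteq> rcosets\<^bsub>G\<^esub> H"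
  proof
    fix L assume "L \<in> (\<lambda>K. K #>\<^bsub>G\<^esub> inv\<^bsub>G\<^esub> g) ` C"
    then obtain K where K: "K \<in> C" "L = K #>\<^bsub>G\<^esub> inv\<^bsub>G\<^esub> g" by blast
    then obtain a where a: "a \<in> carrier G" "K = H #>\<^bsub>G\<^esub> a"
      using C(2) unfolding RCOSETS_def by blast
    have "L = H #>\<^bsub>G\<^esub> (a \<otimes>\<^bsub>G\<^esub> inv\<^bsub>G\<^esub> g)"
      using K a g H.subset by (simp add: coset_mult_assoc)
    then show "L \<in> rcosets\<^bsub>G\<^esub> H" using rcosetsI[OF H.subset, of "a \<otimes>\<^bsub>G\<^esub> inv\<^bsub>G\<^esub> g"] a g by simp
  qed
  have eqv: "ind_action G \<alpha> t g f (h \<otimes>\<^bsub>G\<^esub> x) = t (inverse (\<alpha> h x)) (\<phi> h (ind_action G \<alpha> t g f x))"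
    if h: "h \<in> H" and x: "x \<in> carrier G" for h x
  proof -
    have hG: "h \<in> carrier G" using h by simp
    have nz: "\<alpha> h x \<noteq> 0" "\<alpha> h (x \<otimes>\<^bsub>G\<^esub> g) \<noteq> 0" using c hG x g unfolding cocycle2_def by auto
    have "\<alpha> h x * \<alpha> (h \<otimes>\<^bsub>G\<^esub> x) g = \<alpha> h (x \<otimes>\<^bsub>G\<^esub> g) * \<alpha> x g"
      using c hG x g unfolding cocycle2_def by blast
    then have e: "\<alpha> (h \<otimes>\<^bsub>G\<^esub> x) g * inverse (\<alpha> h (x \<otimes>\<^bsub>G\<^esub> g)) = inverse (\<alpha> h x) * \<alpha> x g"
      using nz by (simp add: field_simps)
    have "f (h \<otimes>\<^bsub>G\<^esub> (x \<otimes>\<^bsub>G\<^esub> g)) = t (inverse (\<alpha> h (x \<otimes>\<^bsub>G\<^esub> g))) (\<phi> h (f (x \<otimes>\<^bsub>G\<^esub> g)))"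
      using f h x g unfolding ind_space_def by auto
    moreover have "f (x \<otimes>\<^bsub>G\<^esub> g) \<in> W" using f x g by (auto simp: ind_space_def)
    ultimately show ?thesis
      using hG x g h e by (simp add: ind_action_def m_assoc lin)
  qed
  have "\<forall>x\<in>carrier G. ind_action G \<alpha> t g f x \<in> W"
    using f g sub by (auto simp: ind_action_def ind_space_def subspace_scale)
  moreover have "\<forall>x. x \<notin> carrier G \<longrightarrow> ind_action G \<alpha> t g f x = 0"
    by (simp add: ind_action_def)
  ultimately show ?thesis
    using eqv supp cos C(1) unfolding ind_space_def by blast
qed

lemma ind_alpha_rep:
  assumes G: "group G" and c: "cocycle2 G \<alpha>" and H: "subgroup H G"
    and \<phi>: "alpha_rep (G\<lparr>carrier := H\<rparr>) \<alpha> t W \<phi>"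
  shows "alpha_rep G \<alpha> (fun_scale t) (ind_space G \<alpha> H t W \<phi>) (ind_action G \<alpha> t)"
proof -
  interpret group G by (rule G)
  have vs: "vector_space t" using \<phi> by (auto simp: alpha_rep_def complex_space_def)
  interpret vector_space t by (rule vs)
  let ?V = "ind_space G \<alpha> H t W \<phi>" and ?r = "ind_action G \<alpha> t"
  note closed = ind_action_closed[OF G c H \<phi>]
  interpret F: vector_space "fun_scale t" by (rule vector_space_fun_scale[OF vs])
  have sub: "F.subspace ?V" by (rule subspace_ind_space[OF G H \<phi>])
  have mult: "?r x (?r y f) = fun_scale t (\<alpha> x y) (?r (x \<otimes>\<^bsub>G\<^esub> y) f)"
    if "x \<in> carrier G" "y \<in> carrier G" for x y f
  proof
    fix z
    show "?r x (?r y f) z = fun_scale t (\<alpha> x y) (?r (x \<otimes>\<^bsub>G\<^esub> y) f) z"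
    proof (cases "z \<in> carrier G")
      case True
      then have "\<alpha> z x * \<alpha> (z \<otimes>\<^bsub>G\<^esub> x) y = \<alpha> z (x \<otimes>\<^bsub>G\<^esub> y) * \<alpha> x y"
        using c that unfolding cocycle2_def by blast
      then show ?thesis using True that by (simp add: ind_action_def fun_scale_def m_assoc mult.commute)
    qed (simp add: ind_action_def fun_scale_def)
  qed
  have one: "?r \<one>\<^bsub>G\<^esub> f = fun_scale t (\<alpha> \<one>\<^bsub>G\<^esub> \<one>\<^bsub>G\<^esub>) f" if "f \<in> ?V" for f
  proof
    fix x show "?r \<one>\<^bsub>G\<^esub> f x = fun_scale t (\<alpha> \<one>\<^bsub>G\<^esub> \<one>\<^bsub>G\<^esub>) f x"
    proof (cases "x \<in> carrier G")
      case True
      show ?thesis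
        unfolding ind_action_def fun_scale_def cocycle2_one[OF G c True] using True by simp
    next
      case False
      then have "f x = 0" using that by (simp add: ind_space_def)
      then show ?thesis using False by (simp add: ind_action_def fun_scale_def)
    qed
  qed
  have lin: "?r g (f + f') = ?r g f + ?r g f'" "?r g (fun_scale t a f) = fun_scale t a (?r g f)" for g f f' a
    by (auto simp: ind_action_def fun_scale_def fun_eq_iff scale_right_distrib scale_left_commute)
  have bij: "bij_betw (?r g) ?V ?V" if g: "g \<in> carrier G" for g
  proof -
    let ?k = "\<lambda>x y. inverse (\<alpha> x y * \<alpha> \<one>\<^bsub>G\<^esub> \<one>\<^bsub>G\<^esub>)"
    let ?i = "inv\<^bsub>G\<^esub> g"
    have nz: "\<alpha> g ?i \<noteq> 0" "\<alpha> ?i g \<noteq> 0" "\<alpha> \<one>\<^bsub>G\<^esub> \<one>\<^bsub>G\<^esub> \<noteq> 0"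
      using c g unfolding cocycle2_def by auto
    have k: "inverse (a * b) * (a * b) = 1" if "a \<noteq> 0" "b \<noteq> 0" for a b :: complex
      using that by (intro left_inverse) simp
    have r: "?r g (fun_scale t (?k g ?i) (?r ?i f)) = f" if "f \<in> ?V" for f
      using mult[of g ?i f] g one[OF that] nz
      by (simp add: lin k del: inverse_mult_distrib)
    have l: "fun_scale t (?k ?i g) (?r ?i (?r g f)) = f" if "f \<in> ?V" for f
      using mult[of ?i g f] g one[OF that] nz
      by (simp add: k del: inverse_mult_distrib)
    show ?thesis
    proof (rule bij_betw_imageI)
      show "inj_on (?r g) ?V" using l by (metis inj_onI)
      show "?r g ` ?V = ?V"
      proof
        show "?r g ` ?V \<subseteq> ?V" using closed[OF g] by blast
        show "?V \<subseteq> ?r g ` ?V"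
        proof
          fix f assume f: "f \<in> ?V"
          have "fun_scale t (?k g ?i) (?r ?i f) \<in> ?V"
            using F.subspace_scale[OF sub closed[OF _ f]] g by simp
          then show "f \<in> ?r g ` ?V" using r[OF f] by (metis image_eqI)
        qed
      qed
    qed
  qed
  show ?thesis
    unfolding alpha_rep_def complex_space_def linear_iso_on_def
    by (intro conjI ballI allI F.vector_space_axioms sub bij lin mult)
qed

lemma one_dim_alpha_rep_imp_alpha_rep:
  assumes "one_dim_alpha_rep H \<alpha> \<psi>"
  shows "alpha_rep H \<alpha> (*) UNIV (\<lambda>h z. \<psi> h * z)"
proof -
  interpret vector_space "(*) :: complex \<Rightarrow> complex \<Rightarrow> complex"
    by unfold_locales (simp_all add: algebra_simps)
  have "bij ((*) (\<psi> h))" if "h \<in> carrier H" for h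
    using assms that by (intro bij_betw_byWitness[where f' = "\<lambda>z. z / \<psi> h"]) (auto simp: one_dim_alpha_rep_def)
  moreover have "\<psi> x * (\<psi> y * v) = \<alpha> x y * (\<psi> (x \<otimes>\<^bsub>H\<^esub> y) * v)"
    if "x \<in> carrier H" "y \<in> carrier H" for x y v
    using assms that unfolding one_dim_alpha_rep_def by (metis mult.assoc)
  ultimately show ?thesis
    unfolding alpha_rep_def complex_space_def linear_iso_on_def
    using vector_space_axioms subspace_UNIV by (simp add: distrib_left mult.left_commute)
qed


section \<open>Monomial representations and finite weight\<close>

text \<open>
  The one-dimensional representation \<open>\<psi>\<close> acts on \<open>\<complex>\<close> by \<open>\<lambda>h z. \<psi> h * z\<close>.
\<close>

definition monomial_rep ::
  "('g, 'm) monoid_scheme \<Rightarrow> ('g \<Rightarrow> 'g \<Rightarrow> complex) \<Rightarrow>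
   (complex \<Rightarrow> 'v \<Rightarrow> 'v::ab_group_add) \<Rightarrow> 'v set \<Rightarrow> ('g \<Rightarrow> 'v \<Rightarrow> 'v) \<Rightarrow> bool" where
  "monomial_rep G \<alpha> s V \<rho> \<longleftrightarrow>
     (\<exists>H \<psi>. subgroup H G \<and> one_dim_alpha_rep (G\<lparr>carrier := H\<rparr>) \<alpha> \<psi> \<and>
        equivalent_reps G s V \<rho>
          (fun_scale (*)) (ind_space G \<alpha> H (*) UNIV (\<lambda>h z. \<psi> h * z)) (ind_action G \<alpha> (*)))"

definition weight_space ::
  "'g set \<Rightarrow> ('g \<Rightarrow> complex) \<Rightarrow>
   (complex \<Rightarrow> 'v \<Rightarrow> 'v::ab_group_add) \<Rightarrow> 'v set \<Rightarrow> ('g \<Rightarrow> 'v \<Rightarrow> 'v) \<Rightarrow> 'v set" where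
  "weight_space H \<psi> s V \<rho> = {v \<in> V. \<forall>h\<in>H. \<rho> h v = s (\<psi> h) v}"

definition finite_dim_subspace :: "(complex \<Rightarrow> 'v \<Rightarrow> 'v::ab_group_add) \<Rightarrow> 'v set \<Rightarrow> bool" where
  "finite_dim_subspace s U \<longleftrightarrow> (\<exists>B. finite B \<and> B \<subseteq> U \<and> module.span s B = U)"

definition finite_weight ::
  "('g, 'm) monoid_scheme \<Rightarrow> ('g \<Rightarrow> 'g \<Rightarrow> complex) \<Rightarrow>
   (complex \<Rightarrow> 'v \<Rightarrow> 'v::ab_group_add) \<Rightarrow> 'v set \<Rightarrow> ('g \<Rightarrow> 'v \<Rightarrow> 'v) \<Rightarrow> bool" where
  "finite_weight G \<alpha> s V \<rho> \<longleftrightarrow>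
     (\<exists>H \<psi>. subgroup H G \<and> one_dim_alpha_rep (G\<lparr>carrier := H\<rparr>) \<alpha> \<psi> \<and>
        weight_space H \<psi> s V \<rho> \<noteq> {0} \<and> finite_dim_subspace s (weight_space H \<psi> s V \<rho>))"

end

theory Submission
  imports Defs "HOL-Algebra.Zassenhaus" "HOL-Computational_Algebra.Fundamental_Theorem_Algebra"
    "HOL-Analysis.Continuum_Not_Denumerable"
begin

text \<open>
  The group acts on the subspaces of \<open>V\<close>, and the cocycle contributes nothing but scalars to this
  action.

  Finite weight implies monomial. Call an \<open>H\<close>-invariant subspace \<open>E\<close> saturated if no nonzero part of
  \<open>E\<close> is isomorphic over \<open>H\<close> to a part of \<open>V\<close> that meets \<open>E\<close> trivially; weight spaces are saturated.
  Since subgroups of \<open>G\<close> satisfy the ascending chain condition, there is a maximal \<open>H\<close> that has a nonzero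
  finite-dimensional saturated \<open>E\<close>, and \<open>E\<close> can be taken minimal. Maximality shows that \<open>H\<close> is the
  stabilizer of \<open>E\<close> and that \<open>N(H)/H\<close> is torsion free, so that \<open>H\<close> is isolated in the nilpotent group
  \<open>G\<close>. Climbing the iterated normalizers of \<open>H\<close>, which reach \<open>G\<close>, one finds that the translates \<open>g E\<close>
  are independent: a coincidence at one stage would give a finite-dimensional representation of a
  conjugate of \<open>H\<close> inside a sum of translates, where orbits on cosets are finite only if that
  conjugate lies in a conjugate of \<open>H\<close> by an element of the previous stage. Hence \<open>V\<close> is induced from a
  finite-dimensional \<open>E\<close>. If \<open>dim E\<close> is least possible, then \<open>dim E = 1\<close>: otherwise some \<open>a \<in> H\<close> acts
  on \<open>E\<close> as a non-scalar that commutes with \<open>H\<close> up to scalars, and \<open>V\<close> is induced from an eigenspace of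
  \<open>a\<close>.

  Monomial implies finite weight. By Frobenius reciprocity, the vectors of weight \<open>\<psi>\<close> in the
  representation induced from \<open>\<psi>\<close> correspond to its endomorphisms, which are scalars by Schur's lemma
  because the dimension is countable.
\<close>

section \<open>Finitely generated nilpotent groups\<close>

text \<open>The obstacle is that \<open>V\<close> may be infinite dimensional and need not be
  completely reducible over \<open>H\<close>, so isotypic decompositions over \<open>H\<close> are
  not at hand. Weight spaces alone do not suffice, since a span of translates of a weight space is
  in general not a weight space. Saturation is the trait of weight spaces that survives every
  operation used: conjugation, intersection, spans of pairwise disjoint members, and enlarging
  \<open>H\<close> inside the stabilizer. Translates of a minimal \<open>E\<close> by elements
  normalizing \<open>H\<close> therefore coincide or are disjoint, and pairwise disjoint families
  are independent. Torsion in \<open>N(H)/H\<close> would let a finite sum of translates be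
  stabilized by a larger group, against maximality. Isolation then turns the outcome of a pigeonhole
  argument, that a positive power of an element fixes a coset, into the statement that the element
  itself fixes it. Above \<open>N(H)\<close> the spans of translates may have infinite dimension,
  and finite-dimensional saturation no longer applies to them. Its place is taken by the property
  that every nonzero invariant subspace of such a span meets \<open>E\<close>, so that all
  comparisons are made on finite-dimensional pieces.\<close>

context group
begin

lemma mult_inv_cancel: "x \<in> carrier G \<Longrightarrow> y \<in> carrier G \<Longrightarrow> x \<otimes> (inv x \<otimes> y) = y"
  by (simp add: m_assoc[symmetric])

lemma inv_mult_cancel: "x \<in> carrier G \<Longrightarrow> y \<in> carrier G \<Longrightarrow> inv x \<otimes> (x \<otimes> y) = y"
  by (simp add: m_assoc[symmetric])

text \<open>As rewrite rules these nest words to the right, push inverses to the letters and cancel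
  adjacent inverse pairs; the word identities below are closed this way.\<close>

lemmas word_simps = m_assoc inv_mult_group mult_inv_cancel inv_mult_cancel

abbreviation commutator :: "'a \<Rightarrow> 'a \<Rightarrow> 'a" where
  "commutator x y \<equiv> x \<otimes> y \<otimes> inv x \<otimes> inv y"

abbreviation lcs :: "nat \<Rightarrow> 'a set" where
  "lcs \<equiv> lower_central G"

lemma subset_generate: "S \<subseteq> generate G S"
  by (auto intro: generate.incl)

section \<open>Commutator identities and the lower central series\<close>

lemma commutator_mult_right:
  assumes "a \<in> carrier G" "b \<in> carrier G" "c \<in> carrier G"
  shows "commutator a (b \<otimes> c) = commutator a b \<otimes> (b \<otimes> commutator a c \<otimes> inv b)"
  using assms by (simp add: word_simps)

lemma commutator_mult_left:
  assumes "a \<in> carrier G" "b \<in> carrier G" "c \<in> carrier G"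
  shows "commutator (a \<otimes> b) c = a \<otimes> commutator b c \<otimes> inv a \<otimes> commutator a c"
  using assms by (simp add: word_simps)

lemma commutator_inv_right:
  assumes "a \<in> carrier G" "b \<in> carrier G"
  shows "commutator a (inv b) = inv b \<otimes> inv (commutator a b) \<otimes> b"
  using assms by (simp add: word_simps)

lemma commutator_inv_left:
  assumes "a \<in> carrier G" "b \<in> carrier G"
  shows "commutator (inv a) b = inv a \<otimes> inv (commutator a b) \<otimes> a"
  using assms by (simp add: word_simps)

text \<open>Conjugation permutes the generators: a conjugated commutator is the commutator of the
  conjugated entries, and the previous term is normal by induction.\<close>

lemma lcs_normal: "lcs n \<lhd> G"
proof (induction n)
  case 0
  show ?case using normal_self by simp
next
  case (Suc n)
  interpret N: normal "lcs n" G by (rule Suc)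
  show ?case
    unfolding lower_central.simps
  proof (rule normal_generateI)
    show "{commutator x y | x y. x \<in> lcs n \<and> y \<in> carrier G} \<subseteq> carrier G"
      using N.subset by auto
  next
    fix h g assume "h \<in> {commutator x y | x y. x \<in> lcs n \<and> y \<in> carrier G}" and g: "g \<in> carrier G"
    then obtain x y where xy: "x \<in> lcs n" "y \<in> carrier G" "h = commutator x y" by blast
    have x: "x \<in> carrier G" using xy N.subset by blast
    have "g \<otimes> h \<otimes> inv g = commutator (g \<otimes> x \<otimes> inv g) (g \<otimes> y \<otimes> inv g)"
      using x xy g by (simp add: word_simps)
    moreover have "g \<otimes> x \<otimes> inv g \<in> lcs n" using N.inv_op_closed2 g xy by blast
    moreover have "g \<otimes> y \<otimes> inv g \<in> carrier G" using g xy by simp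
    ultimately show "g \<otimes> h \<otimes> inv g \<in> {commutator x y | x y. x \<in> lcs n \<and> y \<in> carrier G}" by blast
  qed
qed

lemma lcs_subgroup: "subgroup (lcs n) G"
  using lcs_normal normal_imp_subgroup by blast

lemma lcs_carrier: "x \<in> lcs n \<Longrightarrow> x \<in> carrier G"
  using lcs_subgroup subgroup.mem_carrier by metis

lemma lcs_conj: "x \<in> lcs n \<Longrightarrow> g \<in> carrier G \<Longrightarrow> g \<otimes> x \<otimes> inv g \<in> lcs n"
  using lcs_normal normal.inv_op_closed2 by metis

lemma lcs_commutator: "a \<in> lcs n \<Longrightarrow> g \<in> carrier G \<Longrightarrow> commutator a g \<in> lcs (Suc n)"
  by (auto intro!: generate.incl)

declare lower_central.simps(2) [simp del]

lemma lcs_Suc_subset: "lcs (Suc n) \<subseteq> lcs n"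
proof -
  have "{commutator x y | x y. x \<in> lcs n \<and> y \<in> carrier G} \<subseteq> lcs n"
  proof safe
    fix x y assume x: "x \<in> lcs n" and y: "y \<in> carrier G"
    have "commutator x y = x \<otimes> (y \<otimes> inv x \<otimes> inv y)"
      using lcs_carrier[OF x] y by (simp add: m_assoc)
    moreover have "y \<otimes> inv x \<otimes> inv y \<in> lcs n"
      using lcs_conj lcs_subgroup subgroup.m_inv_closed x y by metis
    ultimately show "commutator x y \<in> lcs n"
      using lcs_subgroup subgroup.m_closed x by metis
  qed
  then show ?thesis
    using generate_subgroup_incl lcs_subgroup by (simp add: lower_central.simps(2))
qed

text \<open>Modulo \<open>lcs (Suc i)\<close> the term \<open>lcs i\<close> is central: conjugation
  changes \<open>r\<close> only by a commutator in \<open>lcs (Suc i)\<close>, which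
  \<open>R\<close> contains. Every subgroup between two consecutive terms is therefore
  normal.\<close>

lemma subgroup_between_lcs_conj:
  assumes R: "subgroup R G" "lcs (Suc i) \<subseteq> R" "R \<subseteq> lcs i"
    and r: "r \<in> R" and g: "g \<in> carrier G"
  shows "g \<otimes> r \<otimes> inv g \<in> R"
proof -
  have rG: "r \<in> carrier G" using R r subgroup.mem_carrier by metis
  have "commutator r g \<in> R" using lcs_commutator R r g by blast
  then have "inv (commutator r g) \<otimes> r \<in> R"
    using R r by (simp add: subgroup.m_inv_closed subgroup.m_closed)
  then show ?thesis using rG g by (simp add: word_simps)
qed

text \<open>\<open>R\<close> is normal and contains \<open>lcs (Suc (Suc i))\<close>, so modulo
  \<open>R\<close> the commutator is multiplicative in each entry, up to conjugation. Hence
  generators suffice: of \<open>G\<close> in the right entry, and of \<open>lcs i\<close> modulo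
  \<open>lcs (Suc i)\<close> in the left one.\<close>

lemma lcs_generated_by_commutators:
  assumes R: "subgroup R G" "lcs (Suc (Suc i)) \<subseteq> R" "R \<subseteq> lcs (Suc i)"
    and F: "F \<subseteq> lcs i" "generate G (F \<union> lcs (Suc i)) = lcs i"
    and S: "S \<subseteq> carrier G" "generate G S = carrier G"
    and FS: "\<And>f x. f \<in> F \<Longrightarrow> x \<in> S \<Longrightarrow> commutator f x \<in> R"
  shows "R = lcs (Suc i)"
proof -
  interpret R: subgroup R G by (rule R)
  note conj = subgroup_between_lcs_conj[OF R]
  have conj': "inv g \<otimes> r \<otimes> g \<in> R" if "r \<in> R" "g \<in> carrier G" for r g
    using conj[of r "inv g"] that by simp
  have 1: "commutator f b \<in> R" if f: "f \<in> F" and b: "b \<in> carrier G" for f b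
  proof -
    have fG: "f \<in> carrier G" using f F lcs_carrier by blast
    have "b \<in> generate G S" using b S by simp
    then show ?thesis
    proof induction
      case one
      then show ?case using fG by simp
    next
      case (incl h)
      then show ?case using FS f by simp
    next
      case (inv h)
      then have h: "h \<in> carrier G" using S by blast
      show ?case unfolding commutator_inv_right[OF fG h]
        using conj'[OF _ h] FS[OF f inv] by simp
    next
      case (eng h1 h2)
      then have h: "h1 \<in> carrier G" "h2 \<in> carrier G" using S by blast+
      show ?case unfolding commutator_mult_right[OF fG h]
        using conj[OF _ h(1)] eng by simp
    qed
  qed
  have 2: "commutator a b \<in> R" if a: "a \<in> lcs i" and b: "b \<in> carrier G" for a b
  proof -
    have FG: "F \<union> lcs (Suc i) \<subseteq> carrier G" using F lcs_carrier by blast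
    have 3: "commutator f b \<in> R" if "f \<in> F \<union> lcs (Suc i)" for f
      using 1 that b lcs_commutator[of f "Suc i" b] R(2) by blast
    have "a \<in> generate G (F \<union> lcs (Suc i))" using a F by simp
    then show ?thesis
    proof induction
      case one
      then show ?case using b by simp
    next
      case (incl h)
      then show ?case using 3 by simp
    next
      case (inv h)
      then have h: "h \<in> carrier G" using FG by blast
      show ?case unfolding commutator_inv_left[OF h b]
        using conj'[OF _ h] 3[OF inv] by simp
    next
      case (eng h1 h2)
      then have h: "h1 \<in> carrier G" "h2 \<in> carrier G" using FG generate_in_carrier by metis+
      show ?case unfolding commutator_mult_left[OF h b]
        using conj[OF _ h(1)] eng by simp
    qed
  qed
  have "lcs (Suc i) \<subseteq> R"
    unfolding lower_central.simps(2)
    by (rule generate_subgroup_incl[OF _ R(1)]) (use 2 in blast)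
  then show ?thesis using R by blast
qed

text \<open>Maximal elements of families replace ascending chains, so that no choice of a chain is needed.\<close>

definition noetherian_subset :: "'a set \<Rightarrow> bool" where
  "noetherian_subset S \<longleftrightarrow>
     (\<forall>\<H>. \<H> \<noteq> {} \<and> (\<forall>H\<in>\<H>. subgroup H G \<and> H \<subseteq> S) \<longrightarrow> (\<exists>H\<in>\<H>. \<forall>H'\<in>\<H>. H \<subseteq> H' \<longrightarrow> H' = H))"

section \<open>The maximal condition on subgroups\<close>

lemma noetherian_subset_mono:
  assumes "noetherian_subset T" and "S \<subseteq> T"
  shows "noetherian_subset S"
  unfolding noetherian_subset_def
proof (intro allI impI)
  fix \<H> assume "\<H> \<noteq> {} \<and> (\<forall>H\<in>\<H>. subgroup H G \<and> H \<subseteq> S)"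
  then have "\<H> \<noteq> {} \<and> (\<forall>H\<in>\<H>. subgroup H G \<and> H \<subseteq> T)" using assms(2) by blast
  then show "\<exists>H\<in>\<H>. \<forall>H'\<in>\<H>. H \<subseteq> H' \<longrightarrow> H' = H"
    using assms(1) unfolding noetherian_subset_def by (elim allE impE)
qed

text \<open>A member containing the least positive number \<open>d\<close> that occurs anywhere is
  maximal, since remainders modulo \<open>d\<close> of elements of a larger member must vanish. If
  no positive number occurs, every member is \<open>{0}\<close>.\<close>

lemma exists_maximal_int_ideal:
  fixes \<D> :: "int set set"
  assumes ne: "\<D> \<noteq> {}"
    and ideal: "\<And>D. D \<in> \<D> \<Longrightarrow> 0 \<in> D" "\<And>D k m. D \<in> \<D> \<Longrightarrow> k \<in> D \<Longrightarrow> m \<in> D \<Longrightarrow> k - m \<in> D"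
  shows "\<exists>D\<in>\<D>. \<forall>D'\<in>\<D>. D \<subseteq> D' \<longrightarrow> D' = D"
proof -
  have neg: "- k \<in> D" if "D \<in> \<D>" "k \<in> D" for D k
    using ideal(2)[OF that(1) ideal(1) that(2)] that by simp
  have add: "k + m \<in> D" if "D \<in> \<D>" "k \<in> D" "m \<in> D" for D k m
    using ideal(2)[OF that(1,2) neg[OF that(1,3)]] by simp
  have mul: "of_nat n * k \<in> D" if "D \<in> \<D>" "k \<in> D" for D k n
    by (induction n) (auto simp: ideal(1)[OF that(1)] distrib_right intro!: add that)
  have mul: "n * k \<in> D" if "D \<in> \<D>" "k \<in> D" for D k n
    using mul[OF that, of "nat n"] mul[OF that(1) neg[OF that], of "nat (- n)"]
    by (cases "n \<ge> 0") auto
  define P where "P n \<longleftrightarrow> n > 0 \<and> (\<exists>D\<in>\<D>. int n \<in> D)" for n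
  show ?thesis
  proof (cases "\<exists>n. P n")
    case False
    have "D \<subseteq> {0}" if D: "D \<in> \<D>" for D
    proof
      fix k assume k: "k \<in> D"
      have "k = 0"
      proof (rule ccontr)
        assume "k \<noteq> 0"
        moreover have "int (nat \<bar>k\<bar>) \<in> D" using k neg[OF D k] by (simp add: abs_if)
        ultimately have "P (nat \<bar>k\<bar>)" unfolding P_def by (intro conjI bexI[OF _ D]) auto
        then show False using False by blast
      qed
      then show "k \<in> {0}" by simp
    qed
    then have "D = {0}" if "D \<in> \<D>" for D using that ideal(1) by blast
    then show ?thesis using ne by blast
  next
    case True
    define d where "d = (LEAST n. P n)"
    have "P d" unfolding d_def using True by (rule LeastI_ex)
    then obtain D where D: "D \<in> \<D>" "int d \<in> D" and d: "d > 0" unfolding P_def by blast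
    have "D' = D" if D': "D' \<in> \<D>" "D \<subseteq> D'" for D'
    proof
      show "D' \<subseteq> D"
      proof
        fix k assume k: "k \<in> D'"
        have "k mod int d = k - k div int d * int d" by (simp add: minus_div_mult_eq_mod)
        also have "\<dots> \<in> D'" using ideal(2) D' k mul D by blast
        finally have "int (nat (k mod int d)) \<in> D'" using d by simp
        moreover have "\<not> P (nat (k mod int d))"
          using d by (intro not_less_Least) (simp add: d_def[symmetric] nat_less_iff)
        ultimately have "nat (k mod int d) = 0"
          using D' unfolding P_def by (metis gr0I)
        then have "k mod int d = 0" using d pos_mod_sign[of "int d" k] by linarith
        then have "k = k div int d * int d" by auto
        then show "k \<in> D" using mul[OF D] by metis
      qed
    qed (rule D')
    then show ?thesis using D by blast
  qed
qed

text \<open>The maximal condition passes to extensions of \<open>N\<close> by powers of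
  \<open>g\<close>. A subgroup is measured by its intersection with \<open>N\<close> and by the
  exponents \<open>k\<close> for which it meets the coset \<open>g^k N\<close>. The two are
  maximized one after the other, and nested subgroups that agree in both are equal.\<close>

lemma noetherian_subset_extend:
  assumes N: "subgroup N G" "noetherian_subset N" and g: "g \<in> carrier G"
    and normal: "\<And>n k. n \<in> N \<Longrightarrow> g [^] (k::int) \<otimes> n \<otimes> inv (g [^] k) \<in> N"
    and S: "\<And>s. s \<in> S \<Longrightarrow> \<exists>k::int. \<exists>n\<in>N. s = g [^] k \<otimes> n"
  shows "noetherian_subset S"
  unfolding noetherian_subset_def
proof (intro allI impI)
  fix \<H> assume "\<H> \<noteq> {} \<and> (\<forall>H\<in>\<H>. subgroup H G \<and> H \<subseteq> S)"
  then have ne: "\<H> \<noteq> {}" and \<H>: "\<And>H. H \<in> \<H> \<Longrightarrow> subgroup H G" "\<And>H. H \<in> \<H> \<Longrightarrow> H \<subseteq> S" by auto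
  interpret N: subgroup N G by (rule N)
  define D where "D H = {k::int. \<exists>n\<in>N. g [^] k \<otimes> n \<in> H}" for H
  have "\<exists>K\<in>(\<lambda>H. H \<inter> N) ` \<H>. \<forall>K'\<in>(\<lambda>H. H \<inter> N) ` \<H>. K \<subseteq> K' \<longrightarrow> K' = K"
    using ne \<H> N(1) subgroups_Inter_pair
    by (intro N(2)[unfolded noetherian_subset_def, rule_format]) auto
  then obtain H0 where H0: "H0 \<in> \<H>"
    "\<And>H. H \<in> \<H> \<Longrightarrow> H0 \<inter> N \<subseteq> H \<inter> N \<Longrightarrow> H \<inter> N = H0 \<inter> N" by auto
  \<comment> \<open>Exponents are compared only among members whose intersection with
    \<open>N\<close> is the maximal one already found.\<close>
  define \<K> where "\<K> = {H \<in> \<H>. H \<inter> N = H0 \<inter> N}"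
  have "\<exists>D0\<in>D ` \<K>. \<forall>D'\<in>D ` \<K>. D0 \<subseteq> D' \<longrightarrow> D' = D0"
  proof (rule exists_maximal_int_ideal)
    show "D ` \<K> \<noteq> {}" using H0 unfolding \<K>_def by blast
  next
    fix E assume "E \<in> D ` \<K>"
    then obtain H where H: "H \<in> \<H>" "E = D H" unfolding \<K>_def by blast
    interpret H: subgroup H G by (rule \<H>(1)[OF H(1)])
    show "0 \<in> E" unfolding H D_def by (auto intro!: bexI[of _ \<one>])
    fix k m assume "k \<in> E" "m \<in> E"
    then obtain n n' where n: "n \<in> N" "n' \<in> N" "g [^] k \<otimes> n \<in> H" "g [^] m \<otimes> n' \<in> H"
      unfolding H D_def by blast
    have nG: "n \<in> carrier G" "n' \<in> carrier G" using n by auto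
    have "g [^] k \<otimes> n \<otimes> inv (g [^] m \<otimes> n') \<in> H" using n by simp
    also have "g [^] k \<otimes> n \<otimes> inv (g [^] m \<otimes> n')
      = g [^] k \<otimes> inv (g [^] m) \<otimes> (g [^] m \<otimes> (n \<otimes> inv n') \<otimes> inv (g [^] m))"
      using nG g by (simp add: word_simps)
    also have "g [^] k \<otimes> inv (g [^] m) = g [^] (k - m)"
      using g by (simp add: int_pow_diff)
    finally show "k - m \<in> E"
      using normal[of "n \<otimes> inv n'" m] n unfolding H D_def by auto
  qed
  then obtain H1 where H1': "H1 \<in> \<K>"
    and max: "\<And>H. H \<in> \<K> \<Longrightarrow> D H1 \<subseteq> D H \<Longrightarrow> D H = D H1" by auto
  have H1: "H1 \<in> \<H>" "H1 \<inter> N = H0 \<inter> N" using H1' unfolding \<K>_def by auto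
  have "H = H1" if H: "H \<in> \<H>" "H1 \<subseteq> H" for H
  proof
    show "H \<subseteq> H1"
    proof
      fix h assume h: "h \<in> H"
      have HN: "H \<inter> N = H0 \<inter> N"
        using H H1(2) by (intro H0(2)) auto
      have "D H1 \<subseteq> D H" using H unfolding D_def by blast
      then have DD: "D H = D H1"
        using H HN by (intro max) (simp_all add: \<K>_def)
      obtain k n where k: "n \<in> N" "h = g [^] (k::int) \<otimes> n" using S[OF subsetD[OF \<H>(2)[OF H(1)] h]] by blast
      then have "k \<in> D H1" using h DD unfolding D_def by blast
      then obtain n' where n': "n' \<in> N" "g [^] k \<otimes> n' \<in> H1" unfolding D_def by blast
      have nG: "n \<in> carrier G" "n' \<in> carrier G" using k n' by auto
      interpret H: subgroup H G by (rule \<H>(1)[OF H(1)])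
      interpret H1: subgroup H1 G by (rule \<H>(1)[OF H1(1)])
      \<comment> \<open>\<open>h\<close> and the element of \<open>H1\<close> with the same exponent
        differ by an element of \<open>H \<inter> N\<close>, and \<open>H1\<close> meets
        \<open>N\<close> in the same set.\<close>
      have "inv (g [^] k \<otimes> n') \<otimes> h = inv n' \<otimes> n"
        using nG g unfolding k(2) by (simp add: word_simps)
      moreover have "inv (g [^] k \<otimes> n') \<otimes> h \<in> H"
        by (rule H.m_closed[OF H.m_inv_closed[OF subsetD[OF H(2) n'(2)]] h])
      moreover have "inv n' \<otimes> n \<in> N"
        by (rule N.m_closed[OF N.m_inv_closed[OF n'(1)] k(1)])
      ultimately have "inv n' \<otimes> n \<in> H \<inter> N" by simp
      then have "inv n' \<otimes> n \<in> H1" unfolding HN H1(2)[symmetric] by simp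
      then have "g [^] k \<otimes> n' \<otimes> (inv n' \<otimes> n) \<in> H1" by (rule H1.m_closed[OF n'(2)])
      then show "h \<in> H1" using nG g unfolding k(2) by (simp add: word_simps)
    qed
  qed (rule H)
  then show "\<exists>H\<in>\<H>. \<forall>H'\<in>\<H>. H \<subseteq> H' \<longrightarrow> H' = H" using H1 by blast
qed

text \<open>Powers of \<open>g\<close> can be collected on the left, because \<open>N\<close> is
  stable under conjugation by all of them, negative ones included.\<close>

lemma generate_insert_normalizing:
  assumes N: "subgroup N G" and g: "g \<in> carrier G"
    and normal: "\<And>n k. n \<in> N \<Longrightarrow> g [^] (k::int) \<otimes> n \<otimes> inv (g [^] k) \<in> N"
    and s: "s \<in> generate G (insert g N)"
  shows "\<exists>k::int. \<exists>n\<in>N. s = g [^] k \<otimes> n"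
proof -
  interpret N: subgroup N G by (rule N)
  have mult: "\<exists>k. \<exists>n\<in>N. g [^] i \<otimes> a \<otimes> (g [^] j \<otimes> b) = g [^] (k::int) \<otimes> n"
    if "a \<in> N" "b \<in> N" for i j :: int and a b
  proof -
    have G: "a \<in> carrier G" "b \<in> carrier G" using that by auto
    have "g [^] i \<otimes> a \<otimes> (g [^] j \<otimes> b)
        = g [^] i \<otimes> g [^] j \<otimes> (g [^] (- j) \<otimes> a \<otimes> inv (g [^] (- j)) \<otimes> b)"
      using G g by (simp add: int_pow_neg word_simps)
    also have "g [^] i \<otimes> g [^] j = g [^] (i + j)" using g by (simp add: int_pow_mult)
    finally show ?thesis using normal[OF that(1), of "- j"] that by blast
  qed
  have triv: "\<exists>k. \<exists>n\<in>N. a = g [^] (k::int) \<otimes> n" if "a \<in> N" for a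
    using that by (auto intro!: exI[of _ 0])
  have "g = g [^] (1::int) \<otimes> \<one>" using g by simp
  then have g1: "\<exists>k. \<exists>n\<in>N. g = g [^] (k::int) \<otimes> n" by (intro exI bexI[OF _ N.one_closed])
  have "inv g = g [^] (- 1 :: int) \<otimes> \<one>" using int_pow_neg[OF g, of 1] g by simp
  then have g2: "\<exists>k. \<exists>n\<in>N. inv g = g [^] (k::int) \<otimes> n" by (intro exI bexI[OF _ N.one_closed])
  show ?thesis
    using s
  proof induction
    case one
    show ?case using triv by simp
  next
    case (incl h)
    then show ?case using triv g1 by (metis insertE)
  next
    case (inv h)
    then show ?case using triv[OF N.m_inv_closed] g2 by (metis insertE)
  next
    case (eng h1 h2)
    then obtain i a j b where "a \<in> N" "h1 = g [^] (i::int) \<otimes> a" "b \<in> N" "h2 = g [^] (j::int) \<otimes> b"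
      by blast
    then show ?case using mult by simp
  qed
qed

text \<open>Generators are adjoined one at a time. Each intermediate group lies between
  \<open>lcs (Suc i)\<close> and \<open>lcs i\<close>, hence is normal, so that adjoining
  \<open>f\<close> is an extension by powers of \<open>f\<close>.\<close>

lemma noetherian_lcs_step:
  assumes "noetherian_subset (lcs (Suc i))" "finite F" "F \<subseteq> lcs i"
  shows "noetherian_subset (generate G (F \<union> lcs (Suc i)))"
  using assms(2,3)
proof (induction F)
  case empty
  have "generate G (lcs (Suc i)) = lcs (Suc i)"
    using generate_subgroup_incl[OF subset_refl lcs_subgroup] subset_generate by blast
  then show ?case using assms(1) by simp
next
  case (insert f F)
  define N where "N = generate G (F \<union> lcs (Suc i))"
  have FG: "F \<union> lcs (Suc i) \<subseteq> carrier G" and f: "f \<in> carrier G"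
    using insert.prems lcs_carrier by blast+
  have N: "subgroup N G" unfolding N_def by (rule generate_is_subgroup[OF FG])
  have FN: "F \<union> lcs (Suc i) \<subseteq> N" unfolding N_def by (rule subset_generate)
  have "N \<subseteq> lcs i"
    unfolding N_def using insert.prems lcs_Suc_subset by (intro generate_subgroup_incl lcs_subgroup) auto
  then have norm: "f [^] (k::int) \<otimes> n \<otimes> inv (f [^] k) \<in> N" if "n \<in> N" for n k
    using subgroup_between_lcs_conj[OF N, of i n "f [^] k"] FN f that by blast
  have "noetherian_subset N" unfolding N_def using insert by blast
  then have "noetherian_subset (generate G (insert f N))"
    by (rule noetherian_subset_extend[OF N _ f norm generate_insert_normalizing[OF N f norm]])
  moreover have "generate G (insert f F \<union> lcs (Suc i)) \<subseteq> generate G (insert f N)"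
    using FN by (intro mono_generate) auto
  ultimately show ?case by (rule noetherian_subset_mono)
qed

lemma noetherian_finitely_generated_nilpotent:
  assumes "finitely_generated_group G" and "nilpotent_group G"
  shows "noetherian_subset (carrier G)"
proof -
  obtain S where S: "finite S" "S \<subseteq> carrier G" "generate G S = carrier G"
    using assms(1) unfolding finitely_generated_group_def by blast
  obtain n where n: "lcs n = {\<one>}" using assms(2) unfolding nilpotent_group_def by blast
  have fg: "\<exists>F. finite F \<and> F \<subseteq> lcs i \<and> generate G (F \<union> lcs (Suc i)) = lcs i" for i
  proof (induction i)
    case 0
    have "generate G (S \<union> lcs (Suc 0)) = carrier G"
      using mono_generate[of S "S \<union> lcs (Suc 0)"] S generate_incl[of "S \<union> lcs (Suc 0)"] lcs_carrier
      by blast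
    then show ?case using S by auto
  next
    case (Suc i)
    then obtain F where F: "finite F" "F \<subseteq> lcs i" "generate G (F \<union> lcs (Suc i)) = lcs i" by blast
    \<comment> \<open>Commutators of generators of one factor with generators of \<open>G\<close>
      generate the next factor.\<close>
    define F' where "F' = (\<lambda>(f, x). commutator f x) ` (F \<times> S)"
    have F': "finite F'" "F' \<subseteq> lcs (Suc i)"
      unfolding F'_def using F(1) S(1) lcs_commutator[OF subsetD[OF F(2)] subsetD[OF S(2)]] by auto
    have "generate G (F' \<union> lcs (Suc (Suc i))) = lcs (Suc i)"
    proof (rule lcs_generated_by_commutators[OF _ _ _ F(2,3) S(2,3)])
      have sub: "F' \<union> lcs (Suc (Suc i)) \<subseteq> lcs (Suc i)" using F' lcs_Suc_subset by blast
      show "subgroup (generate G (F' \<union> lcs (Suc (Suc i)))) G"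
        using sub lcs_carrier by (intro generate_is_subgroup) blast
      show "lcs (Suc (Suc i)) \<subseteq> generate G (F' \<union> lcs (Suc (Suc i)))"
        using subset_generate by blast
      show "generate G (F' \<union> lcs (Suc (Suc i))) \<subseteq> lcs (Suc i)"
        using sub by (rule generate_subgroup_incl[OF _ lcs_subgroup])
      show "commutator f x \<in> generate G (F' \<union> lcs (Suc (Suc i)))" if "f \<in> F" "x \<in> S" for f x
        using that unfolding F'_def by (intro generate.incl) auto
    qed
    then show ?case using F' by blast
  qed
  \<comment> \<open>The induction climbs from the trivial term \<open>lcs n\<close> to
    \<open>lcs 0\<close>, the whole group. Truncated subtraction makes the step trivial once
    \<open>j\<close> has reached \<open>n\<close>.\<close>
  have "noetherian_subset (lcs (n - j))" for j
  proof (induction j)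
    case 0
    show ?case
      unfolding noetherian_subset_def
    proof (intro allI impI)
      fix \<H> assume "\<H> \<noteq> {} \<and> (\<forall>H\<in>\<H>. subgroup H G \<and> H \<subseteq> lcs (n - 0))"
      then have "\<H> \<noteq> {}" "\<And>H. H \<in> \<H> \<Longrightarrow> H = {\<one>}" using n subgroup.one_closed by fastforce+
      then show "\<exists>H\<in>\<H>. \<forall>H'\<in>\<H>. H \<subseteq> H' \<longrightarrow> H' = H" by (metis all_not_in_conv)
    qed
  next
    case (Suc j)
    show ?case
    proof (cases "j < n")
      case True
      then have e: "n - j = Suc (n - Suc j)" by simp
      show ?thesis using noetherian_lcs_step[of "n - Suc j"] Suc fg[of "n - Suc j"] unfolding e by metis
    next
      case False
      then show ?thesis using Suc by simp
    qed
  qed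
  from this[of n] show ?thesis by simp
qed

section \<open>Isolated subgroups of nilpotent groups\<close>

lemma commutator_pow_left:
  assumes "a \<in> carrier G" "b \<in> carrier G" and comm: "a \<otimes> commutator a b = commutator a b \<otimes> a"
  shows "commutator (a [^] (n::nat)) b = commutator a b [^] n"
proof (induction n)
  case (Suc n)
  define c where "c = commutator a b"
  have c: "c \<in> carrier G" unfolding c_def using assms by simp
  have "a [^] n \<otimes> c = c \<otimes> a [^] n"
    using group_commutes_pow[of a c n] assms c unfolding c_def by simp
  then have "a [^] n \<otimes> c \<otimes> inv (a [^] n) = c"
    using c assms by (simp add: word_simps)
  then show ?case
    using Suc assms c unfolding nat_pow_Suc commutator_mult_left[OF nat_pow_closed[OF assms(1)] assms(1,2)]
    by (simp add: c_def[symmetric] nat_pow_Suc2[symmetric])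
qed (use assms in simp)

lemma inv_commutator:
  assumes "a \<in> carrier G" "b \<in> carrier G"
  shows "inv (commutator a b) = commutator b a"
  using assms by (simp add: word_simps)

end

text \<open>The same content as \<open>normal\<close>. The separate name allows the quotient group
  and the projection to be attached as sublocales, so that facts about groups can be applied in the
  quotient and pulled back.\<close>

locale normal_quotient = normal
begin

sublocale Q: group "G Mod H" by (rule factorgroup_is_group)

sublocale proj: group_hom G "G Mod H" "\<lambda>x. H #> x"
  by (unfold_locales) (rule r_coset_hom_Mod)

lemma proj_eq_iff:
  assumes "x \<in> carrier G" "y \<in> carrier G"
  shows "H #> x = H #> y \<longleftrightarrow> x \<otimes> inv y \<in> H"
proof
  assume "H #> x = H #> y"
  moreover have "x \<in> H #> x" by (rule rcos_self[OF assms(1) is_subgroup])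
  ultimately have "x \<in> H #> y" by simp
  then show "x \<otimes> inv y \<in> H" using assms subset by (auto simp: r_coset_def m_assoc)
next
  assume h: "x \<otimes> inv y \<in> H"
  have "x = x \<otimes> inv y \<otimes> y" using assms by (simp add: m_assoc)
  then have "x \<in> H #> y" using h unfolding r_coset_def by blast
  then show "H #> x = H #> y" using repr_independence[OF _ assms(2) is_subgroup] by simp
qed

lemma proj_eqD:
  assumes "x \<in> carrier G" "y \<in> carrier G" "H #> x = H #> y"
  shows "x \<otimes> inv y \<in> H"
  using proj_eq_iff[OF assms(1,2)] assms(3) by blast

lemma proj_commute_iff:
  assumes "x \<in> carrier G" "y \<in> carrier G"
  shows "(H #> x) \<otimes>\<^bsub>G Mod H\<^esub> (H #> y) = (H #> y) \<otimes>\<^bsub>G Mod H\<^esub> (H #> x) \<longleftrightarrow> commutator x y \<in> H"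
proof -
  have "(H #> x) \<otimes>\<^bsub>G Mod H\<^esub> (H #> y) = (H #> y) \<otimes>\<^bsub>G Mod H\<^esub> (H #> x) \<longleftrightarrow> H #> (x \<otimes> y) = H #> (y \<otimes> x)"
    using assms by (simp only: proj.hom_mult)
  also have "\<dots> \<longleftrightarrow> commutator x y \<in> H"
    unfolding proj_eq_iff[OF m_closed[OF assms] m_closed[OF assms(2,1)]]
    using assms by (simp add: word_simps)
  finally show ?thesis .
qed

lemma proj_commutator:
  assumes "x \<in> carrier G" "y \<in> carrier G"
  shows "H #> commutator x y = Q.commutator (H #> x) (H #> y)"
  using assms by (simp only: proj.hom_mult proj.hom_inv m_closed inv_closed)

text \<open>The images of \<open>a\<close> and \<open>b\<close> commute in the quotient, where the
  power of a product is the product of the powers.\<close>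

lemma pow_mult_mod:
  assumes "a \<in> carrier G" "b \<in> carrier G" "commutator a b \<in> H"
  shows "(a \<otimes> b) [^] (n::nat) \<otimes> inv (a [^] n \<otimes> b [^] n) \<in> H"
proof -
  have "(H #> a) \<otimes>\<^bsub>G Mod H\<^esub> (H #> b) = (H #> b) \<otimes>\<^bsub>G Mod H\<^esub> (H #> a)"
    using assms by (simp only: proj_commute_iff)
  then have "((H #> a) \<otimes>\<^bsub>G Mod H\<^esub> (H #> b)) [^]\<^bsub>G Mod H\<^esub> n
      = (H #> a) [^]\<^bsub>G Mod H\<^esub> n \<otimes>\<^bsub>G Mod H\<^esub> (H #> b) [^]\<^bsub>G Mod H\<^esub> n"
    using assms proj.hom_closed by (intro Q.pow_mult_distrib) auto
  then have eq: "H #> (a \<otimes> b) [^] n = H #> (a [^] n \<otimes> b [^] n)"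
    using assms by (simp only: proj.hom_mult proj.hom_nat_pow m_closed nat_pow_closed)
  show ?thesis using assms by (intro proj_eqD[OF _ _ eq]) simp_all
qed

lemma commutator_pow_left_mod:
  assumes "a \<in> carrier G" "b \<in> carrier G" "commutator a (commutator a b) \<in> H"
  shows "commutator (a [^] (n::nat)) b \<otimes> inv (commutator a b [^] n) \<in> H"
proof -
  have c: "commutator a b \<in> carrier G" using assms by simp
  have "Q.commutator ((H #> a) [^]\<^bsub>G Mod H\<^esub> n) (H #> b) = Q.commutator (H #> a) (H #> b) [^]\<^bsub>G Mod H\<^esub> n"
    using assms c proj.hom_closed
    by (intro Q.commutator_pow_left) (simp_all only: proj_commute_iff proj_commutator[symmetric])
  then have eq: "H #> commutator (a [^] n) b = H #> (commutator a b [^] n)"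
    using assms c by (simp only: proj_commutator[symmetric] proj.hom_nat_pow[symmetric] nat_pow_closed)
  show ?thesis using assms by (intro proj_eqD[OF _ _ eq]) simp_all
qed

end

context group
begin

section \<open>Roots modulo terms of the lower central series\<close>

lemma lcs_commutator_left:
  assumes "g \<in> carrier G" "a \<in> lcs n"
  shows "commutator g a \<in> lcs (Suc n)"
  using subgroup.m_inv_closed[OF lcs_subgroup lcs_commutator[OF assms(2,1)]]
  by (simp only: inv_commutator lcs_carrier[OF assms(2)] assms(1))

lemma lcs_normal_quotient: "normal_quotient (lcs n) G"
  unfolding normal_quotient_def by (rule lcs_normal)

lemma subgroup_right_quotient_closed:
  assumes "subgroup T G" "x \<in> carrier G" "y \<in> T" "x \<otimes> inv y \<in> T"
  shows "x \<in> T"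
proof -
  have "x = x \<otimes> inv y \<otimes> y" using assms subgroup.mem_carrier[OF assms(1,3)] by (simp add: m_assoc)
  then show ?thesis using subgroup.m_closed[OF assms(1,4,3)] by simp
qed

lemma subgroup_right_quotient_closed':
  assumes "subgroup T G" "y \<in> carrier G" "x \<in> T" "x \<otimes> inv y \<in> T"
  shows "y \<in> T"
proof -
  have "y = inv (x \<otimes> inv y) \<otimes> x"
    using assms subgroup.mem_carrier[OF assms(1,3)] by (simp add: word_simps)
  then show ?thesis using subgroup.m_closed[OF assms(1) subgroup.m_inv_closed[OF assms(1,4)] assms(3)] by simp
qed

lemma subgroup_nat_pow_closed: "subgroup T G \<Longrightarrow> x \<in> T \<Longrightarrow> x [^] (n::nat) \<in> T"
  by (induction n) (auto simp: subgroup.m_closed subgroup.one_closed)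

text \<open>Commutators of elements of \<open>lcs i\<close> lie in \<open>lcs (Suc i)\<close>, so
  modulo \<open>T\<close> taking powers is multiplicative on \<open>lcs i\<close>. If
  \<open>n\<close> and \<open>m\<close> serve for two elements, then \<open>n * m\<close> serves for
  their product.\<close>

lemma roots_between_lcs_subgroup:
  assumes T: "subgroup T G" "lcs (Suc i) \<subseteq> T" "T \<subseteq> lcs i"
  defines "R \<equiv> {a \<in> lcs i. \<exists>n::nat. n > 0 \<and> a [^] n \<in> T}"
  shows "subgroup R G" "T \<subseteq> R"
proof -
  interpret N: normal_quotient "lcs (Suc i)" G by (rule lcs_normal_quotient)
  interpret T: subgroup T G by (rule T)
  interpret L: subgroup "lcs i" G by (rule lcs_subgroup)
  show TR: "T \<subseteq> R"
  proof
    fix a assume a: "a \<in> T"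
    then have "a [^] (1::nat) \<in> T" by simp
    then show "a \<in> R" using a T(3) unfolding R_def by blast
  qed
  show "subgroup R G"
  proof (rule subgroupI)
    show "R \<subseteq> carrier G" unfolding R_def using L.subset by blast
    show "R \<noteq> {}" using TR T.one_closed by blast
  next
    fix a assume "a \<in> R"
    then obtain n :: nat where n: "a \<in> lcs i" "n > 0" "a [^] n \<in> T" unfolding R_def by blast
    have "inv a [^] n = inv (a [^] n)" using n by (simp add: nat_pow_inv)
    then have "inv a [^] n \<in> T" using n T.m_inv_closed by simp
    then show "inv a \<in> R" using n L.m_inv_closed unfolding R_def by blast
  next
    fix a b assume "a \<in> R" "b \<in> R"
    then obtain n m :: nat where n: "a \<in> lcs i" "n > 0" "a [^] n \<in> T"
      and m: "b \<in> lcs i" "m > 0" "b [^] m \<in> T" unfolding R_def by blast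
    have ab: "a \<in> carrier G" "b \<in> carrier G" using n m by auto
    have "a [^] (n * m) \<in> T" "b [^] (n * m) \<in> T"
      using subgroup_nat_pow_closed[OF T(1) n(3), of m] subgroup_nat_pow_closed[OF T(1) m(3), of n] ab
      by (simp_all add: nat_pow_pow mult.commute)
    then have 1: "a [^] (n * m) \<otimes> b [^] (n * m) \<in> T" by (rule T.m_closed)
    note 2 = subsetD[OF T(2) N.pow_mult_mod[OF ab lcs_commutator[OF n(1) ab(2)], of "n * m"]]
    have "(a \<otimes> b) [^] (n * m) \<in> T"
      by (rule subgroup_right_quotient_closed[OF T(1) _ 1 2]) (use ab in simp)
    moreover have "n * m > 0" using n(2) m(2) by simp
    moreover have "a \<otimes> b \<in> lcs i" by (rule L.m_closed[OF n(1) m(1)])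
    ultimately show "a \<otimes> b \<in> R" unfolding R_def by blast
  qed
qed

text \<open>The torsion that \<open>y\<close> creates over \<open>L\<close> spreads to every factor
  of the lower central series. For entries from \<open>lcs i\<close> and \<open>G\<close>,
  commutators are multiplicative modulo \<open>lcs (Suc (Suc i))\<close>, so powers can be moved out
  of them and roots found in one factor produce roots in the next.\<close>

lemma power_of_lcs_mod_next:
  assumes L: "subgroup L G" and y: "y \<in> carrier G" "y [^] (m::nat) \<in> L" "m > 0"
    and gen: "generate G (insert y L) = carrier G"
    and a: "a \<in> lcs i"
  shows "\<exists>n::nat. n > 0 \<and> a [^] n \<in> lcs (Suc i) <#> (L \<inter> lcs i)"
proof -
  interpret L: subgroup L G by (rule L)
  \<comment> \<open>\<open>T i\<close> is the part of \<open>lcs i\<close> that \<open>L\<close>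
    covers modulo the next term, and \<open>R i\<close> is the set of its roots in
    \<open>lcs i\<close>. The claim becomes \<open>R i = lcs i\<close>.\<close>
  define T where "T i = lcs (Suc i) <#> (L \<inter> lcs i)" for i
  define R where "R i = {a \<in> lcs i. \<exists>n::nat. n > 0 \<and> a [^] n \<in> T i}" for i
  have T: "subgroup (T i) G" for i
    unfolding T_def by (intro mult_norm_subgroup lcs_normal subgroups_Inter_pair L lcs_subgroup)
  have T1: "lcs (Suc i) \<subseteq> T i" for i
  proof
    fix c assume c: "c \<in> lcs (Suc i)"
    then have "c = c \<otimes> \<one>" using lcs_carrier by simp
    moreover have "\<one> \<in> L \<inter> lcs i" using L.one_closed lcs_subgroup subgroup.one_closed by blast
    ultimately show "c \<in> T i" unfolding T_def set_mult_def using c by blast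
  qed
  have T2: "T i \<subseteq> lcs i" for i
    unfolding T_def set_mult_def using lcs_Suc_subset subgroup.m_closed[OF lcs_subgroup] by blast
  have T3: "L \<inter> lcs i \<subseteq> T i" for i
  proof
    fix c assume c: "c \<in> L \<inter> lcs i"
    then have "c = \<one> \<otimes> c" using lcs_carrier by simp
    moreover have "\<one> \<in> lcs (Suc i)" using lcs_subgroup subgroup.one_closed by blast
    ultimately show "c \<in> T i" unfolding T_def set_mult_def using c by blast
  qed
  have R: "subgroup (R i) G" "T i \<subseteq> R i" for i
    unfolding R_def using roots_between_lcs_subgroup[OF T T1 T2] by auto
  have Rsub: "R i \<subseteq> lcs i" for i unfolding R_def by blast
  have "R i = lcs i" for i
  proof (induction i)
    case 0
    have "L \<subseteq> R 0" using R(2)[of 0] T3[of 0] L.subset by auto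
    moreover have "y \<in> R 0" using y T3[of 0] L.subset unfolding R_def by auto
    ultimately have "carrier G \<subseteq> R 0"
      using generate_subgroup_incl[of "insert y L" "R 0"] R(1)[of 0] gen by simp
    then show ?case using Rsub[of 0] by auto
  next
    case (Suc i)
    interpret N: normal_quotient "lcs (Suc (Suc i))" G by (rule lcs_normal_quotient)
    \<comment> \<open>Write \<open>a [^] n = c \<otimes> k\<close> with \<open>c\<close> in the next
      term and \<open>k\<close> in \<open>L\<close>. The commutator of this power with
      \<open>l\<close> lies in \<open>T (Suc i)\<close>, and modulo \<open>lcs (Suc (Suc i))\<close>
      it is the \<open>n\<close>-th power of the commutator of \<open>a\<close> with
      \<open>l\<close>.\<close>
    have Tc: "commutator a l \<in> R (Suc i)" if a: "a \<in> lcs i" and l: "l \<in> L" for a l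
    proof -
      have G: "a \<in> carrier G" "l \<in> carrier G" using a l lcs_carrier by auto
      obtain n :: nat where n: "n > 0" "a [^] n \<in> T i" using Suc a unfolding R_def by blast
      then obtain c k where ck: "c \<in> lcs (Suc i)" "k \<in> L \<inter> lcs i" "a [^] n = c \<otimes> k"
        unfolding T_def set_mult_def by blast
      have G': "c \<in> carrier G" "k \<in> carrier G" using ck lcs_carrier by auto
      have "commutator k l \<in> L \<inter> lcs (Suc i)"
        using ck(2) l lcs_commutator[of k i l] G by auto
      then have "commutator k l \<in> T (Suc i)" using T3 by blast
      then have "c \<otimes> commutator k l \<otimes> inv c \<in> T (Suc i)"
        using subgroup_between_lcs_conj[OF T T1 T2] G' by blast
      moreover have "commutator c l \<in> T (Suc i)" using lcs_commutator[OF ck(1) G(2)] T1 by blast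
      ultimately have 1: "commutator (a [^] n) l \<in> T (Suc i)"
        unfolding ck(3) commutator_mult_left[OF G' G(2)] by (rule subgroup.m_closed[OF T])
      have c: "commutator a l \<in> lcs (Suc i)" using lcs_commutator a G by blast
      have "commutator a (commutator a l) \<in> lcs (Suc (Suc i))"
        by (rule lcs_commutator_left[OF G(1) c])
      note 2 = subsetD[OF T1 N.commutator_pow_left_mod[OF G this, of n]]
      have "commutator a l [^] n \<in> T (Suc i)"
        by (rule subgroup_right_quotient_closed'[OF T _ 1 2]) (use G in simp)
      then show ?thesis using c n unfolding R_def by blast
    qed
    \<comment> \<open>Here the power is moved out of \<open>y\<close>: the element
      \<open>y [^] m\<close> lies in \<open>L\<close>, so the previous fact applies to it, and a
      root of an element of \<open>R (Suc i)\<close> is again a root of an element of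
      \<open>T (Suc i)\<close>.\<close>
    have Ty: "commutator a y \<in> R (Suc i)" if a: "a \<in> lcs i" for a
    proof -
      have G: "a \<in> carrier G" "y \<in> carrier G" using a y lcs_carrier by auto
      have c: "commutator y a \<in> lcs (Suc i)" by (rule lcs_commutator_left[OF G(2) a])
      have "inv (commutator a (y [^] m)) \<in> R (Suc i)"
        by (rule subgroup.m_inv_closed[OF R(1) Tc[OF a y(2)]])
      then have 1: "commutator (y [^] m) a \<in> R (Suc i)" using G by (simp only: inv_commutator nat_pow_closed)
      have "commutator y (commutator y a) \<in> lcs (Suc (Suc i))" by (rule lcs_commutator_left[OF G(2) c])
      note 2 = subsetD[OF R(2) subsetD[OF T1 N.commutator_pow_left_mod[OF G(2,1) this, of m]]]
      have "commutator y a [^] m \<in> R (Suc i)"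
        by (rule subgroup_right_quotient_closed'[OF R(1) _ 1 2]) (use G in simp)
      then obtain k :: nat where "k > 0" "(commutator y a [^] m) [^] k \<in> T (Suc i)"
        unfolding R_def by blast
      then have "m * k > 0" "commutator y a [^] (m * k) \<in> T (Suc i)"
        using y(3) G by (simp_all add: nat_pow_pow)
      then have "commutator y a \<in> R (Suc i)" using c unfolding R_def by blast
      then have "inv (commutator y a) \<in> R (Suc i)" by (rule subgroup.m_inv_closed[OF R(1)])
      then show ?thesis by (simp only: inv_commutator[OF G(2,1)])
    qed
    show ?case
    proof (rule lcs_generated_by_commutators[OF R(1) _ Rsub _ _ _ gen])
      show "lcs (Suc (Suc i)) \<subseteq> R (Suc i)" using T1 R(2) by blast
      show "lcs i \<subseteq> lcs i" ..
      show "insert y L \<subseteq> carrier G" using y L.subset by blast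
      have "lcs i \<union> lcs (Suc i) = lcs i" using lcs_Suc_subset by blast
      then show "generate G (lcs i \<union> lcs (Suc i)) = lcs i"
        using generate_subgroup_incl[OF subset_refl lcs_subgroup] subset_generate[of "lcs i"]
        by (simp add: subset_antisym)
      show "commutator f x \<in> R (Suc i)" if "f \<in> lcs i" "x \<in> insert y L" for f x
        using that(2) Tc[OF that(1)] Ty[OF that(1)] by (elim insertE) simp_all
    qed
  qed
  then show ?thesis using a unfolding R_def T_def by blast
qed

section \<open>Conjugates and normalizers\<close>

definition conjugate :: "'a \<Rightarrow> 'a set \<Rightarrow> 'a set" where
  "conjugate g K = (\<lambda>k. g \<otimes> k \<otimes> inv g) ` K"

text \<open>Equality is required because in an infinite group a conjugate of \<open>K\<close> can be
  a proper subset of \<open>K\<close>.\<close>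

definition normalizer_of :: "'a set \<Rightarrow> 'a set" where
  "normalizer_of K = {g \<in> carrier G. conjugate g K = K}"

lemma lower_central_subgroup_mono:
  assumes M: "subgroup M G"
  shows "lower_central (G\<lparr>carrier := M\<rparr>) n \<subseteq> lcs n"
proof (induction n)
  case 0
  show ?case using subgroup.subset[OF M] by simp
next
  case (Suc n)
  interpret M: subgroup M G by (rule M)
  interpret GM: group "G\<lparr>carrier := M\<rparr>" by (rule subgroup_imp_group[OF M])
  let ?C = "{x \<otimes> y \<otimes> inv\<^bsub>G\<lparr>carrier := M\<rparr>\<^esub> x \<otimes> inv\<^bsub>G\<lparr>carrier := M\<rparr>\<^esub> y | x y.
      x \<in> lower_central (G\<lparr>carrier := M\<rparr>) n \<and> y \<in> M}"
  have C: "?C \<subseteq> {commutator x y | x y. x \<in> lcs n \<and> y \<in> carrier G}"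
  proof safe
    fix x y assume x: "x \<in> lower_central (G\<lparr>carrier := M\<rparr>) n" and y: "y \<in> M"
    have "x \<in> M" using GM.lcs_carrier[OF x] by simp
    then have "x \<otimes> y \<otimes> inv\<^bsub>G\<lparr>carrier := M\<rparr>\<^esub> x \<otimes> inv\<^bsub>G\<lparr>carrier := M\<rparr>\<^esub> y = commutator x y"
      using y M by (simp add: m_inv_consistent)
    then show "\<exists>x' y'. x \<otimes> y \<otimes> inv\<^bsub>G\<lparr>carrier := M\<rparr>\<^esub> x \<otimes> inv\<^bsub>G\<lparr>carrier := M\<rparr>\<^esub> y = commutator x' y'
        \<and> x' \<in> lcs n \<and> y' \<in> carrier G"
      using Suc x y M.subset by blast
  qed
  have "?C \<subseteq> M"
  proof safe
    fix x y assume x: "x \<in> lower_central (G\<lparr>carrier := M\<rparr>) n" and y: "y \<in> M"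
    have "x \<in> M" using GM.lcs_carrier[OF x] by simp
    then show "x \<otimes> y \<otimes> inv\<^bsub>G\<lparr>carrier := M\<rparr>\<^esub> x \<otimes> inv\<^bsub>G\<lparr>carrier := M\<rparr>\<^esub> y \<in> M"
      using y M by (simp add: m_inv_consistent)
  qed
  then have "generate (G\<lparr>carrier := M\<rparr>) ?C = generate G ?C"
    using generate_consistent[OF _ M] by simp
  then show ?case
    using mono_generate[OF C] by (simp add: lower_central.simps(2))
qed

lemma first_failure:
  assumes "\<not> P (0::nat)" and "P n"
  shows "\<exists>i. \<not> P i \<and> P (Suc i)"
  using assms by (induction n) auto

text \<open>In the group \<open>M\<close> generated by \<open>L\<close> and \<open>y\<close>, take
  the last term of the lower central series that is not contained in \<open>L\<close>. An element
  \<open>a\<close> of it outside \<open>L\<close> normalizes \<open>L\<close>, since its commutators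
  with \<open>L\<close> fall into the next term, and a positive power of \<open>a\<close> lies in
  \<open>L\<close>. This contradicts the hypothesis on the normalizer.\<close>

lemma isolated_if_normalizer_torsion_free:
  assumes nil: "nilpotent_group G" and L: "subgroup L G"
    and tf: "\<And>g n. g \<in> normalizer_of L \<Longrightarrow> n > 0 \<Longrightarrow> g [^] (n::nat) \<in> L \<Longrightarrow> g \<in> L"
    and y: "y \<in> carrier G" "y [^] (m::nat) \<in> L" "m > 0"
  shows "y \<in> L"
proof (rule ccontr)
  assume yL: "y \<notin> L"
  interpret L: subgroup L G by (rule L)
  define M where "M = generate G (insert y L)"
  have yLG: "insert y L \<subseteq> carrier G" using y L.subset by blast
  have M: "subgroup M G" unfolding M_def by (rule generate_is_subgroup[OF yLG])
  interpret M: subgroup M G by (rule M)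
  have sub: "insert y L \<subseteq> M" unfolding M_def by (rule subset_generate)
  define GM where "GM = G\<lparr>carrier := M\<rparr>"
  have GM: "carrier GM = M" "monoid.mult GM = monoid.mult G" "\<one>\<^bsub>GM\<^esub> = \<one>" unfolding GM_def by auto
  interpret GM: group GM unfolding GM_def by (rule subgroup_imp_group[OF M])
  have inv: "inv\<^bsub>GM\<^esub> x = inv x" if "x \<in> M" for x
    unfolding GM_def by (rule m_inv_consistent[OF M that])
  have pow: "x [^]\<^bsub>GM\<^esub> (k::nat) = x [^] k" for x k
    by (induction k) (auto simp: GM GM_def nat_pow_def)
  have LM: "subgroup L GM" unfolding GM_def using subgroup_incl[OF L M] sub by blast
  have gen: "generate GM (insert y L) = carrier GM"
    unfolding GM using generate_consistent[OF sub M] unfolding M_def[symmetric] GM_def .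
  obtain n where "lcs n = {\<one>}" using nil unfolding nilpotent_group_def by blast
  then have "GM.lcs n \<subseteq> {\<one>}" using lower_central_subgroup_mono[OF M, of n] by (simp add: GM_def)
  also have "{\<one>} \<subseteq> L" by simp
  finally have n: "GM.lcs n \<subseteq> L" .
  have 0: "\<not> GM.lcs 0 \<subseteq> L" using yL sub by (auto simp: GM)
  obtain i where i: "\<not> GM.lcs i \<subseteq> L" "GM.lcs (Suc i) \<subseteq> L"
    using first_failure[of "\<lambda>n. GM.lcs n \<subseteq> L", OF 0 n] by blast
  then obtain a where a: "a \<in> GM.lcs i" "a \<notin> L" by blast
  have aM: "a \<in> M" using GM.lcs_carrier[OF a(1)] GM by simp
  have ia: "inv a \<in> GM.lcs i"
    using subgroup.m_inv_closed[OF GM.lcs_subgroup a(1)] inv[OF aM] by simp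
  obtain k :: nat where k: "k > 0" "a [^] k \<in> GM.lcs (Suc i) <#>\<^bsub>GM\<^esub> (L \<inter> GM.lcs i)"
    using GM.power_of_lcs_mod_next[OF LM _ _ y(3) gen a(1)] y(2) sub unfolding pow GM by blast
  then obtain c l where "c \<in> L" "l \<in> L" "a [^] k = c \<otimes> l"
    using i(2) unfolding set_mult_def GM by blast
  then have "a [^] k \<in> L" using L.m_closed by simp
  moreover have "a \<in> normalizer_of L"
  proof -
    have cl: "b \<otimes> l \<otimes> inv b \<in> L" if b: "b \<in> GM.lcs i" and l: "l \<in> L" for b l
    proof -
      have bM: "b \<in> M" "l \<in> M" using GM.lcs_carrier[OF b] GM sub l by auto
      have "GM.commutator b l \<in> GM.lcs (Suc i)"
        by (rule GM.lcs_commutator[OF b]) (simp add: GM bM)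
      moreover have "GM.commutator b l = commutator b l" using bM by (simp add: GM inv)
      ultimately have "commutator b l \<in> L" using i(2) by auto
      then have "commutator b l \<otimes> l \<in> L" by (rule L.m_closed[OF _ l])
      then show ?thesis using bM by (simp add: word_simps)
    qed
    have "l \<in> conjugate a L" if l: "l \<in> L" for l
    proof -
      have "inv a \<otimes> l \<otimes> inv (inv a) \<in> L" by (rule cl[OF ia l])
      moreover have "l = a \<otimes> (inv a \<otimes> l \<otimes> inv (inv a)) \<otimes> inv a"
        using aM l by (simp add: word_simps)
      ultimately show ?thesis unfolding conjugate_def by blast
    qed
    then show ?thesis
      using cl[OF a(1)] M.mem_carrier[OF aM] unfolding normalizer_of_def by (auto simp: conjugate_def)
  qed
  ultimately show False using tf k a by blast
qed

section \<open>Projective representations\<close>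

lemma conjugate_conjugate:
  assumes "x \<in> carrier G" "y \<in> carrier G" "K \<subseteq> carrier G"
  shows "conjugate x (conjugate y K) = conjugate (x \<otimes> y) K"
proof -
  have "x \<otimes> (y \<otimes> k \<otimes> inv y) \<otimes> inv x = x \<otimes> y \<otimes> k \<otimes> inv (x \<otimes> y)" if "k \<in> K" for k
    using that assms subsetD[OF assms(3) that] by (simp add: word_simps)
  then show ?thesis unfolding conjugate_def image_image by (intro image_cong) auto
qed

lemma conjugate_one: "K \<subseteq> carrier G \<Longrightarrow> conjugate \<one> K = K"
  unfolding conjugate_def by force

lemma conjugate_carrier: "g \<in> carrier G \<Longrightarrow> K \<subseteq> carrier G \<Longrightarrow> conjugate g K \<subseteq> carrier G"
  unfolding conjugate_def by auto

lemma conjugate_mono: "K \<subseteq> L \<Longrightarrow> conjugate g K \<subseteq> conjugate g L"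
  unfolding conjugate_def by blast

lemma conjugate_inv:
  assumes "g \<in> carrier G" "K \<subseteq> carrier G"
  shows "conjugate (inv g) (conjugate g K) = K" "conjugate g (conjugate (inv g) K) = K"
  using assms by (simp_all add: conjugate_conjugate conjugate_one)

lemma conjugate_subgroup:
  assumes "g \<in> carrier G" "subgroup K G"
  shows "subgroup (conjugate g K) G"
proof -
  interpret K: subgroup K G by (rule assms(2))
  show ?thesis
  proof (rule subgroupI)
    show "conjugate g K \<subseteq> carrier G" by (rule conjugate_carrier[OF assms(1) K.subset])
    show "conjugate g K \<noteq> {}" unfolding conjugate_def using K.one_closed by blast
  next
    fix a assume "a \<in> conjugate g K"
    then obtain k where k: "k \<in> K" "a = g \<otimes> k \<otimes> inv g" unfolding conjugate_def by blast
    have "inv a = g \<otimes> inv k \<otimes> inv g" using k assms(1) by (simp add: word_simps)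
    then show "inv a \<in> conjugate g K" unfolding conjugate_def using K.m_inv_closed[OF k(1)] by blast
  next
    fix a b assume "a \<in> conjugate g K" "b \<in> conjugate g K"
    then obtain k l where k: "k \<in> K" "a = g \<otimes> k \<otimes> inv g" and l: "l \<in> K" "b = g \<otimes> l \<otimes> inv g"
      unfolding conjugate_def by blast
    have "a \<otimes> b = g \<otimes> (k \<otimes> l) \<otimes> inv g" using k l assms(1) by (simp add: word_simps)
    then show "a \<otimes> b \<in> conjugate g K" unfolding conjugate_def using K.m_closed[OF k(1) l(1)] by blast
  qed
qed

lemma normalizer_of_subgroup:
  assumes "K \<subseteq> carrier G"
  shows "subgroup (normalizer_of K) G"
proof (rule subgroupI)
  show "normalizer_of K \<subseteq> carrier G" unfolding normalizer_of_def by blast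
  show "normalizer_of K \<noteq> {}" unfolding normalizer_of_def using conjugate_one[OF assms] by blast
  show "inv a \<in> normalizer_of K" if "a \<in> normalizer_of K" for a
    using that conjugate_inv(1)[OF _ assms, of a] unfolding normalizer_of_def by simp
  show "a \<otimes> b \<in> normalizer_of K" if "a \<in> normalizer_of K" "b \<in> normalizer_of K" for a b
    using that conjugate_conjugate[OF _ _ assms, of a b] unfolding normalizer_of_def by simp
qed

lemma subgroup_normalizer_of:
  assumes "subgroup K G"
  shows "K \<subseteq> normalizer_of K"
proof
  fix k assume k: "k \<in> K"
  interpret K: subgroup K G by (rule assms)
  have kG: "k \<in> carrier G" using k by simp
  have sub: "conjugate l K \<subseteq> K" if "l \<in> K" for l
    unfolding conjugate_def using that by auto
  have "K = conjugate k (conjugate (inv k) K)" using conjugate_inv(2)[OF kG K.subset] by simp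
  also have "\<dots> \<subseteq> conjugate k K" by (rule conjugate_mono[OF sub[OF K.m_inv_closed[OF k]]])
  finally show "k \<in> normalizer_of K" unfolding normalizer_of_def using sub[OF k] kG by blast
qed

end

section \<open>The action on vectors and on subspaces\<close>

locale projective_rep = group G + vs: vector_space s
  for G (structure) and s :: "complex \<Rightarrow> 'v \<Rightarrow> 'v::ab_group_add" +
  fixes \<alpha> :: "'a \<Rightarrow> 'a \<Rightarrow> complex" and V :: "'v set" and \<rho> :: "'a \<Rightarrow> 'v \<Rightarrow> 'v"
  assumes cocycle: "cocycle2 G \<alpha>" and rep: "alpha_rep G \<alpha> s V \<rho>"
begin

lemma cocycle_nonzero: "x \<in> carrier G \<Longrightarrow> y \<in> carrier G \<Longrightarrow> \<alpha> x y \<noteq> 0"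
  using cocycle unfolding cocycle2_def by blast

lemma subspace_V: "vs.subspace V"
  using rep unfolding alpha_rep_def complex_space_def by blast

lemma rho_closed: "g \<in> carrier G \<Longrightarrow> v \<in> V \<Longrightarrow> \<rho> g v \<in> V"
  using rep unfolding alpha_rep_def linear_iso_on_def bij_betw_def by blast

lemma rho_inj_on: "g \<in> carrier G \<Longrightarrow> inj_on (\<rho> g) V"
  using rep unfolding alpha_rep_def linear_iso_on_def bij_betw_def by blast

lemma rho_add: "g \<in> carrier G \<Longrightarrow> u \<in> V \<Longrightarrow> v \<in> V \<Longrightarrow> \<rho> g (u + v) = \<rho> g u + \<rho> g v"
  using rep unfolding alpha_rep_def linear_iso_on_def by blast

lemma rho_scale: "g \<in> carrier G \<Longrightarrow> v \<in> V \<Longrightarrow> \<rho> g (s c v) = s c (\<rho> g v)"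
  using rep unfolding alpha_rep_def linear_iso_on_def by blast

lemma rho_mult: "x \<in> carrier G \<Longrightarrow> y \<in> carrier G \<Longrightarrow> v \<in> V \<Longrightarrow> \<rho> x (\<rho> y v) = s (\<alpha> x y) (\<rho> (x \<otimes> y) v)"
  using rep unfolding alpha_rep_def by blast

lemma rho_zero: "g \<in> carrier G \<Longrightarrow> \<rho> g 0 = 0"
  using rho_scale[of g 0 0] vs.subspace_0[OF subspace_V] by simp

lemma rho_eq_0_iff: "g \<in> carrier G \<Longrightarrow> v \<in> V \<Longrightarrow> \<rho> g v = 0 \<longleftrightarrow> v = 0"
  using rho_inj_on[of g] rho_zero[of g] vs.subspace_0[OF subspace_V] unfolding inj_on_def by metis

lemma rho_minus: "g \<in> carrier G \<Longrightarrow> v \<in> V \<Longrightarrow> \<rho> g (- v) = - \<rho> g v"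
  using rho_scale[of g v "- 1"] by simp

lemma rho_diff: "g \<in> carrier G \<Longrightarrow> u \<in> V \<Longrightarrow> v \<in> V \<Longrightarrow> \<rho> g (u - v) = \<rho> g u - \<rho> g v"
  using rho_add[of g u "- v"] rho_minus[of g v] vs.subspace_neg[OF subspace_V, of v] by simp

lemma rho_one:
  assumes "v \<in> V"
  shows "\<rho> \<one> v = s (\<alpha> \<one> \<one>) v"
proof -
  have "\<rho> \<one> (\<rho> \<one> v) = \<rho> \<one> (s (\<alpha> \<one> \<one>) v)"
    using rho_mult[OF _ _ assms, of \<one> \<one>] rho_scale[OF _ assms, of \<one>] by simp
  then show ?thesis
    using rho_inj_on[of \<one>] rho_closed[OF _ assms] vs.subspace_scale[OF subspace_V assms]
    unfolding inj_on_def by simp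
qed

definition subsp :: "'v set \<Rightarrow> bool" where
  "subsp U \<longleftrightarrow> vs.subspace U \<and> U \<subseteq> V"

lemma subspD: "subsp U \<Longrightarrow> u \<in> U \<Longrightarrow> u \<in> V"
  unfolding subsp_def by blast

lemma subsp_subspace: "subsp U \<Longrightarrow> vs.subspace U"
  unfolding subsp_def by blast

lemma subsp_Int: "subsp U \<Longrightarrow> subsp W \<Longrightarrow> subsp (U \<inter> W)"
  unfolding subsp_def using vs.subspace_inter by blast

lemma subsp_span: "A \<subseteq> V \<Longrightarrow> subsp (vs.span A)"
  unfolding subsp_def using vs.span_minimal[OF _ subspace_V] by simp

lemma subsp_image:
  assumes g: "g \<in> carrier G" and U: "subsp U"
  shows "subsp (\<rho> g ` U)"
  unfolding subsp_def
proof
  show "\<rho> g ` U \<subseteq> V" using rho_closed[OF g] subspD[OF U] by blast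
  note sU = subsp_subspace[OF U]
  show "vs.subspace (\<rho> g ` U)"
  proof (rule vs.subspaceI)
    show "0 \<in> \<rho> g ` U" using vs.subspace_0[OF sU] rho_zero[OF g] by (intro image_eqI[of _ _ 0]) simp_all
  next
    fix x y assume "x \<in> \<rho> g ` U" "y \<in> \<rho> g ` U"
    then obtain u v where "u \<in> U" "x = \<rho> g u" "v \<in> U" "y = \<rho> g v" by blast
    then show "x + y \<in> \<rho> g ` U"
      using rho_add[OF g] subspD[OF U] vs.subspace_add[OF sU] by (metis image_eqI)
  next
    fix c x assume "x \<in> \<rho> g ` U"
    then obtain u where "u \<in> U" "x = \<rho> g u" by blast
    then show "s c x \<in> \<rho> g ` U"
      using rho_scale[OF g] subspD[OF U] vs.subspace_scale[OF sU] by (metis image_eqI)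
  qed
qed

lemma scale_image:
  assumes "vs.subspace U" "c \<noteq> 0"
  shows "s c ` U = U"
proof
  show "s c ` U \<subseteq> U" using vs.subspace_scale[OF assms(1)] by blast
  show "U \<subseteq> s c ` U"
  proof
    fix u assume "u \<in> U"
    then have "s (inverse c) u \<in> U" "u = s c (s (inverse c) u)"
      using vs.subspace_scale[OF assms(1)] assms(2) by simp_all
    then show "u \<in> s c ` U" by blast
  qed
qed

lemma image_mult:
  assumes "x \<in> carrier G" "y \<in> carrier G" "subsp U"
  shows "\<rho> x ` \<rho> y ` U = \<rho> (x \<otimes> y) ` U"
proof -
  have "\<rho> x ` \<rho> y ` U = s (\<alpha> x y) ` \<rho> (x \<otimes> y) ` U"
    unfolding image_image using assms by (intro image_cong refl rho_mult) (auto dest: subspD)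
  also have "\<dots> = \<rho> (x \<otimes> y) ` U"
    using assms cocycle_nonzero by (intro scale_image subsp_subspace subsp_image) auto
  finally show ?thesis .
qed

lemma image_one:
  assumes "subsp U"
  shows "\<rho> \<one> ` U = U"
proof -
  have "\<rho> \<one> ` U = s (\<alpha> \<one> \<one>) ` U"
    using assms by (intro image_cong refl rho_one) (auto dest: subspD)
  also have "\<dots> = U" using assms cocycle_nonzero by (intro scale_image subsp_subspace) auto
  finally show ?thesis .
qed

lemma image_inv:
  assumes "g \<in> carrier G" "subsp U"
  shows "\<rho> (inv g) ` \<rho> g ` U = U" "\<rho> g ` \<rho> (inv g) ` U = U"
  using assms by (simp_all add: image_mult image_one)

lemma image_Int:
  assumes "g \<in> carrier G" "subsp U" "subsp W"
  shows "\<rho> g ` (U \<inter> W) = \<rho> g ` U \<inter> \<rho> g ` W"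
  using inj_on_image_Int[OF rho_inj_on[OF assms(1)]] assms unfolding subsp_def by blast

lemma image_subset_zero_iff:
  assumes "g \<in> carrier G" "U \<subseteq> V"
  shows "\<rho> g ` U \<subseteq> {0} \<longleftrightarrow> U \<subseteq> {0}"
  using rho_eq_0_iff[OF assms(1)] assms(2) by blast

lemma image_span:
  assumes g: "g \<in> carrier G" and A: "A \<subseteq> V"
  shows "\<rho> g ` vs.span A = vs.span (\<rho> g ` A)"
proof
  show "vs.span (\<rho> g ` A) \<subseteq> \<rho> g ` vs.span A"
    using subsp_image[OF g subsp_span[OF A]] vs.span_superset[of A]
    by (intro vs.span_minimal subsp_subspace image_mono)
  have "\<rho> g x \<in> vs.span (\<rho> g ` A)" if "x \<in> vs.span A" for x
  proof -
    have "x \<in> V \<and> \<rho> g x \<in> vs.span (\<rho> g ` A)"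
      using that
    proof (induction rule: vs.span_induct_alt)
      case base
      show ?case using rho_zero[OF g] vs.subspace_0[OF subspace_V] by (simp add: vs.span_zero)
    next
      case (step c x y)
      have x: "x \<in> V" "s c x \<in> V" using step A vs.subspace_scale[OF subspace_V] by auto
      have "\<rho> g (s c x + y) = s c (\<rho> g x) + \<rho> g y"
        using x step by (simp add: rho_add[OF g] rho_scale[OF g])
      moreover have "\<rho> g x \<in> vs.span (\<rho> g ` A)" using step by (intro vs.span_base) blast
      ultimately show ?case
        using step x vs.subspace_add[OF subspace_V] by (auto intro!: vs.span_add vs.span_scale)
    qed
    then show ?thesis by blast
  qed
  then show "\<rho> g ` vs.span A \<subseteq> vs.span (\<rho> g ` A)" by blast
qed

section \<open>Invariant subspaces and disjoint families\<close>

definition invariant :: "'a set \<Rightarrow> 'v set \<Rightarrow> bool" where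
  "invariant K U \<longleftrightarrow> subsp U \<and> (\<forall>k\<in>K. \<rho> k ` U \<subseteq> U)"

lemma invariant_subsp: "invariant K U \<Longrightarrow> subsp U"
  unfolding invariant_def by blast

lemma invariant_mono: "invariant K U \<Longrightarrow> L \<subseteq> K \<Longrightarrow> invariant L U"
  unfolding invariant_def by blast

lemma invariant_in: "invariant K U \<Longrightarrow> k \<in> K \<Longrightarrow> u \<in> U \<Longrightarrow> \<rho> k u \<in> U"
  unfolding invariant_def by blast

lemma invariant_image_eq:
  assumes "subgroup K G" "invariant K U" "k \<in> K"
  shows "\<rho> k ` U = U"
proof
  interpret K: subgroup K G by (rule assms(1))
  show "\<rho> k ` U \<subseteq> U" using assms unfolding invariant_def by blast
  have "U = \<rho> k ` \<rho> (inv k) ` U"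
    using image_inv(2)[of k U] K.mem_carrier[OF assms(3)] invariant_subsp[OF assms(2)] by simp
  also have "\<dots> \<subseteq> \<rho> k ` U"
    using assms(2) K.m_inv_closed[OF assms(3)] unfolding invariant_def by (intro image_mono) blast
  finally show "U \<subseteq> \<rho> k ` U" .
qed

lemma invariant_Int: "invariant K U \<Longrightarrow> invariant K W \<Longrightarrow> invariant K (U \<inter> W)"
  unfolding invariant_def using subsp_Int by blast

lemma invariant_span_Union:
  assumes K: "K \<subseteq> carrier G" and F: "\<And>W. W \<in> F \<Longrightarrow> invariant K W"
  shows "invariant K (vs.span (\<Union>F))"
proof -
  have FV: "\<Union>F \<subseteq> V" using F invariant_subsp unfolding subsp_def by blast
  have "\<rho> k ` vs.span (\<Union>F) \<subseteq> vs.span (\<Union>F)" if k: "k \<in> K" for k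
  proof -
    have "\<rho> k ` \<Union>F \<subseteq> \<Union>F" using F k unfolding invariant_def by blast
    then show ?thesis using image_span[OF _ FV, of k] K k vs.span_mono by blast
  qed
  then show ?thesis unfolding invariant_def using subsp_span[OF FV] by blast
qed

lemma invariant_conjugate:
  assumes g: "g \<in> carrier G" and K: "K \<subseteq> carrier G" and U: "invariant K U"
  shows "invariant (conjugate g K) (\<rho> g ` U)"
  unfolding invariant_def
proof
  note U' = invariant_subsp[OF U]
  show "subsp (\<rho> g ` U)" by (rule subsp_image[OF g U'])
  show "\<forall>k\<in>conjugate g K. \<rho> k ` \<rho> g ` U \<subseteq> \<rho> g ` U"
  proof
    fix k assume "k \<in> conjugate g K"
    then obtain h where h: "h \<in> K" "k = g \<otimes> h \<otimes> inv g" unfolding conjugate_def by blast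
    have hG: "h \<in> carrier G" using h K by blast
    have "\<rho> k ` \<rho> g ` U = \<rho> (g \<otimes> h) ` U"
      unfolding h(2) using g hG U' by (simp add: image_mult word_simps)
    also have "\<dots> = \<rho> g ` \<rho> h ` U" using g hG U' by (simp add: image_mult)
    also have "\<dots> \<subseteq> \<rho> g ` U" using U h(1) unfolding invariant_def by blast
    finally show "\<rho> k ` \<rho> g ` U \<subseteq> \<rho> g ` U" .
  qed
qed

text \<open>
  The graph of an isomorphism between nonzero invariant subspaces of \<open>W\<close> and \<open>W'\<close> is an invariant
  subspace of \<open>W + W'\<close> that meets neither; the second clause excludes such graphs.
\<close>

definition disjoint_reps :: "'a set \<Rightarrow> 'v set \<Rightarrow> 'v set \<Rightarrow> bool" where
  "disjoint_reps K W W' \<longleftrightarrow> W \<inter> W' \<subseteq> {0} \<and>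
     (\<forall>X. invariant K X \<longrightarrow> X \<inter> W \<subseteq> {0} \<longrightarrow> X \<inter> W' \<subseteq> {0} \<longrightarrow>
        (\<forall>w\<in>W. \<forall>w'\<in>W'. w + w' \<in> X \<longrightarrow> w + w' = 0))"

lemma disjoint_reps_commute: "disjoint_reps K W W' \<Longrightarrow> disjoint_reps K W' W"
  unfolding disjoint_reps_def by (metis add.commute inf_commute)

lemma disjoint_repsD:
  assumes "disjoint_reps K W W'" "invariant K X" "X \<inter> W \<subseteq> {0}" "X \<inter> W' \<subseteq> {0}"
    "w \<in> W" "w' \<in> W'" "w + w' \<in> X"
  shows "w + w' = 0"
  using assms unfolding disjoint_reps_def by blast

lemma disjoint_reps_mono: "disjoint_reps K W W' \<Longrightarrow> K \<subseteq> L \<Longrightarrow> disjoint_reps L W W'"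
  unfolding disjoint_reps_def using invariant_mono by blast

text \<open>\<open>X\<close> is read as a relation between \<open>W\<close> and \<open>S\<close> in
  which \<open>w\<close> and \<open>y\<close> are related when \<open>w + y\<close> lies in
  \<open>X\<close>. The set is the projection of this relation to \<open>S\<close>; if
  \<open>X\<close> is the graph of a map from part of \<open>W\<close> to \<open>S\<close>, it is
  the range of that map.\<close>

lemma invariant_shadow:
  assumes K: "K \<subseteq> carrier G" and W: "invariant K W" and S: "invariant K S" and X: "invariant K X"
  shows "invariant K {y \<in> S. \<exists>w\<in>W. w + y \<in> X}" (is "invariant K ?Y")
  unfolding invariant_def subsp_def
proof (intro conjI ballI)
  note sub = subsp_subspace[OF invariant_subsp]
  show "vs.subspace ?Y"
  proof (rule vs.subspaceI)
    show "0 \<in> ?Y"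
      using vs.subspace_0[OF sub[OF W]] vs.subspace_0[OF sub[OF S]] vs.subspace_0[OF sub[OF X]]
      by (auto intro!: bexI[of _ 0])
  next
    fix y y' assume "y \<in> ?Y" "y' \<in> ?Y"
    then obtain w w' where w: "w \<in> W" "w + y \<in> X" "w' \<in> W" "w' + y' \<in> X" and y: "y \<in> S" "y' \<in> S" by blast
    have "(w + w') + (y + y') \<in> X"
      using vs.subspace_add[OF sub[OF X] w(2,4)] by (simp add: algebra_simps)
    then show "y + y' \<in> ?Y"
      using vs.subspace_add[OF sub[OF W] w(1,3)] vs.subspace_add[OF sub[OF S] y] by blast
  next
    fix c y assume "y \<in> ?Y"
    then obtain w where w: "w \<in> W" "w + y \<in> X" and y: "y \<in> S" by blast
    have "s c w + s c y \<in> X"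
      using vs.subspace_scale[OF sub[OF X] w(2), of c] by (simp add: vs.scale_right_distrib)
    then show "s c y \<in> ?Y"
      using vs.subspace_scale[OF sub[OF W] w(1)] vs.subspace_scale[OF sub[OF S] y] by blast
  qed
  show "?Y \<subseteq> V" using subspD[OF invariant_subsp[OF S]] by blast
next
  fix k assume k: "k \<in> K"
  show "\<rho> k ` ?Y \<subseteq> ?Y"
  proof safe
    fix y w assume y: "y \<in> S" and w: "w \<in> W" "w + y \<in> X"
    show "\<rho> k y \<in> S" by (rule invariant_in[OF S k y])
    have "\<rho> k w + \<rho> k y = \<rho> k (w + y)"
      using rho_add[of k w y] k K subspD[OF invariant_subsp[OF W] w(1)] subspD[OF invariant_subsp[OF S] y] by auto
    then have "\<rho> k w + \<rho> k y \<in> X" using invariant_in[OF X k w(2)] by simp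
    then show "\<exists>w\<in>W. w + \<rho> k y \<in> X" using invariant_in[OF W k w(1)] by blast
  qed
qed

text \<open>This replaces complete reducibility: an invariant subspace that meets the span of
  pairwise disjoint members must meet one of them. A vector of \<open>X\<close> splits as
  \<open>w + y\<close> along \<open>W\<close> and the remaining members. The induction hypothesis is
  applied not to \<open>X\<close> but to its shadow \<open>Y\<close> in the remaining span, so
  \<open>X\<close> has to be generalized.\<close>

lemma disjoint_family_finite:
  assumes K: "K \<subseteq> carrier G" and "finite F"
    and "\<And>W. W \<in> F \<Longrightarrow> invariant K W"
    and "\<And>W W'. W \<in> F \<Longrightarrow> W' \<in> F \<Longrightarrow> W \<noteq> W' \<Longrightarrow> disjoint_reps K W W'"
    and "invariant K X" "\<And>W. W \<in> F \<Longrightarrow> X \<inter> W \<subseteq> {0}"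
  shows "X \<inter> vs.span (\<Union>F) \<subseteq> {0}"
  using assms(2-)
proof (induction F arbitrary: X)
  case empty
  then show ?case by simp
next
  case (insert W F)
  note sub = subsp_subspace[OF invariant_subsp]
  define S where "S = vs.span (\<Union>F)"
  have W: "invariant K W" and X: "invariant K X" using insert.prems by auto
  have S: "invariant K S" unfolding S_def using insert.prems(1) by (intro invariant_span_Union[OF K]) blast
  have IH: "Y \<inter> S \<subseteq> {0}" if "invariant K Y" "\<And>W'. W' \<in> F \<Longrightarrow> Y \<inter> W' \<subseteq> {0}" for Y
    unfolding S_def using insert.prems(1,2) by (intro insert.IH that) auto
  define Y where "Y = {y \<in> S. \<exists>w\<in>W. w + y \<in> X}"
  have Y: "invariant K Y" unfolding Y_def by (rule invariant_shadow[OF K W S X])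
  have "Y \<inter> W' \<subseteq> {0}" if W': "W' \<in> F" for W'
  proof
    fix y assume y: "y \<in> Y \<inter> W'"
    then obtain w where w: "w \<in> W" "w + y \<in> X" unfolding Y_def by blast
    have d: "disjoint_reps K W W'" using insert.prems(2)[of W W'] insert.hyps(2) W' by auto
    have "w + y = 0"
      using insert.prems(4)[of W] insert.prems(4)[of W'] W' y
      by (intro disjoint_repsD[OF d X _ _ w(1) _ w(2)]) auto
    then have "y = - w" by (simp add: eq_neg_iff_add_eq_0 add.commute)
    then have "y \<in> W \<inter> W'" using y vs.subspace_neg[OF sub[OF W] w(1)] by simp
    then show "y \<in> {0}" using d unfolding disjoint_reps_def by blast
  qed
  from IH[OF Y this] have Y0: "Y \<inter> S \<subseteq> {0}" .
  show ?case
  proof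
    fix x assume x: "x \<in> X \<inter> vs.span (\<Union>(insert W F))"
    then have "x \<in> vs.span (W \<union> \<Union>F)" by simp
    then obtain w y where wy: "w \<in> W" "y \<in> S" "x = w + y"
      unfolding vs.span_Un S_def vs.span_eq_iff[THEN iffD2, OF sub[OF W]] by blast
    then have "y \<in> Y \<inter> S" unfolding Y_def using x by blast
    then have "y = 0" using Y0 by blast
    then have "x \<in> X \<inter> W" using wy x by simp
    then show "x \<in> {0}" using insert.prems(4)[of W] by blast
  qed
qed

lemma in_span_Union_finite:
  assumes "x \<in> vs.span (\<Union>\<W>)"
  obtains F where "finite F" "F \<subseteq> \<W>" "x \<in> vs.span (\<Union>F)"
proof -
  obtain t where t: "finite t" "t \<subseteq> \<Union>\<W>" "x \<in> vs.span t"
  proof -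
    have "\<exists>t r. finite t \<and> t \<subseteq> \<Union>\<W> \<and> (\<Sum>a\<in>t. s (r a) a) = x"
      using assms unfolding vs.span_explicit by blast
    then obtain t r where tr: "finite t" "t \<subseteq> \<Union>\<W>" "(\<Sum>a\<in>t. s (r a) a) = x" by blast
    have "(\<Sum>a\<in>t. s (r a) a) \<in> vs.span t" by (intro vs.span_sum vs.span_scale vs.span_base)
    then show ?thesis using that tr by blast
  qed
  obtain F where "finite F" "F \<subseteq> \<W>" "t \<subseteq> \<Union>F" using finite_subset_Union[OF t(1,2)] by blast
  then show ?thesis using that t(3) vs.span_mono by blast
qed

lemma disjoint_family:
  assumes K: "K \<subseteq> carrier G" and inv: "\<And>W. W \<in> \<W> \<Longrightarrow> invariant K W"
    and disj: "\<And>W W'. W \<in> \<W> \<Longrightarrow> W' \<in> \<W> \<Longrightarrow> W \<noteq> W' \<Longrightarrow> disjoint_reps K W W'"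
    and X: "invariant K X" "\<And>W. W \<in> \<W> \<Longrightarrow> X \<inter> W \<subseteq> {0}"
  shows "X \<inter> vs.span (\<Union>\<W>) \<subseteq> {0}"
proof
  fix x assume x: "x \<in> X \<inter> vs.span (\<Union>\<W>)"
  then obtain F where F: "finite F" "F \<subseteq> \<W>" "x \<in> vs.span (\<Union>F)" using in_span_Union_finite by blast
  have "X \<inter> vs.span (\<Union>F) \<subseteq> {0}"
    using F(2) by (intro disjoint_family_finite[OF K F(1)] inv disj X) auto
  then show "x \<in> {0}" using x F by blast
qed

text \<open>The invariant subspace tested against the rest of the family is \<open>W\<close>
  itself.\<close>

lemma disjoint_family_independent:
  assumes K: "K \<subseteq> carrier G" and inv: "\<And>W. W \<in> \<W> \<Longrightarrow> invariant K W"
    and disj: "\<And>W W'. W \<in> \<W> \<Longrightarrow> W' \<in> \<W> \<Longrightarrow> W \<noteq> W' \<Longrightarrow> disjoint_reps K W W'"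
    and W: "W \<in> \<W>"
  shows "W \<inter> vs.span (\<Union>(\<W> - {W})) \<subseteq> {0}"
proof (rule disjoint_family[OF K _ _ inv[OF W]])
  show "W \<inter> W' \<subseteq> {0}" if "W' \<in> \<W> - {W}" for W'
    using disj[OF W, of W'] that unfolding disjoint_reps_def by blast
qed (use inv disj in auto)

section \<open>Saturated subspaces\<close>

lemma disjoint_reps_conjugate:
  assumes g: "g \<in> carrier G" and K: "K \<subseteq> carrier G" and W: "subsp W" "subsp W'"
    and d: "disjoint_reps K W W'"
  shows "disjoint_reps (conjugate g K) (\<rho> g ` W) (\<rho> g ` W')"
  unfolding disjoint_reps_def
proof (intro conjI allI impI ballI)
  have "W \<inter> W' \<subseteq> V" using W(1) unfolding subsp_def by blast
  then show "\<rho> g ` W \<inter> \<rho> g ` W' \<subseteq> {0}"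
    using d image_subset_zero_iff[OF g, of "W \<inter> W'"] image_Int[OF g W] unfolding disjoint_reps_def by simp
next
  fix X w w'
  assume X: "invariant (conjugate g K) X" "X \<inter> \<rho> g ` W \<subseteq> {0}" "X \<inter> \<rho> g ` W' \<subseteq> {0}"
    and w: "w \<in> \<rho> g ` W" "w' \<in> \<rho> g ` W'" "w + w' \<in> X"
  have g': "inv g \<in> carrier G" using g by simp
  define X' where "X' = \<rho> (inv g) ` X"
  have sX: "subsp X" using X(1) by (rule invariant_subsp)
  have X': "invariant K X'"
    using invariant_conjugate[OF g' conjugate_carrier[OF g K] X(1)] conjugate_inv(1)[OF g K]
    unfolding X'_def by simp
  have sX': "subsp X'" using X' by (rule invariant_subsp)
  have gX': "\<rho> g ` X' = X" unfolding X'_def by (rule image_inv(2)[OF g sX])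
  have z: "X' \<inter> U \<subseteq> {0}" if "X \<inter> \<rho> g ` U \<subseteq> {0}" "subsp U" for U
  proof -
    have "\<rho> g ` (X' \<inter> U) \<subseteq> {0}" using that image_Int[OF g sX' that(2)] gX' by simp
    then show ?thesis using image_subset_zero_iff[OF g] that(2) unfolding subsp_def by blast
  qed
  obtain u u' where u: "u \<in> W" "w = \<rho> g u" "u' \<in> W'" "w' = \<rho> g u'" using w by blast
  have uV: "u \<in> V" "u' \<in> V" using u W subspD by blast+
  have e: "w + w' = \<rho> g (u + u')" unfolding u using rho_add[OF g uV] by simp
  have "\<rho> g (u + u') \<in> \<rho> g ` X'" using w(3) e gX' by simp
  then have "u + u' \<in> X'"
    using inj_on_image_mem_iff[OF rho_inj_on[OF g]] vs.subspace_add[OF subspace_V uV] sX'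
    unfolding subsp_def by blast
  then have "u + u' = 0"
    by (intro disjoint_repsD[OF d X' z[OF X(2) W(1)] z[OF X(3) W(2)] u(1,3)])
  then show "w + w' = 0" using e rho_zero[OF g] by simp
qed

text \<open>
  Saturation says that no nonzero \<open>H\<close>-subrepresentation of \<open>E\<close> is isomorphic to an
  \<open>H\<close>-subrepresentation of \<open>V\<close> that meets \<open>E\<close> trivially. Weight spaces and isotypic components have
  this property.
\<close>

definition saturated :: "'a set \<Rightarrow> 'v set \<Rightarrow> bool" where
  "saturated H E \<longleftrightarrow> invariant H E \<and> (\<forall>U. invariant H U \<and> E \<inter> U \<subseteq> {0} \<longrightarrow> disjoint_reps H E U)"

lemma saturated_invariant: "saturated H E \<Longrightarrow> invariant H E"
  unfolding saturated_def by blast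

lemma saturated_disjoint: "saturated H E \<Longrightarrow> invariant H U \<Longrightarrow> E \<inter> U \<subseteq> {0} \<Longrightarrow> disjoint_reps H E U"
  unfolding saturated_def by blast

text \<open>A larger group has fewer invariant subspaces, so there are fewer candidates for
  \<open>U\<close> and for the graphs \<open>X\<close>. This is what lets the stabilizer of a
  saturated space compete with \<open>H\<close> when \<open>H\<close> is maximal.\<close>

lemma saturated_mono:
  assumes "saturated H E" "H \<subseteq> H'" "invariant H' E"
  shows "saturated H' E"
  using assms disjoint_reps_mono[OF _ assms(2)] invariant_mono[OF _ assms(2)] unfolding saturated_def by blast

lemma saturated_conjugate:
  assumes g: "g \<in> carrier G" and H: "H \<subseteq> carrier G" and E: "saturated H E"
  shows "saturated (conjugate g H) (\<rho> g ` E)"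
  unfolding saturated_def
proof (intro conjI allI impI)
  note iE = saturated_invariant[OF E]
  note sE = invariant_subsp[OF iE]
  show "invariant (conjugate g H) (\<rho> g ` E)" by (rule invariant_conjugate[OF g H iE])
  fix U assume U: "invariant (conjugate g H) U \<and> \<rho> g ` E \<inter> U \<subseteq> {0}"
  have g': "inv g \<in> carrier G" using g by simp
  have sU: "subsp U" using U invariant_subsp by blast
  have U': "invariant H (\<rho> (inv g) ` U)"
    using invariant_conjugate[OF g' conjugate_carrier[OF g H], of U] U conjugate_inv(1)[OF g H] by simp
  note sU' = invariant_subsp[OF U']
  have gU': "\<rho> g ` \<rho> (inv g) ` U = U" by (rule image_inv(2)[OF g sU])
  have "\<rho> g ` (E \<inter> \<rho> (inv g) ` U) \<subseteq> {0}" using U image_Int[OF g sE sU'] gU' by simp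
  then have "E \<inter> \<rho> (inv g) ` U \<subseteq> {0}"
    using image_subset_zero_iff[OF g] sE unfolding subsp_def by blast
  from disjoint_reps_conjugate[OF g H sE sU' saturated_disjoint[OF E U' this]]
  show "disjoint_reps (conjugate g H) (\<rho> g ` E) U" using gU' by simp
qed

text \<open>The difficulty is that \<open>U\<close> may still meet \<open>E\<close>. Saturation of
  \<open>E'\<close> against \<open>U \<inter> E\<close> settles the sums \<open>e + u\<close> inside
  \<open>E\<close>. Consequently the shadow of \<open>X\<close> in \<open>U\<close> misses
  \<open>E\<close>, and saturation of \<open>E\<close> against that shadow settles the rest.\<close>

lemma saturated_Int:
  assumes H: "H \<subseteq> carrier G" and E: "saturated H E" "saturated H E'"
  shows "saturated H (E \<inter> E')"
  unfolding saturated_def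
proof (intro conjI allI impI)
  note iE = saturated_invariant[OF E(1)] saturated_invariant[OF E(2)]
  note sub = subsp_subspace[OF invariant_subsp]
  show iEE: "invariant H (E \<inter> E')" by (intro invariant_Int iE)
  fix U assume "invariant H U \<and> E \<inter> E' \<inter> U \<subseteq> {0}"
  then have U: "invariant H U" "E \<inter> E' \<inter> U \<subseteq> {0}" by auto
  have "w + w' = 0"
    if X: "invariant H X" "X \<inter> (E \<inter> E') \<subseteq> {0}" "X \<inter> U \<subseteq> {0}"
      and w: "w \<in> E \<inter> E'" "w' \<in> U" "w + w' \<in> X" for X w w'
  proof -
    have 1: "e + u = 0" if e: "e \<in> E \<inter> E'" "u \<in> U \<inter> E" "e + u \<in> X" for e u
    proof -
      have d: "disjoint_reps H E' (U \<inter> E)"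
        using U by (intro saturated_disjoint[OF E(2)] invariant_Int iE) auto
      have "e + u \<in> E" using e vs.subspace_add[OF sub[OF iE(1)]] by blast
      define X1 where "X1 = X \<inter> E"
      have "invariant H X1" unfolding X1_def by (intro invariant_Int X iE)
      then show ?thesis
        using X e \<open>e + u \<in> E\<close> by (intro disjoint_repsD[OF d, of X1 e u]) (auto simp: X1_def)
    qed
    define Y where "Y = {y \<in> U. \<exists>e\<in>E \<inter> E'. e + y \<in> X}"
    have Y: "invariant H Y" unfolding Y_def by (rule invariant_shadow[OF H iEE U(1) X(1)])
    have "E \<inter> Y \<subseteq> {0}"
    proof
      fix y assume y: "y \<in> E \<inter> Y"
      then obtain e where e: "e \<in> E \<inter> E'" "e + y \<in> X" unfolding Y_def by blast
      have "e + y = 0" using y by (intro 1 e) (auto simp: Y_def)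
      then have "y = - e" by (simp add: eq_neg_iff_add_eq_0 add.commute)
      then have "y \<in> E \<inter> E' \<inter> U"
        using y vs.subspace_neg[OF sub[OF iEE] e(1)] unfolding Y_def by simp
      then show "y \<in> {0}" using U(2) by blast
    qed
    note d = saturated_disjoint[OF E(1) Y this]
    have w'Y: "w' \<in> Y" using w unfolding Y_def by blast
    \<comment> \<open>\<open>X\<close> may meet \<open>E\<close> outside the sum of
      \<open>E \<inter> E'\<close> and \<open>U\<close>. Cutting it down to this sum brings its
      vectors in \<open>E\<close> under fact \<open>1\<close>.\<close>
    define X2 where "X2 = X \<inter> vs.span (\<Union>{E \<inter> E', U})"
    have X2: "invariant H X2"
      unfolding X2_def using iEE U(1) by (intro invariant_Int X invariant_span_Union[OF H]) auto
    have "X2 \<inter> E \<subseteq> {0}"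
    proof
      fix x assume x: "x \<in> X2 \<inter> E"
      then have "x \<in> vs.span ((E \<inter> E') \<union> U)" unfolding X2_def by simp
      then obtain e u where eu: "e \<in> E \<inter> E'" "u \<in> U" "x = e + u"
        unfolding vs.span_Un vs.span_eq_iff[THEN iffD2, OF sub[OF iEE]]
          vs.span_eq_iff[THEN iffD2, OF sub[OF U(1)]] by blast
      have "u = x - e" using eu by simp
      then have "u \<in> E" using x eu(1) vs.subspace_diff[OF sub[OF iE(1)]] by blast
      then have "e + u = 0" using eu x by (intro 1) (auto simp: X2_def)
      then show "x \<in> {0}" using eu by simp
    qed
    moreover have "X2 \<inter> Y \<subseteq> {0}" using X(3) unfolding X2_def Y_def by blast
    moreover have "w + w' \<in> X2"
      unfolding X2_def using w by (intro IntI vs.span_add vs.span_base) auto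
    ultimately show ?thesis using w(1) w'Y by (intro disjoint_repsD[OF d X2]) auto
  qed
  then show "disjoint_reps H (E \<inter> E') U" unfolding disjoint_reps_def using U(2) by blast
qed

text \<open>By saturation \<open>U\<close> is disjoint from each member, so
  \<open>insert U F\<close> is still pairwise disjoint and \<open>disjoint_family\<close> applies to
  it.\<close>

lemma saturated_span_Union:
  assumes H: "H \<subseteq> carrier G" and F: "\<And>E. E \<in> F \<Longrightarrow> saturated H E"
    and disj: "\<And>E E'. E \<in> F \<Longrightarrow> E' \<in> F \<Longrightarrow> E \<noteq> E' \<Longrightarrow> disjoint_reps H E E'"
  shows "saturated H (vs.span (\<Union>F))"
  unfolding saturated_def
proof (intro conjI allI impI)
  have inv: "invariant H E" if "E \<in> F" for E using saturated_invariant[OF F[OF that]] .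
  show iF: "invariant H (vs.span (\<Union>F))" by (intro invariant_span_Union[OF H] inv)
  fix U assume "invariant H U \<and> vs.span (\<Union>F) \<inter> U \<subseteq> {0}"
  then have U: "invariant H U" "vs.span (\<Union>F) \<inter> U \<subseteq> {0}" by auto
  have sup: "E \<subseteq> vs.span (\<Union>F)" if "E \<in> F" for E using that vs.span_superset[of "\<Union>F"] by blast
  have dU: "disjoint_reps H E U" if "E \<in> F" for E
    using sup[OF that] U(2) by (intro saturated_disjoint[OF F[OF that] U(1)]) blast
  have dis: "disjoint_reps H W W'" if "W \<in> insert U F" "W' \<in> insert U F" "W \<noteq> W'" for W W'
    using that disj dU disjoint_reps_commute[OF dU] by (elim insertE) simp_all
  have "w + w' = 0"
    if X: "invariant H X" "X \<inter> vs.span (\<Union>F) \<subseteq> {0}" "X \<inter> U \<subseteq> {0}"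
      and w: "w \<in> vs.span (\<Union>F)" "w' \<in> U" "w + w' \<in> X" for X w w'
  proof -
    have "X \<inter> vs.span (\<Union>(insert U F)) \<subseteq> {0}"
    proof (rule disjoint_family[OF H _ dis X(1)])
      show "invariant H W" if "W \<in> insert U F" for W using that inv U(1) by blast
      show "X \<inter> W \<subseteq> {0}" if "W \<in> insert U F" for W
        using that X(2,3) sup[of W] by (elim insertE) auto
    qed
    moreover have "w \<in> vs.span (\<Union>(insert U F))" using w(1) vs.span_mono[of "\<Union>F" "\<Union>(insert U F)"] by auto
    moreover have "w' \<in> vs.span (\<Union>(insert U F))" using w(2) by (intro vs.span_base) auto
    ultimately show ?thesis using w(3) vs.span_add by blast
  qed
  then show "disjoint_reps H (vs.span (\<Union>F)) U" unfolding disjoint_reps_def using U(2) by blast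
qed

text \<open>The operator \<open>\<rho> h - \<psi> h\<close> kills \<open>w\<close>, so it sends
  \<open>w + w'\<close> into \<open>X \<inter> U\<close>, which is zero. Hence \<open>w'\<close> has
  weight \<open>\<psi>\<close> too, and \<open>w + w'\<close> lies in the zero intersection of
  \<open>X\<close> with the weight space.\<close>

lemma saturated_weight_space:
  assumes H: "H \<subseteq> carrier G"
  shows "saturated H (weight_space H \<psi> s V \<rho>)" (is "saturated H ?E")
  unfolding saturated_def
proof (intro conjI allI impI)
  have "vs.subspace ?E"
  proof (rule vs.subspaceI)
    show "0 \<in> ?E" unfolding weight_space_def
      using vs.subspace_0[OF subspace_V] rho_zero H by auto
    show "x + y \<in> ?E" if "x \<in> ?E" "y \<in> ?E" for x y
      using that H vs.subspace_add[OF subspace_V] rho_add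
      unfolding weight_space_def by (auto simp: vs.scale_right_distrib subset_iff)
    show "s c x \<in> ?E" if "x \<in> ?E" for c x
      using that H vs.subspace_scale[OF subspace_V] rho_scale
      unfolding weight_space_def by (auto simp: subset_iff mult.commute)
  qed
  then have sE: "subsp ?E" unfolding subsp_def weight_space_def by blast
  show iE: "invariant H ?E"
    unfolding invariant_def
  proof (intro conjI ballI sE)
    fix h assume h: "h \<in> H"
    have "\<rho> h ` ?E = s (\<psi> h) ` ?E" using h by (intro image_cong refl) (auto simp: weight_space_def)
    also have "\<dots> \<subseteq> ?E" using vs.subspace_scale[OF subsp_subspace[OF sE]] by blast
    finally show "\<rho> h ` ?E \<subseteq> ?E" .
  qed
  fix U assume "invariant H U \<and> ?E \<inter> U \<subseteq> {0}"
  then have U: "invariant H U" "?E \<inter> U \<subseteq> {0}" by auto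
  have "w + w' = 0"
    if X: "invariant H X" "X \<inter> ?E \<subseteq> {0}" "X \<inter> U \<subseteq> {0}"
      and w: "w \<in> ?E" "w' \<in> U" "w + w' \<in> X" for X w w'
  proof -
    note sub = subsp_subspace[OF invariant_subsp]
    have V: "w \<in> V" "w' \<in> V" using w subspD invariant_subsp[OF U(1)] sE by blast+
    have "\<rho> h w' = s (\<psi> h) w'" if h: "h \<in> H" for h
    proof -
      have "\<rho> h (w + w') - s (\<psi> h) (w + w') \<in> X"
        by (intro vs.subspace_diff[OF sub[OF X(1)]] invariant_in[OF X(1) h w(3)]
            vs.subspace_scale[OF sub[OF X(1)] w(3)])
      moreover have "\<rho> h (w + w') - s (\<psi> h) (w + w') = \<rho> h w' - s (\<psi> h) w'"
        using w(1) h H V by (auto simp: weight_space_def rho_add subset_iff vs.scale_right_distrib)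
      moreover have "\<rho> h w' - s (\<psi> h) w' \<in> U"
        by (intro vs.subspace_diff[OF sub[OF U(1)]] invariant_in[OF U(1) h w(2)]
            vs.subspace_scale[OF sub[OF U(1)] w(2)])
      ultimately show ?thesis using X(3) by auto
    qed
    then have "w' \<in> ?E" using V unfolding weight_space_def by blast
    then have "w + w' \<in> X \<inter> ?E" using w vs.subspace_add[OF subsp_subspace[OF sE]] by blast
    then show ?thesis using X(2) by blast
  qed
  then show "disjoint_reps H ?E U" unfolding disjoint_reps_def using U(2) by blast
qed

section \<open>Finite-dimensional subspaces\<close>

definition fin_dim :: "'v set \<Rightarrow> bool" where
  "fin_dim U \<longleftrightarrow> (\<exists>B. finite B \<and> U \<subseteq> vs.span B)"

text \<open>The spanning set in \<open>fin_dim\<close> may lie outside the subspace, which makes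
  this immediate.\<close>

lemma fin_dim_mono: "fin_dim W \<Longrightarrow> U \<subseteq> W \<Longrightarrow> fin_dim U"
  unfolding fin_dim_def by blast

lemma fin_dim_basis:
  assumes "fin_dim U"
  obtains B where "finite B" "B \<subseteq> U" "vs.independent B" "U \<subseteq> vs.span B" "card B = vs.dim U"
proof -
  obtain A where A: "finite A" "U \<subseteq> vs.span A" using assms unfolding fin_dim_def by blast
  obtain B where B: "B \<subseteq> U" "vs.independent B" "U \<subseteq> vs.span B"
    using vs.maximal_independent_subset by blast
  have "finite B" using vs.independent_span_bound[OF A(1) B(2)] A(2) B(1) by blast
  then show ?thesis using that B vs.basis_card_eq_dim[OF B(1,3,2)] by blast
qed

lemma fin_dim_image:
  assumes g: "g \<in> carrier G" and U: "subsp U" "fin_dim U"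
  shows "fin_dim (\<rho> g ` U)"
proof -
  obtain B where B: "finite B" "B \<subseteq> U" "U \<subseteq> vs.span B" using fin_dim_basis[OF U(2)] by metis
  have "B \<subseteq> V" using B(2) U(1) unfolding subsp_def by (meson subset_trans)
  have "\<rho> g ` U \<subseteq> \<rho> g ` vs.span B" by (rule image_mono[OF B(3)])
  also have "\<dots> = vs.span (\<rho> g ` B)" by (rule image_span[OF g \<open>B \<subseteq> V\<close>])
  finally show ?thesis unfolding fin_dim_def using finite_imageI[OF B(1)] by blast
qed

lemma fin_dim_span_Union:
  assumes "finite F" "\<And>U. U \<in> F \<Longrightarrow> fin_dim U"
  shows "fin_dim (vs.span (\<Union>F))"
proof -
  have "\<forall>U\<in>F. \<exists>B. finite B \<and> U \<subseteq> vs.span B" using assms(2) unfolding fin_dim_def by blast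
  then obtain B where B: "\<And>U. U \<in> F \<Longrightarrow> finite (B U) \<and> U \<subseteq> vs.span (B U)" by metis
  have "U \<subseteq> vs.span (\<Union>(B ` F))" if "U \<in> F" for U
    using B[OF that] vs.span_mono[of "B U" "\<Union>(B ` F)"] that by blast
  then have "vs.span (\<Union>F) \<subseteq> vs.span (\<Union>(B ` F))"
    by (intro vs.span_minimal vs.subspace_span) blast
  moreover have "finite (\<Union>(B ` F))" using assms(1) B by auto
  ultimately show ?thesis unfolding fin_dim_def by blast
qed

lemma dim_less:
  assumes U: "vs.subspace U" "U \<subset> W" and W: "fin_dim W"
  shows "vs.dim U < vs.dim W"
proof -
  obtain B where B: "finite B" "B \<subseteq> U" "vs.independent B" "U \<subseteq> vs.span B" "card B = vs.dim U"
    using fin_dim_basis[OF fin_dim_mono[OF W psubset_imp_subset[OF U(2)]]] by metis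
  obtain C where C: "finite C" "W \<subseteq> vs.span C" "card C = vs.dim W"
    using fin_dim_basis[OF W] by metis
  obtain x where x: "x \<in> W" "x \<notin> U" using U(2) by blast
  have "vs.span B \<subseteq> U" by (rule vs.span_minimal[OF B(2) U(1)])
  then have nx: "x \<notin> vs.span B" using x by blast
  then have "vs.independent (insert x B)" using B(3) vs.independent_insertI by blast
  moreover have "B \<subseteq> W" using B(2) U(2) by blast
  then have "insert x B \<subseteq> vs.span C" using x(1) C(2) by blast
  ultimately have "card (insert x B) \<le> card C" using vs.independent_span_bound[OF C(1)] by blast
  moreover have "x \<notin> B" using nx vs.span_base by blast
  ultimately show ?thesis using B(1,5) C(3) by simp
qed

lemma exists_minimal_subspace:
  assumes "P E" and P: "\<And>U. P U \<Longrightarrow> vs.subspace U" and E: "fin_dim E"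
  obtains E' where "P E'" "E' \<subseteq> E" "\<And>U. P U \<Longrightarrow> U \<subseteq> E' \<Longrightarrow> U = E'"
proof -
  define Q where "Q U \<longleftrightarrow> P U \<and> U \<subseteq> E" for U
  have QE: "Q E" using assms(1) unfolding Q_def by blast
  define E' where "E' = (ARG_MIN vs.dim U. Q U)"
  have E': "Q E'" "\<And>U. Q U \<Longrightarrow> vs.dim E' \<le> vs.dim U"
    unfolding E'_def by (rule arg_min_natI[of Q, OF QE], rule arg_min_nat_le[of Q])
  have PE: "P E'" and EE: "E' \<subseteq> E" using E'(1) unfolding Q_def by auto
  show ?thesis
  proof (rule that[OF PE EE])
    fix U assume U: "P U" "U \<subseteq> E'"
    show "U = E'"
    proof (rule ccontr)
      assume "U \<noteq> E'"
      then have "vs.dim U < vs.dim E'"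
        using U by (intro dim_less P fin_dim_mono[OF E EE]) auto
      moreover have "Q U" using U EE unfolding Q_def by blast
      ultimately show False using E'(2)[of U] by simp
    qed
  qed
qed

end

section \<open>Translates of a maximal saturated subspace\<close>

context group
begin

lemma conj_nat_pow:
  assumes "x \<in> carrier G" "h \<in> carrier G"
  shows "(inv x \<otimes> h \<otimes> x) [^] (n::nat) = inv x \<otimes> h [^] n \<otimes> x"
proof (induction n)
  case (Suc n)
  then show ?case using assms by (simp add: word_simps)
qed (use assms in simp)

lemma conjugate_normalizer_of: "g \<in> normalizer_of K \<Longrightarrow> conjugate g K = K"
  unfolding normalizer_of_def by blast

lemma normalizer_of_carrier: "g \<in> normalizer_of K \<Longrightarrow> g \<in> carrier G"
  unfolding normalizer_of_def by blast

end

context projective_rep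
begin

section \<open>Stabilizers of subspaces and spans of translates\<close>

definition stabilizer_of :: "'v set \<Rightarrow> 'a set" where
  "stabilizer_of U = {g \<in> carrier G. \<rho> g ` U = U}"

lemma stabilizer_of_subgroup:
  assumes U: "subsp U"
  shows "subgroup (stabilizer_of U) G"
proof (rule subgroupI)
  show "stabilizer_of U \<subseteq> carrier G" unfolding stabilizer_of_def by blast
  show "stabilizer_of U \<noteq> {}" unfolding stabilizer_of_def using image_one[OF U] by blast
  show "inv a \<in> stabilizer_of U" if "a \<in> stabilizer_of U" for a
    using that image_inv(1)[OF _ U, of a] unfolding stabilizer_of_def by simp
  show "a \<otimes> b \<in> stabilizer_of U" if "a \<in> stabilizer_of U" "b \<in> stabilizer_of U" for a b
    using that image_mult[OF _ _ U, of a b] unfolding stabilizer_of_def by simp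
qed

lemma invariant_stabilizer_of: "subsp U \<Longrightarrow> invariant (stabilizer_of U) U"
  unfolding invariant_def stabilizer_of_def by blast

lemma subset_stabilizer_of:
  assumes "subgroup K G" "invariant K U"
  shows "K \<subseteq> stabilizer_of U"
  using invariant_image_eq[OF assms] subgroup.mem_carrier[OF assms(1)] unfolding stabilizer_of_def by blast

definition translates :: "'v set \<Rightarrow> 'a set \<Rightarrow> 'v set" where
  "translates E A = vs.span (\<Union>g\<in>A. \<rho> g ` E)"

lemma translates_mono: "A \<subseteq> B \<Longrightarrow> translates E A \<subseteq> translates E B"
  unfolding translates_def by (intro vs.span_mono UN_mono) auto

lemma translates_superset: "g \<in> A \<Longrightarrow> \<rho> g ` E \<subseteq> translates E A"
  unfolding translates_def using vs.span_superset[of "\<Union>g\<in>A. \<rho> g ` E"] by blast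

lemma subset_translates: "subsp E \<Longrightarrow> \<one> \<in> A \<Longrightarrow> E \<subseteq> translates E A"
  using translates_superset[of \<one> A E] image_one by simp

lemma translates_image_V: "A \<subseteq> carrier G \<Longrightarrow> E \<subseteq> V \<Longrightarrow> (\<Union>g\<in>A. \<rho> g ` E) \<subseteq> V"
  using rho_closed by blast

lemma subsp_translates: "A \<subseteq> carrier G \<Longrightarrow> subsp E \<Longrightarrow> subsp (translates E A)"
  unfolding translates_def subsp_def[of E] by (intro subsp_span translates_image_V) simp_all

lemma image_translates:
  assumes "x \<in> carrier G" "A \<subseteq> carrier G" "subsp E"
  shows "\<rho> x ` translates E A = translates E ((\<lambda>a. x \<otimes> a) ` A)"
proof -
  have E: "E \<subseteq> V" using assms(3) unfolding subsp_def by blast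
  have "\<rho> x ` translates E A = vs.span (\<rho> x ` (\<Union>g\<in>A. \<rho> g ` E))"
    unfolding translates_def by (rule image_span[OF assms(1) translates_image_V[OF assms(2) E]])
  also have "\<rho> x ` (\<Union>g\<in>A. \<rho> g ` E) = (\<Union>g\<in>A. \<rho> x ` \<rho> g ` E)" by (rule image_UN)
  also have "\<dots> = (\<Union>g\<in>A. \<rho> (x \<otimes> g) ` E)"
    using assms(2) by (intro SUP_cong refl image_mult assms(1,3)) blast
  finally show ?thesis unfolding translates_def by simp
qed

lemma translates_Un:
  assumes "x \<in> translates E (A \<union> B)"
  obtains p q where "p \<in> translates E A" "q \<in> translates E B" "x = p + q"
proof -
  have "(\<Union>g\<in>A \<union> B. \<rho> g ` E) = (\<Union>g\<in>A. \<rho> g ` E) \<union> (\<Union>g\<in>B. \<rho> g ` E)" by blast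
  then have "x \<in> {x + y |x y. x \<in> translates E A \<and> y \<in> translates E B}"
    using assms unfolding translates_def by (simp add: vs.span_Un)
  then show ?thesis using that by blast
qed

lemma left_mult_subgroup:
  assumes "subgroup K G" "k \<in> K"
  shows "(\<lambda>a. k \<otimes> a) ` K = K"
proof
  interpret K: subgroup K G by (rule assms(1))
  show "(\<lambda>a. k \<otimes> a) ` K \<subseteq> K" using K.m_closed[OF assms(2)] by blast
  show "K \<subseteq> (\<lambda>a. k \<otimes> a) ` K"
  proof
    fix a assume a: "a \<in> K"
    have "a = k \<otimes> (inv k \<otimes> a)" using a assms(2) by (simp add: word_simps)
    moreover have "inv k \<otimes> a \<in> K" using a assms(2) by simp
    ultimately show "a \<in> (\<lambda>a. k \<otimes> a) ` K" by blast
  qed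
qed

lemma image_translates_subgroup:
  assumes "subgroup K G" "subsp E" "k \<in> K"
  shows "\<rho> k ` translates E K = translates E K"
  using image_translates[OF _ subgroup.subset[OF assms(1)] assms(2), of k] left_mult_subgroup[OF assms(1,3)]
    subgroup.mem_carrier[OF assms(1,3)] by simp

lemma invariant_translates: "subgroup K G \<Longrightarrow> subsp E \<Longrightarrow> invariant K (translates E K)"
  unfolding invariant_def
  by (intro conjI ballI subsp_translates subgroup.subset) (simp_all add: image_translates_subgroup)

lemma translates_finite_subset:
  assumes "fin_dim Q" "Q \<subseteq> translates E A"
  obtains F where "finite F" "F \<subseteq> A" "Q \<subseteq> translates E F"
proof -
  obtain B where B: "finite B" "B \<subseteq> Q" "Q \<subseteq> vs.span B" using fin_dim_basis[OF assms(1)] by metis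
  have "\<exists>F. finite F \<and> F \<subseteq> A \<and> b \<in> translates E F" if b: "b \<in> B" for b
  proof -
    have "b \<in> vs.span (\<Union>((\<lambda>g. \<rho> g ` E) ` A))"
      using b B assms(2) unfolding translates_def by blast
    then obtain F where F: "finite F" "F \<subseteq> (\<lambda>g. \<rho> g ` E) ` A" "b \<in> vs.span (\<Union>F)"
      by (rule in_span_Union_finite)
    obtain C where C: "C \<subseteq> A" "finite C" "F = (\<lambda>g. \<rho> g ` E) ` C"
      using finite_subset_image[OF F(1,2)] by metis
    then show ?thesis using F(3) unfolding translates_def by blast
  qed
  then obtain f where f: "\<And>b. b \<in> B \<Longrightarrow> finite (f b) \<and> f b \<subseteq> A \<and> b \<in> translates E (f b)" by metis
  define F where "F = (\<Union>b\<in>B. f b)"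
  have "B \<subseteq> translates E F"
  proof
    fix b assume b: "b \<in> B"
    then have "f b \<subseteq> F" unfolding F_def by blast
    then show "b \<in> translates E F" using f[OF b] translates_mono by blast
  qed
  then have "vs.span B \<subseteq> translates E F"
    unfolding translates_def by (rule vs.span_minimal[OF _ vs.subspace_span])
  then have "Q \<subseteq> translates E F" using B(3) by blast
  moreover have "finite F" "F \<subseteq> A" unfolding F_def using B(1) f by auto
  ultimately show ?thesis using that by blast
qed

end

text \<open>\<open>H_maximal\<close> compares \<open>H\<close> with groups carrying any
  finite-dimensional saturated space, so it can be applied to spans of translates of
  \<open>E\<close> and to conjugates of \<open>H\<close>. \<open>E_minimal\<close> concerns the
  fixed group \<open>H\<close> and handles intersections of translates.\<close>

locale maximal_saturated = projective_rep +
  fixes H :: "'a set" and E :: "'c set"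
  assumes nilpotent: "nilpotent_group G"
    and H: "subgroup H G" and E: "saturated H E" and fin_dim_E: "fin_dim E" and E_nonzero: "\<not> E \<subseteq> {0}"
    and H_maximal: "\<And>H' E'. subgroup H' G \<Longrightarrow> saturated H' E' \<Longrightarrow> fin_dim E' \<Longrightarrow> \<not> E' \<subseteq> {0} \<Longrightarrow> H \<subseteq> H' \<Longrightarrow> H' = H"
    and E_minimal: "\<And>E'. saturated H E' \<Longrightarrow> \<not> E' \<subseteq> {0} \<Longrightarrow> E' \<subseteq> E \<Longrightarrow> E' = E"
begin

lemma H_carrier: "H \<subseteq> carrier G"
  by (rule subgroup.subset[OF H])

lemma invariant_E: "invariant H E"
  by (rule saturated_invariant[OF E])

lemma subsp_E: "subsp E"
  by (rule invariant_subsp[OF invariant_E])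

lemma E_subset_V: "E \<subseteq> V"
  using subsp_E unfolding subsp_def by blast

lemma image_E_nonzero: "g \<in> carrier G \<Longrightarrow> \<not> \<rho> g ` E \<subseteq> {0}"
  using image_subset_zero_iff[OF _ E_subset_V] E_nonzero by simp

lemma stabilizer_saturated:
  assumes "saturated H E'" "fin_dim E'" "\<not> E' \<subseteq> {0}"
  shows "stabilizer_of E' = H"
proof (rule H_maximal[OF _ _ assms(2,3)])
  note i = saturated_invariant[OF assms(1)]
  note s = invariant_subsp[OF i]
  show "subgroup (stabilizer_of E') G" by (rule stabilizer_of_subgroup[OF s])
  show "H \<subseteq> stabilizer_of E'" by (rule subset_stabilizer_of[OF H i])
  then show "saturated (stabilizer_of E') E'"
    by (rule saturated_mono[OF assms(1) _ invariant_stabilizer_of[OF s]])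
qed

lemma saturated_translate: "g \<in> normalizer_of H \<Longrightarrow> saturated H (\<rho> g ` E)"
  using saturated_conjugate[OF _ H_carrier E, of g] unfolding normalizer_of_def by simp

lemma normalizer_of_H_subgroup: "subgroup (normalizer_of H) G"
  by (rule normalizer_of_subgroup[OF H_carrier])

text \<open>Translates by the normalizer are again saturated over \<open>H\<close>, and so is their
  intersection. If it is nonzero, moving it back into \<open>E\<close> gives all of \<open>E\<close>
  by minimality, so it equals both translates.\<close>

lemma disjoint_translates_normalizer:
  assumes g: "g \<in> normalizer_of H" "g' \<in> normalizer_of H" and ne: "\<rho> g ` E \<noteq> \<rho> g' ` E"
  shows "disjoint_reps H (\<rho> g ` E) (\<rho> g' ` E)"
proof (cases "\<rho> g ` E \<inter> \<rho> g' ` E \<subseteq> {0}")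
  case True
  then show ?thesis
    by (intro saturated_disjoint saturated_translate g saturated_invariant[OF saturated_translate[OF g(2)]])
next
  case False
  define I where "I = \<rho> g ` E \<inter> \<rho> g' ` E"
  have I: "saturated H I"
    unfolding I_def by (intro saturated_Int saturated_translate g H_carrier)
  note sI = invariant_subsp[OF saturated_invariant[OF I]]
  have "I = \<rho> x ` E" if x: "x \<in> normalizer_of H" "I \<subseteq> \<rho> x ` E" for x
  proof -
    have xG: "x \<in> carrier G" "inv x \<in> carrier G" using normalizer_of_carrier[OF x(1)] by auto
    have "inv x \<in> normalizer_of H" using subgroup.m_inv_closed[OF normalizer_of_H_subgroup x(1)] .
    then have "saturated H (\<rho> (inv x) ` I)"
      using saturated_conjugate[OF xG(2) H_carrier I] by (simp add: conjugate_normalizer_of)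
    moreover have "\<not> \<rho> (inv x) ` I \<subseteq> {0}"
      using image_subset_zero_iff[OF xG(2)] sI False unfolding I_def subsp_def by blast
    moreover have "\<rho> (inv x) ` I \<subseteq> E"
      using image_mono[OF x(2), of "\<rho> (inv x)"] image_inv(1)[OF xG(1) subsp_E] by simp
    ultimately have "\<rho> (inv x) ` I = E" by (rule E_minimal)
    then show ?thesis using image_inv(2)[OF xG(1) sI] by simp
  qed
  then have "I = \<rho> g ` E" "I = \<rho> g' ` E" using g unfolding I_def by auto
  then show ?thesis using ne by simp
qed

text \<open>If \<open>g [^] n\<close> lies in \<open>H\<close>, then \<open>g\<close> permutes the
  translates of \<open>E\<close> by \<open>g [^] i\<close> with \<open>i < n\<close>. Their span is
  finite dimensional and saturated over \<open>H\<close>, so by maximality its stabilizer is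
  \<open>H\<close>; but \<open>g\<close> stabilizes it.\<close>

lemma normalizer_torsion_free:
  assumes g: "g \<in> normalizer_of H" and n: "n > 0" "g [^] (n::nat) \<in> H"
  shows "g \<in> H"
proof -
  have gG: "g \<in> carrier G" by (rule normalizer_of_carrier[OF g])
  have gN: "g [^] i \<in> normalizer_of H" for i :: nat
    by (rule subgroup_nat_pow_closed[OF normalizer_of_H_subgroup g])
  define f where "f i = \<rho> (g [^] i) ` E" for i :: nat
  define E' where "E' = vs.span (\<Union>(f ` {0..<n}))"
  have sat: "saturated H E'"
    unfolding E'_def f_def
    by (rule saturated_span_Union[OF H_carrier])
      (use saturated_translate[OF gN] disjoint_translates_normalizer[OF gN gN] in blast)+
  have fd: "fin_dim E'"
    unfolding E'_def f_def using fin_dim_image[OF _ subsp_E fin_dim_E] gG by (intro fin_dim_span_Union) auto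
  have "E = f 0" unfolding f_def using image_one[OF subsp_E] by simp
  moreover have "f 0 \<subseteq> \<Union>(f ` {0..<n})" using n(1) by (intro Union_upper imageI) simp
  ultimately have "E \<subseteq> E'" unfolding E'_def using vs.span_superset[of "\<Union>(f ` {0..<n})"] by blast
  then have "\<not> E' \<subseteq> {0}" using E_nonzero by blast
  then have st: "stabilizer_of E' = H" by (rule stabilizer_saturated[OF sat fd])
  have "f n = E" unfolding f_def by (rule invariant_image_eq[OF H invariant_E n(2)])
  with \<open>E = f 0\<close> have fn: "f n = f 0" by simp
  have split: "{1..n} = insert n {1..<n}" "{0..<n} = insert 0 {1..<n}" using n(1) by auto
  have "f ` {1..n} = f ` {0..<n}" unfolding split image_insert fn ..
  moreover have "(\<lambda>i. f (Suc i)) ` {0..<n} = f ` Suc ` {0..<n}" by (simp only: image_image)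
  moreover have "Suc ` {0..<n} = {1..n}" by (simp add: atLeastLessThanSuc_atLeastAtMost)
  ultimately have shift: "(\<lambda>i. f (Suc i)) ` {0..<n} = f ` {0..<n}" by simp
  have fV: "\<Union>(f ` {0..<n}) \<subseteq> V"
    unfolding f_def using subsp_image[OF _ subsp_E] gG unfolding subsp_def by blast
  have "\<rho> g ` f i = f (Suc i)" for i
    unfolding f_def using gG by (simp only: image_mult[OF gG _ subsp_E] nat_pow_closed nat_pow_Suc2)
  then have "\<rho> g ` \<Union>(f ` {0..<n}) = \<Union>(f ` {0..<n})" using shift by (simp add: image_UN)
  then have "\<rho> g ` E' = E'" unfolding E'_def image_span[OF gG fV] by simp
  then show ?thesis using st gG unfolding stabilizer_of_def by blast
qed

lemma H_isolated: "y \<in> carrier G \<Longrightarrow> m > 0 \<Longrightarrow> y [^] (m::nat) \<in> H \<Longrightarrow> y \<in> H"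
  by (rule isolated_if_normalizer_torsion_free[OF nilpotent H normalizer_torsion_free])

text \<open>The translate of \<open>E\<close> by \<open>x\<close> is saturated over
  \<open>conjugate x H\<close>, so maximality excludes a proper inclusion.\<close>

lemma subset_conjugate_imp_normalizer:
  assumes x: "x \<in> carrier G" and sub: "H \<subseteq> conjugate x H"
  shows "x \<in> normalizer_of H"
proof -
  have "conjugate x H = H"
    by (rule H_maximal[OF conjugate_subgroup[OF x H] saturated_conjugate[OF x H_carrier E]
          fin_dim_image[OF x subsp_E fin_dim_E] image_E_nonzero[OF x] sub])
  then show ?thesis unfolding normalizer_of_def using x by blast
qed

text \<open>For a subgroup \<open>K\<close> containing \<open>H\<close> this says that the
  translates of \<open>E\<close> along the cosets of \<open>H\<close> in \<open>K\<close> form a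
  direct sum, that is, \<open>translates E K\<close> is the representation induced from
  \<open>H\<close> to \<open>K\<close>.\<close>

definition independent_over :: "'a set \<Rightarrow> bool" where
  "independent_over K \<longleftrightarrow> E \<inter> translates E (K - H) \<subseteq> {0}"

text \<open>A substitute for saturation when \<open>translates E K\<close> has infinite dimension:
  each nonzero subrepresentation contains a nonzero part of \<open>E\<close>, and comparisons can be
  made on that finite-dimensional part.\<close>

definition meets_over :: "'a set \<Rightarrow> bool" where
  "meets_over K \<longleftrightarrow> (\<forall>X. invariant K X \<longrightarrow> X \<subseteq> translates E K \<longrightarrow> \<not> X \<subseteq> {0} \<longrightarrow> \<not> X \<inter> E \<subseteq> {0})"

lemma translates_H: "translates E H = E"
proof -
  have "(\<Union>g\<in>H. \<rho> g ` E) = (\<Union>g\<in>H. E)"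
    by (intro SUP_cong refl invariant_image_eq[OF H invariant_E])
  also have "\<dots> = E" using subgroup.one_closed[OF H] by blast
  finally show ?thesis
    unfolding translates_def using subsp_E vs.span_eq_iff unfolding subsp_def by simp
qed

lemma base_over_H: "independent_over H" "meets_over H"
proof -
  show "independent_over H" unfolding independent_over_def translates_def by simp
  show "meets_over H" unfolding meets_over_def translates_H by (simp add: Int_absorb2)
qed

text \<open>Distinct translates of \<open>W = translates E K\<close> by the normalizer are disjoint
  over \<open>K\<close>, hence independent, and by \<open>sep\<close> an element outside
  \<open>K\<close> moves \<open>W\<close> to a different translate. So independence inside
  \<open>W\<close> and independence of the blocks combine. An invariant subspace meets some block;
  the element moving \<open>W\<close> to that block preserves the subspace, which therefore meets
  \<open>W\<close> and then \<open>E\<close>.\<close>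

lemma normalizer_step:
  assumes K: "subgroup K G" "H \<subseteq> K" and ind: "independent_over K" and meets: "meets_over K"
    and disj: "\<And>g g'. g \<in> normalizer_of K \<Longrightarrow> g' \<in> normalizer_of K \<Longrightarrow>
      \<rho> g ` translates E K \<noteq> \<rho> g' ` translates E K \<Longrightarrow>
      disjoint_reps K (\<rho> g ` translates E K) (\<rho> g' ` translates E K)"
    and sep: "\<And>g. g \<in> normalizer_of K \<Longrightarrow> \<rho> g ` translates E K = translates E K \<Longrightarrow> g \<in> K"
  shows "independent_over (normalizer_of K)" "meets_over (normalizer_of K)"
proof -
  note KG = subgroup.subset[OF K(1)]
  define N where "N = normalizer_of K"
  have N: "subgroup N G" unfolding N_def by (rule normalizer_of_subgroup[OF KG])
  have NG: "N \<subseteq> carrier G" by (rule subgroup.subset[OF N])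
  have KN: "K \<subseteq> N" unfolding N_def by (rule subgroup_normalizer_of[OF K(1)])
  define W where "W = translates E K"
  have W: "invariant K W" unfolding W_def by (rule invariant_translates[OF K(1) subsp_E])
  note sW = invariant_subsp[OF W]
  define \<W> where "\<W> = (\<lambda>g. \<rho> g ` W) ` N"
  have invW: "invariant K U" if "U \<in> \<W>" for U
  proof -
    obtain g where g: "g \<in> N" "U = \<rho> g ` W" using \<open>U \<in> \<W>\<close> unfolding \<W>_def by blast
    then show ?thesis
      using invariant_conjugate[OF _ KG W, of g] conjugate_normalizer_of[of g K] NG unfolding N_def by auto
  qed
  have disjW: "disjoint_reps K U U'" if "U \<in> \<W>" "U' \<in> \<W>" "U \<noteq> U'" for U U'
    using that disj unfolding \<W>_def W_def N_def by blast
  have WW: "W \<in> \<W>"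
    unfolding \<W>_def using image_one[OF sW] subgroup.one_closed[OF N] by (metis image_eqI)
  have img: "\<rho> g ` E \<subseteq> \<rho> g ` W" for g
    unfolding W_def using subset_translates[OF subsp_E] subgroup.one_closed[OF K(1)] by (intro image_mono)
  have EW: "E \<subseteq> W"
    unfolding W_def by (rule subset_translates[OF subsp_E subgroup.one_closed[OF K(1)]])
  show "independent_over (normalizer_of K)"
    unfolding independent_over_def N_def[symmetric]
  proof
    fix e assume e: "e \<in> E \<inter> translates E (N - H)"
    have "N - H = (K - H) \<union> (N - K)" using KN K(2) by blast
    then have "e \<in> translates E ((K - H) \<union> (N - K))" using e by simp
    then obtain p q where pq: "p \<in> translates E (K - H)" "q \<in> translates E (N - K)" "e = p + q"
      by (rule translates_Un)
    have pW: "p \<in> W" using pq(1) translates_mono[of "K - H" K] unfolding W_def by blast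
    have "translates E (N - K) \<subseteq> vs.span (\<Union>(\<W> - {W}))"
      unfolding translates_def
    proof (intro vs.span_mono UN_least)
      fix g assume g: "g \<in> N - K"
      then have "\<rho> g ` W \<noteq> W" using sep unfolding W_def N_def by blast
      then have "\<rho> g ` W \<in> \<W> - {W}" using g unfolding \<W>_def by blast
      then show "\<rho> g ` E \<subseteq> \<Union>(\<W> - {W})" using img[of g] by blast
    qed
    then have "q \<in> vs.span (\<Union>(\<W> - {W}))" using pq(2) by blast
    moreover have "q = e - p" using pq(3) by simp
    then have "q \<in> W" using vs.subspace_diff[OF subsp_subspace[OF sW] _ pW, of e] e EW by auto
    ultimately have "q \<in> W \<inter> vs.span (\<Union>(\<W> - {W}))" by blast
    then have "q = 0" using disjoint_family_independent[OF KG invW disjW WW] by blast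
    then have "e \<in> E \<inter> translates E (K - H)" using pq e by simp
    then show "e \<in> {0}" using ind unfolding independent_over_def by blast
  qed
  show "meets_over (normalizer_of K)"
    unfolding meets_over_def N_def[symmetric]
  proof (intro allI impI)
    fix X assume X: "invariant N X" "X \<subseteq> translates E N" "\<not> X \<subseteq> {0}"
    note XK = invariant_mono[OF X(1) KN]
    have "translates E N \<subseteq> vs.span (\<Union>\<W>)"
      unfolding translates_def \<W>_def using img by (intro vs.span_mono) blast
    then have "\<not> X \<inter> vs.span (\<Union>\<W>) \<subseteq> {0}" using X by blast
    then obtain U where "U \<in> \<W>" "\<not> X \<inter> U \<subseteq> {0}"
      using disjoint_family[OF KG invW disjW XK] by blast
    then obtain g where g: "g \<in> N" "\<not> X \<inter> \<rho> g ` W \<subseteq> {0}" unfolding \<W>_def by blast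
    have gG: "g \<in> carrier G" using g NG by blast
    have "\<rho> g ` X = X" by (rule invariant_image_eq[OF N X(1) g(1)])
    then have "\<rho> g ` (X \<inter> W) = X \<inter> \<rho> g ` W"
      using image_Int[OF gG invariant_subsp[OF X(1)] sW] by simp
    then have "\<not> X \<inter> W \<subseteq> {0}"
      using g(2) image_subset_zero_iff[OF gG, of "X \<inter> W"] sW unfolding subsp_def by auto
    then have "\<not> (X \<inter> W) \<inter> E \<subseteq> {0}"
      using meets invariant_Int[OF XK W] unfolding meets_over_def W_def by blast
    then show "\<not> X \<inter> E \<subseteq> {0}" by blast
  qed
qed

lemma translate_not_in_complement:
  assumes K: "subgroup K G" "H \<subseteq> K" and ind: "independent_over K" and x: "x \<in> K"
  shows "\<rho> x ` E \<inter> \<rho> x ` translates E (K - H) \<subseteq> {0}"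
proof -
  have xG: "x \<in> carrier G" by (rule subgroup.mem_carrier[OF K(1) x])
  have "K - H \<subseteq> carrier G" using subgroup.subset[OF K(1)] by blast
  then show ?thesis
    using ind image_Int[OF xG subsp_E subsp_translates[OF _ subsp_E], of "K - H"]
      image_subset_zero_iff[OF xG, of "E \<inter> translates E (K - H)"] E_subset_V
    unfolding independent_over_def by auto
qed

lemma image_complement:
  assumes K: "subgroup K G" "H \<subseteq> K" and x: "x \<in> K"
  shows "\<rho> x ` translates E (K - H) = translates E {k \<in> K. inv x \<otimes> k \<notin> H}"
proof -
  interpret K: subgroup K G by (rule K(1))
  have xG: "x \<in> carrier G" by (rule K.mem_carrier[OF x])
  have "(\<lambda>a. x \<otimes> a) ` (K - H) = {k \<in> K. inv x \<otimes> k \<notin> H}"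
  proof
    show "(\<lambda>a. x \<otimes> a) ` (K - H) \<subseteq> {k \<in> K. inv x \<otimes> k \<notin> H}"
    proof
      fix k assume "k \<in> (\<lambda>a. x \<otimes> a) ` (K - H)"
      then obtain a where a: "a \<in> K" "a \<notin> H" "k = x \<otimes> a" by blast
      have "inv x \<otimes> k = a" using a xG by (simp add: word_simps)
      moreover have "k \<in> K" using K.m_closed[OF x a(1)] a(3) by simp
      ultimately show "k \<in> {k \<in> K. inv x \<otimes> k \<notin> H}" using a(2) by simp
    qed
    show "{k \<in> K. inv x \<otimes> k \<notin> H} \<subseteq> (\<lambda>a. x \<otimes> a) ` (K - H)"
    proof
      fix k assume "k \<in> {k \<in> K. inv x \<otimes> k \<notin> H}"
      then have k: "k \<in> K" "inv x \<otimes> k \<notin> H" by auto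
      have "k = x \<otimes> (inv x \<otimes> k)" using k(1) xG by (simp add: word_simps)
      moreover have "inv x \<otimes> k \<in> K" by (rule K.m_closed[OF K.m_inv_closed[OF x] k(1)])
      ultimately show "k \<in> (\<lambda>a. x \<otimes> a) ` (K - H)" using k(2) by blast
    qed
  qed
  moreover have "K - H \<subseteq> carrier G" using K.subset by blast
  ultimately show ?thesis using image_translates[OF xG _ subsp_E, of "K - H"] by simp
qed

lemma same_coset_image:
  assumes "x \<in> carrier G" "y \<in> carrier G" "inv x \<otimes> y \<in> H"
  shows "\<rho> y ` E = \<rho> x ` E"
proof -
  have G: "inv x \<otimes> y \<in> carrier G" using assms by simp
  have "y = x \<otimes> (inv x \<otimes> y)" using assms by (simp add: word_simps)
  then have "\<rho> y ` E = \<rho> x ` \<rho> (inv x \<otimes> y) ` E"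
    using image_mult[OF assms(1) G subsp_E] by simp
  then show ?thesis using invariant_image_eq[OF H invariant_E assms(3)] by simp
qed

text \<open>
  For \<open>x \<in> K\<close>, the vectors in the sum of the \<open>k E\<close> with \<open>k \<in> K - x H\<close> are those with zero component at
  the coset \<open>x H\<close>.
\<close>

lemma zero_if_all_components_zero:
  assumes K: "subgroup K G" "H \<subseteq> K" and ind: "independent_over K"
    and F: "finite F" "F \<subseteq> K"
  shows "w \<in> translates E F \<Longrightarrow> (\<And>x. x \<in> F \<Longrightarrow> w \<in> translates E {k \<in> K. inv x \<otimes> k \<notin> H}) \<Longrightarrow> w = 0"
  using F
proof (induction F arbitrary: w)
  case empty
  then show ?case by (simp add: translates_def)
next
  case (insert x F)
  note KG = subgroup.mem_carrier[OF K(1)]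
  have x: "x \<in> K" and F: "F \<subseteq> K" using insert.prems by auto
  have IH: "w = 0" if "w \<in> translates E F"
    using that insert.prems(2) F by (intro insert.IH) auto
  show ?case
  \<comment> \<open>A coset already represented in \<open>F\<close> adds nothing to the span.
    Otherwise neither \<open>w\<close> nor \<open>q\<close> has a component at \<open>x H\<close>,
    so \<open>p\<close>, which lies in the translate by \<open>x\<close>, has none either and
    vanishes.\<close>
  proof (cases "\<exists>f\<in>F. inv x \<otimes> f \<in> H")
    case True
    then obtain f where f: "f \<in> F" "inv x \<otimes> f \<in> H" by blast
    have "\<rho> f ` E = \<rho> x ` E" using f F by (intro same_coset_image KG x) auto
    then have "\<rho> x ` E \<subseteq> (\<Union>g\<in>F. \<rho> g ` E)" using f(1) by blast
    then have "(\<Union>g\<in>insert x F. \<rho> g ` E) = (\<Union>g\<in>F. \<rho> g ` E)" by auto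
    then show ?thesis using insert.prems(1) IH unfolding translates_def by simp
  next
    case False
    have "insert x F = {x} \<union> F" by simp
    then have "w \<in> translates E ({x} \<union> F)" using insert.prems(1) by simp
    then obtain p q where pq: "p \<in> translates E {x}" "q \<in> translates E F" "w = p + q"
      by (rule translates_Un)
    have "vs.subspace (\<rho> x ` E)" by (rule subsp_subspace[OF subsp_image[OF KG[OF x] subsp_E]])
    then have e: "vs.span (\<rho> x ` E) = \<rho> x ` E" by (rule vs.span_eq_iff[THEN iffD2])
    have "p \<in> vs.span (\<rho> x ` E)" using pq(1) unfolding translates_def by simp
    then have p: "p \<in> \<rho> x ` E" unfolding e .
    have "F \<subseteq> {k \<in> K. inv x \<otimes> k \<notin> H}" using F False by blast
    then have "q \<in> translates E {k \<in> K. inv x \<otimes> k \<notin> H}" using pq(2) translates_mono by blast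
    moreover have "w \<in> translates E {k \<in> K. inv x \<otimes> k \<notin> H}" using insert.prems(2) by simp
    ultimately have "w - q \<in> translates E {k \<in> K. inv x \<otimes> k \<notin> H}"
      unfolding translates_def by (intro vs.span_diff)
    then have "p \<in> \<rho> x ` E \<inter> \<rho> x ` translates E (K - H)"
      using p pq(3) by (simp add: image_complement[OF K x])
    then have "p = 0" using translate_not_in_complement[OF K ind x] by blast
    then show ?thesis using IH pq by simp
  qed
qed

text \<open>\<open>Q\<close> lies in the sum of the translates by a finite set \<open>F\<close>. If
  \<open>w\<close> has a nonzero component at \<open>x H\<close>, then
  \<open>\<rho> (h [^] k) w\<close> has one at the coset of \<open>h [^] k \<otimes> x\<close>. All
  these cosets are represented in \<open>F\<close>, so two of them agree and a positive power of
  \<open>h\<close> lies in \<open>conjugate x H\<close>. Isolation of \<open>H\<close> removes the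
  power.\<close>

lemma finite_dimensional_subrep_of_translates:
  assumes K: "subgroup K G" "H \<subseteq> K" and ind: "independent_over K"
    and L: "subgroup L G" "L \<subseteq> K"
    and Q: "invariant L Q" "Q \<subseteq> translates E K" "fin_dim Q" "\<not> Q \<subseteq> {0}"
  shows "\<exists>x\<in>K. L \<subseteq> conjugate x H"
proof -
  note KG = subgroup.mem_carrier[OF K(1)]
  obtain F where F: "finite F" "F \<subseteq> K" "Q \<subseteq> translates E F"
    using translates_finite_subset[OF Q(3,2)] by metis
  obtain w where w: "w \<in> Q" "w \<noteq> 0" using Q(4) by blast
  have "w \<in> translates E F" using F(3) w(1) by blast
  then obtain x where x: "x \<in> F" "w \<notin> translates E {k \<in> K. inv x \<otimes> k \<notin> H}"
    using zero_if_all_components_zero[OF K ind F(1,2)] w(2) by metis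
  have xK: "x \<in> K" and xG: "x \<in> carrier G" using x F(2) KG by auto
  have "L \<subseteq> conjugate x H"
  proof
    fix h assume h: "h \<in> L"
    have hG: "h \<in> carrier G" and hK: "h \<in> K" using subgroup.mem_carrier[OF L(1) h] L(2) h by auto
    \<comment> \<open>If \<open>F\<close> missed the coset of \<open>h [^] k \<otimes> x\<close>,
      all of \<open>Q\<close> would have zero component there, and undoing
      \<open>\<rho> (h [^] k)\<close> would leave \<open>w\<close> with zero component at
      \<open>x H\<close>.\<close>
    have "\<exists>f\<in>F. inv (h [^] k \<otimes> x) \<otimes> f \<in> H" for k :: nat
    proof (rule ccontr)
      assume neg: "\<not> (\<exists>f\<in>F. inv (h [^] k \<otimes> x) \<otimes> f \<in> H)"
      have hk: "h [^] k \<in> K" "h [^] k \<in> L" "h [^] k \<in> carrier G"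
        using subgroup_nat_pow_closed[OF K(1) hK] subgroup_nat_pow_closed[OF L(1) h] hG by auto
      have hkx: "h [^] k \<otimes> x \<in> K" by (rule subgroup.m_closed[OF K(1) hk(1) xK])
      have "F \<subseteq> {g \<in> K. inv (h [^] k \<otimes> x) \<otimes> g \<notin> H}" using neg F(2) by blast
      then have "Q \<subseteq> translates E {g \<in> K. inv (h [^] k \<otimes> x) \<otimes> g \<notin> H}"
        using F(3) translates_mono by blast
      then have "Q \<subseteq> \<rho> (h [^] k \<otimes> x) ` translates E (K - H)" by (simp add: image_complement[OF K hkx])
      moreover have "subsp (translates E (K - H))"
        using KG by (intro subsp_translates subsp_E) blast
      then have "\<rho> (h [^] k \<otimes> x) ` translates E (K - H) = \<rho> (h [^] k) ` \<rho> x ` translates E (K - H)"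
        using image_mult[OF hk(3) xG] by simp
      ultimately have 1: "Q \<subseteq> \<rho> (h [^] k) ` translates E {k \<in> K. inv x \<otimes> k \<notin> H}"
        by (simp add: image_complement[OF K xK])
      have "\<rho> (h [^] k) w \<in> Q" by (rule invariant_in[OF Q(1) hk(2) w(1)])
      then have "\<rho> (h [^] k) w \<in> \<rho> (h [^] k) ` translates E {k \<in> K. inv x \<otimes> k \<notin> H}" using 1 by blast
      moreover have "w \<in> V" by (rule subspD[OF invariant_subsp[OF Q(1)] w(1)])
      moreover have "subsp (translates E {k \<in> K. inv x \<otimes> k \<notin> H})"
        using KG by (intro subsp_translates subsp_E) blast
      then have "translates E {k \<in> K. inv x \<otimes> k \<notin> H} \<subseteq> V" unfolding subsp_def by blast
      ultimately have "w \<in> translates E {k \<in> K. inv x \<otimes> k \<notin> H}"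
        using inj_on_image_mem_iff[OF rho_inj_on[OF hk(3)]] by blast
      then show False using x(2) by simp
    qed
    then obtain f where f: "\<And>k::nat. f k \<in> F \<and> inv (h [^] k \<otimes> x) \<otimes> f k \<in> H" by metis
    have "finite (range f)" using f by (intro finite_subset[OF _ F(1)]) blast
    then have "\<not> inj f" using finite_imageD[of f UNIV] infinite_UNIV_nat by blast
    then obtain a b where ab: "a \<noteq> b" "f a = f b" unfolding inj_def by blast
    obtain i j where ij: "f i = f j" "i < j"
      using ab that[of a b] that[of b a] by (cases "a < b") auto
    have fG: "f i \<in> carrier G" using f[of i] F(2) KG by blast
    have H2: "inv (h [^] i \<otimes> x) \<otimes> f i \<in> H" "inv (h [^] j \<otimes> x) \<otimes> f i \<in> H" using f[of i] f[of j] ij(1) by auto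
    have "inv (h [^] i \<otimes> x) \<otimes> f i \<otimes> inv (inv (h [^] j \<otimes> x) \<otimes> f i) \<in> H"
      by (rule subgroup.m_closed[OF H H2(1) subgroup.m_inv_closed[OF H H2(2)]])
    moreover have "inv (h [^] i \<otimes> x) \<otimes> f i \<otimes> inv (inv (h [^] j \<otimes> x) \<otimes> f i) = inv x \<otimes> (inv (h [^] i) \<otimes> h [^] j) \<otimes> x"
      using fG hG xG by (simp add: word_simps)
    moreover have "h [^] j = h [^] i \<otimes> h [^] (j - i)" using ij(2) hG by (simp add: nat_pow_mult)
    then have "inv (h [^] i) \<otimes> h [^] j = h [^] (j - i)" using hG by (simp add: word_simps)
    ultimately have "(inv x \<otimes> h \<otimes> x) [^] (j - i) \<in> H" using conj_nat_pow[OF xG hG] by simp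
    then have 2: "inv x \<otimes> h \<otimes> x \<in> H" by (rule H_isolated[rotated 2]) (use ij(2) xG hG in auto)
    have "h = x \<otimes> (inv x \<otimes> h \<otimes> x) \<otimes> inv x" using xG hG by (simp add: word_simps)
    then show "h \<in> conjugate x H" unfolding conjugate_def using 2 by blast
  qed
  then show ?thesis using xK by blast
qed

section \<open>Translates of the span over \<open>K\<close> by the normalizer of
  \<open>K\<close>\<close>

context
  fixes K assumes K: "subgroup K G" and NK: "normalizer_of H \<subseteq> K"
    and ind: "independent_over K" and meets: "meets_over K"
begin

lemma HK: "H \<subseteq> K"
  using subgroup_normalizer_of[OF H] NK by blast

lemma K_carrier: "K \<subseteq> carrier G"
  by (rule subgroup.subset[OF K])

text \<open>Moved back by \<open>g'\<close>, the space \<open>Q\<close> lies in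
  \<open>translates E K\<close> and is invariant under \<open>conjugate z H\<close>. So
  \<open>conjugate z H\<close> is contained in \<open>conjugate x H\<close> for some
  \<open>x \<in> K\<close>, and maximality of \<open>H\<close> puts \<open>inv z \<otimes> x\<close>
  into the normalizer of \<open>H\<close>. Here \<open>K\<close> has to contain that
  normalizer.\<close>

lemma finite_dimensional_in_translate:
  assumes g: "g \<in> normalizer_of K" "g' \<in> normalizer_of K"
    and Q: "invariant (conjugate g H) Q" "Q \<subseteq> \<rho> g' ` translates E K" "fin_dim Q" "\<not> Q \<subseteq> {0}"
  shows "inv g \<otimes> g' \<in> K"
proof -
  note N = normalizer_of_subgroup[OF K_carrier]
  have gG: "g \<in> carrier G" "g' \<in> carrier G" using g normalizer_of_carrier by auto
  have ig': "inv g' \<in> carrier G" using gG by simp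
  define z where "z = inv g' \<otimes> g"
  have z: "z \<in> normalizer_of K"
    unfolding z_def by (rule subgroup.m_closed[OF N subgroup.m_inv_closed[OF N g(2)] g(1)])
  have zG: "z \<in> carrier G" by (rule normalizer_of_carrier[OF z])
  define Q' where "Q' = \<rho> (inv g') ` Q"
  have sT: "subsp (translates E K)" by (rule subsp_translates[OF K_carrier subsp_E])
  note sQ = invariant_subsp[OF Q(1)]
  have "conjugate (inv g') (conjugate g H) = conjugate z H"
    unfolding z_def by (rule conjugate_conjugate[OF ig' gG(1) H_carrier])
  then have "invariant (conjugate z H) Q'"
    using invariant_conjugate[OF ig' conjugate_carrier[OF gG(1) H_carrier] Q(1)] unfolding Q'_def by simp
  moreover have "Q' \<subseteq> translates E K"
    using image_mono[OF Q(2), of "\<rho> (inv g')"] image_inv(1)[OF gG(2) sT] unfolding Q'_def by simp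
  moreover have "fin_dim Q'" unfolding Q'_def by (rule fin_dim_image[OF ig' sQ Q(3)])
  moreover have "\<not> Q' \<subseteq> {0}"
    using image_subset_zero_iff[OF ig'] Q(4) sQ unfolding Q'_def subsp_def by blast
  moreover have "conjugate z H \<subseteq> K" using conjugate_mono[OF HK, of z] conjugate_normalizer_of[OF z] by simp
  ultimately obtain x where x: "x \<in> K" "conjugate z H \<subseteq> conjugate x H"
    using finite_dimensional_subrep_of_translates[OF K HK ind conjugate_subgroup[OF zG H]] by blast
  have xG: "x \<in> carrier G" using x K_carrier by blast
  have "H = conjugate (inv z) (conjugate z H)" using conjugate_inv(1)[OF zG H_carrier] by simp
  also have "\<dots> \<subseteq> conjugate (inv z) (conjugate x H)" by (rule conjugate_mono[OF x(2)])
  also have "\<dots> = conjugate (inv z \<otimes> x) H" using zG xG by (intro conjugate_conjugate H_carrier) auto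
  finally have "inv z \<otimes> x \<in> normalizer_of H" using zG xG by (intro subset_conjugate_imp_normalizer) auto
  then have "inv z \<otimes> x \<in> K" using NK by blast
  then have "inv z \<otimes> x \<otimes> inv x \<in> K" by (rule subgroup.m_closed[OF K _ subgroup.m_inv_closed[OF K x(1)]])
  then have "inv z \<in> K" using zG xG by (simp add: word_simps)
  then show ?thesis unfolding z_def using gG by (simp add: inv_mult_group)
qed

text \<open>\<open>E\<close> itself serves as the finite-dimensional space, with the unit element in
  place of \<open>g\<close> and the given \<open>g\<close> in place of \<open>g'\<close>.\<close>

lemma normalizer_translates_separated:
  assumes g: "g \<in> normalizer_of K" and eq: "\<rho> g ` translates E K = translates E K"
  shows "g \<in> K"
proof -
  have one: "\<one> \<in> normalizer_of K" by (rule subgroup.one_closed[OF normalizer_of_subgroup[OF K_carrier]])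
  have "E \<subseteq> \<rho> g ` translates E K"
    unfolding eq by (rule subset_translates[OF subsp_E subgroup.one_closed[OF K]])
  moreover have "invariant (conjugate \<one> H) E" using invariant_E conjugate_one[OF H_carrier] by simp
  ultimately have "inv \<one> \<otimes> g \<in> K"
    using finite_dimensional_in_translate[OF one g] fin_dim_E E_nonzero by blast
  then show ?thesis using normalizer_of_carrier[OF g] by simp
qed

lemma translates_eq:
  assumes g: "g \<in> carrier G" "g' \<in> carrier G" and K': "inv g \<otimes> g' \<in> K"
  shows "\<rho> g ` translates E K = \<rho> g' ` translates E K"
proof -
  have "g' = g \<otimes> (inv g \<otimes> g')" using g by (simp add: word_simps)
  then have "\<rho> g' ` translates E K = \<rho> g ` \<rho> (inv g \<otimes> g') ` translates E K"
    using image_mult[OF g(1) _ subsp_translates[OF K_carrier subsp_E], of "inv g \<otimes> g'"] g by simp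
  then show ?thesis using image_translates_subgroup[OF K subsp_E K'] by simp
qed

text \<open>If the two spans intersected, or if an isomorphism related parts of them,
  \<open>meets_over\<close> would locate part of the translate of \<open>E\<close> by
  \<open>g\<close> there. This gives a nonzero finite-dimensional subspace of the other span
  invariant under \<open>conjugate g H\<close>, which forces \<open>inv g \<otimes> g'\<close> into
  \<open>K\<close> and makes the spans equal.\<close>

lemma normalizer_translates_disjoint:
  assumes g: "g \<in> normalizer_of K" "g' \<in> normalizer_of K"
    and ne: "\<rho> g ` translates E K \<noteq> \<rho> g' ` translates E K"
  shows "disjoint_reps K (\<rho> g ` translates E K) (\<rho> g' ` translates E K)"
proof -
  note sub = subsp_subspace[OF invariant_subsp]
  note N = normalizer_of_subgroup[OF K_carrier]
  have gG: "g \<in> carrier G" "g' \<in> carrier G" using g normalizer_of_carrier by auto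
  define A where "A = \<rho> g ` translates E K"
  define A' where "A' = \<rho> g' ` translates E K"
  note iT = invariant_translates[OF K subsp_E]
  note sT = invariant_subsp[OF iT]
  have A: "invariant K A"
    using invariant_conjugate[OF gG(1) K_carrier iT] conjugate_normalizer_of[OF g(1)] unfolding A_def by simp
  have A': "invariant K A'"
    using invariant_conjugate[OF gG(2) K_carrier iT] conjugate_normalizer_of[OF g(2)] unfolding A'_def by simp
  have LK: "conjugate g H \<subseteq> K" using conjugate_mono[OF HK, of g] conjugate_normalizer_of[OF g(1)] by simp
  have LG: "conjugate g H \<subseteq> carrier G" using LK K_carrier by blast
  have gE: "invariant (conjugate g H) (\<rho> g ` E)" by (rule invariant_conjugate[OF gG(1) H_carrier invariant_E])
  have fE: "fin_dim (\<rho> g ` E)" by (rule fin_dim_image[OF gG(1) subsp_E fin_dim_E])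
  have meets': "\<not> X \<inter> \<rho> g ` E \<subseteq> {0}" if X: "invariant K X" "X \<subseteq> A" "\<not> X \<subseteq> {0}" for X
  proof -
    have ig: "inv g \<in> normalizer_of K" "inv g \<in> carrier G"
      using subgroup.m_inv_closed[OF N g(1)] gG by auto
    note sX = invariant_subsp[OF X(1)]
    define Y where "Y = \<rho> (inv g) ` X"
    have Y: "invariant K Y"
      using invariant_conjugate[OF ig(2) K_carrier X(1)] conjugate_normalizer_of[OF ig(1)] unfolding Y_def by simp
    have "Y \<subseteq> translates E K"
      using image_mono[OF X(2), of "\<rho> (inv g)"] image_inv(1)[OF gG(1) sT] unfolding Y_def A_def by simp
    moreover have "\<not> Y \<subseteq> {0}"
      using image_subset_zero_iff[OF ig(2)] X(3) sX unfolding Y_def subsp_def by blast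
    ultimately have "\<not> Y \<inter> E \<subseteq> {0}" using meets Y unfolding meets_over_def by blast
    moreover have "\<rho> g ` (Y \<inter> E) = X \<inter> \<rho> g ` E"
      using image_Int[OF gG(1) invariant_subsp[OF Y] subsp_E] image_inv(2)[OF gG(1) sX] unfolding Y_def by simp
    moreover have "Y \<inter> E \<subseteq> V" using E_subset_V by blast
    ultimately show ?thesis using image_subset_zero_iff[OF gG(1), of "Y \<inter> E"] by simp
  qed
  have no: False
    if "invariant (conjugate g H) Q" "Q \<subseteq> A'" "fin_dim Q" "\<not> Q \<subseteq> {0}" for Q
    using translates_eq[OF gG finite_dimensional_in_translate[OF g that(1) _ that(3,4)]] that(2) ne
    unfolding A'_def by blast
  have "A \<inter> A' \<subseteq> {0}"
  proof (rule ccontr)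
    assume "\<not> A \<inter> A' \<subseteq> {0}"
    then have 1: "\<not> A \<inter> A' \<inter> \<rho> g ` E \<subseteq> {0}" by (intro meets' invariant_Int A A') auto
    have 2: "invariant (conjugate g H) (A \<inter> A' \<inter> \<rho> g ` E)"
      by (intro invariant_Int gE invariant_mono[OF A LK] invariant_mono[OF A' LK])
    show False by (rule no[OF 2 _ fin_dim_mono[OF fE] 1]) auto
  qed
  moreover have "w + w' = 0"
    if X: "invariant K X" "X \<inter> A \<subseteq> {0}" "X \<inter> A' \<subseteq> {0}" and w: "w \<in> A" "w' \<in> A'" "w + w' \<in> X" for X w w'
  proof (rule ccontr)
    assume nz: "w + w' \<noteq> 0"
    define Y where "Y = {y \<in> A. \<exists>u\<in>A'. u + y \<in> X}"
    have Y: "invariant K Y" unfolding Y_def by (rule invariant_shadow[OF K_carrier A' A X(1)])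
    have "w \<noteq> 0" using nz w X(3) by auto
    moreover have "w \<in> Y" using w unfolding Y_def by (auto simp: add.commute)
    ultimately have "\<not> Y \<inter> \<rho> g ` E \<subseteq> {0}" by (intro meets' Y) (auto simp: Y_def)
    then obtain y u where y: "y \<in> \<rho> g ` E" "y \<in> A" "y \<noteq> 0" "u \<in> A'" "u + y \<in> X" unfolding Y_def by blast
    define Q where "Q = {q \<in> A'. \<exists>e\<in>\<rho> g ` E. e + q \<in> X}"
    have Q: "invariant (conjugate g H) Q"
      unfolding Q_def
      by (rule invariant_shadow[OF LG gE invariant_mono[OF A' LK] invariant_mono[OF X(1) LK]])
    have "u \<noteq> 0" using y X(2) by auto
    moreover have "u \<in> Q" unfolding Q_def using y by (auto simp: add.commute)
    ultimately have Q0: "\<not> Q \<subseteq> {0}" by blast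
    \<comment> \<open>\<open>P\<close> is the finite-dimensional domain of the relation
      \<open>X\<close> between the translate of \<open>E\<close> and \<open>A'\<close>. Because
      \<open>X \<inter> A'\<close> is zero, each vector of \<open>P\<close> has only one partner in
      \<open>A'\<close>, so \<open>Q\<close> is spanned by the partners of a finite spanning set of
      \<open>P\<close>.\<close>
    define P where "P = {e \<in> \<rho> g ` E. \<exists>q\<in>A'. q + e \<in> X}"
    have "fin_dim P" unfolding P_def by (rule fin_dim_mono[OF fE]) blast
    then obtain B where B: "finite B" "B \<subseteq> P" "P \<subseteq> vs.span B" by (rule fin_dim_basis)
    have "\<forall>b\<in>B. \<exists>q\<in>A'. q + b \<in> X" using B(2) unfolding P_def by blast
    then obtain q where q: "\<And>b. b \<in> B \<Longrightarrow> q b \<in> A'" "\<And>b. b \<in> B \<Longrightarrow> q b + b \<in> X" by metis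
    have "Q \<subseteq> vs.span (q ` B)"
    proof
      fix v assume "v \<in> Q"
      then obtain e where e: "v \<in> A'" "e \<in> \<rho> g ` E" "e + v \<in> X" unfolding Q_def by blast
      then have "e \<in> P" unfolding P_def by (auto simp: add.commute)
      then obtain c where c: "e = (\<Sum>b\<in>B. s (c b) b)" using B vs.span_finite[OF B(1)] by blast
      define d where "d = (\<Sum>b\<in>B. s (c b) (q b))"
      have "d + e = (\<Sum>b\<in>B. s (c b) (q b + b))"
        unfolding d_def c by (simp add: vs.scale_right_distrib sum.distrib)
      also have "\<dots> \<in> X" using q(2) by (intro vs.subspace_sum vs.subspace_scale sub[OF X(1)])
      finally have "(e + v) - (d + e) \<in> X" using vs.subspace_diff[OF sub[OF X(1)] e(3)] by blast
      then have "v - d \<in> X" by (simp add: algebra_simps)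
      moreover have "d \<in> A'" unfolding d_def using q(1) by (intro vs.subspace_sum vs.subspace_scale sub[OF A'])
      then have "v - d \<in> A'" by (rule vs.subspace_diff[OF sub[OF A'] e(1)])
      ultimately have "v = d" using X(3) by auto
      moreover have "d \<in> vs.span (q ` B)"
        unfolding d_def by (intro vs.span_sum vs.span_scale vs.span_base imageI)
      ultimately show "v \<in> vs.span (q ` B)" by simp
    qed
    then have "fin_dim Q" unfolding fin_dim_def using finite_imageI[OF B(1)] by blast
    then show False by (intro no[OF Q _ _ Q0]) (auto simp: Q_def)
  qed
  ultimately show ?thesis unfolding disjoint_reps_def A_def A'_def by blast
qed

end

text \<open>The step from \<open>H\<close> to its normalizer rests on saturation, all later ones on
  \<open>meets_over\<close> and on \<open>K\<close> containing the normalizer of \<open>H\<close>.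
  Hence the induction is about the successor stages.\<close>

lemma independent_over_carrier: "independent_over (carrier G)"
proof -
  define K where "K j = (normalizer_of ^^ j) H" for j
  have K: "subgroup (K j) G" for j
  proof (induction j)
    case (Suc j)
    show ?case using normalizer_of_subgroup[OF subgroup.subset[OF Suc]] by (simp add: K_def)
  qed (simp add: K_def H)
  have KS: "K (Suc j) = normalizer_of (K j)" for j by (simp add: K_def)
  have NK: "normalizer_of H \<subseteq> K (Suc j)" for j
  proof (induction j)
    case (Suc j)
    then show ?case using subgroup_normalizer_of[OF K[of "Suc j"]] KS[of "Suc j"] by simp
  qed (simp add: K_def)
  have "independent_over (K (Suc j)) \<and> meets_over (K (Suc j))" for j
  proof (induction j)
    case 0
    have "g \<in> H" if "g \<in> normalizer_of H" "\<rho> g ` E = E" for g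
      using that stabilizer_saturated[OF E fin_dim_E E_nonzero] normalizer_of_carrier
      unfolding stabilizer_of_def by blast
    then show ?case
      using normalizer_step[OF H subset_refl base_over_H] disjoint_translates_normalizer
      by (simp add: K_def translates_H)
  next
    case (Suc j)
    note c = K[of "Suc j"] NK[of j] conjunct1[OF Suc] conjunct2[OF Suc]
    have "H \<subseteq> K (Suc j)" by (rule HK[OF c])
    from normalizer_step[OF c(1) this c(3,4) normalizer_translates_disjoint[OF c] normalizer_translates_separated[OF c]]
    show ?case unfolding KS[of "Suc j", symmetric] by blast
  qed
  moreover obtain n where n: "lcs n = {\<one>}" using nilpotent unfolding nilpotent_group_def by blast
  have "lcs (n - j) \<subseteq> K j" for j
  proof (induction j)
    case 0
    then show ?case using n subgroup.one_closed[OF K[of 0]] by simp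
  next
    case (Suc j)
    show ?case
    proof (cases "j < n")
      case False
      then show ?thesis using Suc subgroup_normalizer_of[OF K[of j]] KS[of j] by auto
    next
      case True
      then have e: "n - j = Suc (n - Suc j)" by simp
      \<comment> \<open>Commutators of \<open>a\<close> with \<open>K j\<close> fall into
        \<open>lcs (n - j)\<close>, which \<open>K j\<close> contains, so \<open>a\<close> maps
        \<open>K j\<close> into itself by conjugation.\<close>
      have sub: "conjugate a (K j) \<subseteq> K j" if a: "a \<in> lcs (n - Suc j)" for a
      proof
        fix y assume "y \<in> conjugate a (K j)"
        then obtain k where k: "k \<in> K j" "y = a \<otimes> k \<otimes> inv a" unfolding conjugate_def by blast
        have G: "a \<in> carrier G" "k \<in> carrier G" using lcs_carrier[OF a] subgroup.mem_carrier[OF K k(1)] by auto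
        have "commutator a k \<in> K j" using lcs_commutator[OF a G(2)] Suc e by auto
        then have "commutator a k \<otimes> k \<in> K j" by (rule subgroup.m_closed[OF K _ k(1)])
        then show "y \<in> K j" using k(2) G by (simp add: word_simps)
      qed
      show ?thesis
        unfolding KS
      proof
        fix a assume a: "a \<in> lcs (n - Suc j)"
        have aG: "a \<in> carrier G" by (rule lcs_carrier[OF a])
        have "K j = conjugate a (conjugate (inv a) (K j))"
          using conjugate_inv(2)[OF aG subgroup.subset[OF K]] by simp
        also have "\<dots> \<subseteq> conjugate a (K j)"
          by (rule conjugate_mono[OF sub[OF subgroup.m_inv_closed[OF lcs_subgroup a]]])
        finally show "a \<in> normalizer_of (K j)" unfolding normalizer_of_def using sub[OF a] aG by blast
      qed
    qed
  qed
  \<comment> \<open>Independence is known at successor stages, so the index \<open>Suc n\<close> is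
    taken; by truncated subtraction the term is still \<open>lcs 0\<close>, the whole group.\<close>
  from this[of "Suc n"] have "carrier G \<subseteq> K (Suc n)" by simp
  then have "K (Suc n) = carrier G" using subgroup.subset[OF K[of "Suc n"]] by blast
  ultimately show ?thesis by metis
qed

end

section \<open>Reduction to a line\<close>

lemma eigenvector_of_annihilating_poly:
  fixes s :: "complex \<Rightarrow> 'v \<Rightarrow> 'v::ab_group_add"
  assumes vs: "vector_space s" and U: "module.subspace s U"
    and closed: "\<And>u. u \<in> U \<Longrightarrow> A u \<in> U"
    and add: "\<And>u w. u \<in> U \<Longrightarrow> w \<in> U \<Longrightarrow> A (u + w) = A u + A w"
    and scale: "\<And>c u. u \<in> U \<Longrightarrow> A (s c u) = s c (A u)"
    and x: "x \<in> U" "x \<noteq> 0"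
    and p: "p \<noteq> 0" "degree p \<le> n" "(\<Sum>k\<le>n. s (coeff p k) ((A ^^ k) x)) = 0"
  shows "\<exists>\<mu> u. u \<in> U \<and> u \<noteq> 0 \<and> A u = s \<mu> u"
proof -
  interpret vector_space s by (rule vs)
  have pow: "(A ^^ k) x \<in> U" for k
    by (induction k) (use x closed in auto)
  have A0: "A 0 = 0" using scale[OF x(1), of 0] by simp
  have sumU: "(\<Sum>k\<in>F. s (c k) ((A ^^ k) x)) \<in> U" for c and F :: "nat set"
    using pow by (intro subspace_sum subspace_scale U) auto
  have Asum: "A (\<Sum>k\<in>F. s (c k) ((A ^^ k) x)) = (\<Sum>k\<in>F. s (c k) ((A ^^ Suc k) x))" if "finite F"
    for c and F :: "nat set"
    using that
  proof (induction F)
    case (insert k F)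
    then show ?case
      using add[OF subspace_scale[OF U pow] sumU, of "c k" k c F] scale[OF pow, of "c k" k] by simp
  qed (simp add: A0)
  show ?thesis
    using p
  proof (induction n arbitrary: p)
    case 0
    then have "coeff p 0 \<noteq> 0" using leading_coeff_0_iff by (metis le_zero_eq)
    then show ?case using 0 x by simp
  next
    case (Suc n)
    show ?case
    proof (cases "degree p \<le> n")
      case True
      then have "coeff p (Suc n) = 0" by (simp add: coeff_eq_0)
      then show ?thesis using Suc True by simp
    next
      case False
      then have deg: "degree p = Suc n" using Suc.prems by simp
      then have "\<not> constant (poly p)" by (simp add: constant_degree)
      \<comment> \<open>Splitting off a root \<open>\<mu>\<close> gives \<open>p\<close> as a linear
        factor times \<open>q\<close>, and \<open>y = q(A) x\<close> satisfies
        \<open>A y = s \<mu> y\<close>. Either \<open>y\<close> is an eigenvector, or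
        \<open>y = 0\<close> and \<open>q\<close> annihilates \<open>x\<close> with smaller
        degree.\<close>
      then obtain \<mu> where "poly p \<mu> = 0" using fundamental_theorem_of_algebra by blast
      then obtain q where q: "p = [:- \<mu>, 1:] * q" using poly_eq_0_iff_dvd by (metis dvdE)
      then have "q \<noteq> 0" using Suc.prems by auto
      have "degree p = Suc (degree q)" unfolding q using \<open>q \<noteq> 0\<close> by (subst degree_mult_eq) auto
      then have degq: "degree q = n" using deg by simp
      define y where "y = (\<Sum>k\<le>n. s (coeff q k) ((A ^^ k) x))"
      have y: "y \<in> U" unfolding y_def by (rule sumU)
      have "p = pCons 0 q - smult \<mu> q" unfolding q by simp
      then have c: "coeff p k = coeff (pCons 0 q) k - \<mu> * coeff q k" for k by simp
      have "(\<Sum>k\<le>Suc n. s (coeff p k) ((A ^^ k) x))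
          = (\<Sum>k\<le>Suc n. s (coeff (pCons 0 q) k) ((A ^^ k) x)) - s \<mu> (\<Sum>k\<le>Suc n. s (coeff q k) ((A ^^ k) x))"
        unfolding c by (simp only: scale_left_diff_distrib sum_subtractf scale_sum_right scale_scale)
      also have "(\<Sum>k\<le>Suc n. s (coeff q k) ((A ^^ k) x)) = y"
        unfolding y_def using degq by (simp add: coeff_eq_0)
      also have "(\<Sum>k\<le>Suc n. s (coeff (pCons 0 q) k) ((A ^^ k) x)) = A y"
        unfolding sum.atMost_Suc_shift y_def by (subst Asum) simp_all
      finally have "A y = s \<mu> y" using Suc.prems by simp
      then show ?thesis
        using Suc.IH[OF \<open>q \<noteq> 0\<close>] degq y unfolding y_def[symmetric] by blast
    qed
  qed
qed

text \<open>With \<open>n = card B\<close> the first \<open>n + 1\<close> iterates of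
  \<open>x\<close> are linearly dependent, and a relation among them is an annihilating
  polynomial.\<close>

lemma eigenvector_exists:
  fixes s :: "complex \<Rightarrow> 'v \<Rightarrow> 'v::ab_group_add"
  assumes vs: "vector_space s" and U: "module.subspace s U"
    and closed: "\<And>u. u \<in> U \<Longrightarrow> A u \<in> U"
    and add: "\<And>u w. u \<in> U \<Longrightarrow> w \<in> U \<Longrightarrow> A (u + w) = A u + A w"
    and scale: "\<And>c u. u \<in> U \<Longrightarrow> A (s c u) = s c (A u)"
    and x: "x \<in> U" "x \<noteq> 0" and B: "finite B" "U \<subseteq> module.span s B"
  shows "\<exists>\<mu> u. u \<in> U \<and> u \<noteq> 0 \<and> A u = s \<mu> u"
proof -
  interpret vector_space s by (rule vs)
  have pow: "(A ^^ k) x \<in> U" for k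
    by (induction k) (use x closed in auto)
  define n where "n = card B"
  have "\<exists>c. (\<exists>k\<le>n. c k \<noteq> 0) \<and> (\<Sum>k\<le>n. s (c k) ((A ^^ k) x)) = 0"
  proof (cases "inj_on (\<lambda>k. (A ^^ k) x) {..n}")
    case True
    define S where "S = (\<lambda>k. (A ^^ k) x) ` {..n}"
    have "card S = Suc n" unfolding S_def using card_image[OF True] by simp
    moreover have "S \<subseteq> span B" unfolding S_def using pow B(2) by blast
    ultimately have "dependent S" using independent_span_bound[OF B(1), of S] unfolding n_def by auto
    then obtain d where d: "\<exists>v\<in>S. d v \<noteq> 0" "(\<Sum>v\<in>S. s (d v) v) = 0"
      using dependent_finite[of S] unfolding S_def by auto
    have "(\<Sum>k\<le>n. s (d ((A ^^ k) x)) ((A ^^ k) x)) = 0"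
      using d(2) unfolding S_def sum.reindex[OF True] by simp
    moreover have "\<exists>k\<le>n. d ((A ^^ k) x) \<noteq> 0" using d(1) unfolding S_def by auto
    ultimately show ?thesis by (intro exI[of _ "\<lambda>k. d ((A ^^ k) x)"]) simp
  next
    \<comment> \<open>A repetition among the iterates disappears in a set of vectors, so it is
      turned directly into a relation with coefficients 1 and -1.\<close>
    case False
    then obtain i j where ij: "i \<le> n" "j \<le> n" "i \<noteq> j" "(A ^^ i) x = (A ^^ j) x"
      unfolding inj_on_def by auto
    define c :: "nat \<Rightarrow> complex" where "c k = (if k = i then 1 else if k = j then - 1 else 0)" for k
    have "(\<Sum>k\<le>n. s (c k) ((A ^^ k) x)) = (\<Sum>k\<in>{i, j}. s (c k) ((A ^^ k) x))"
      using ij by (intro sum.mono_neutral_right) (auto simp: c_def)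
    also have "\<dots> = 0" using ij(3) by (simp add: c_def ij(4))
    finally show ?thesis using ij(1) by (intro exI[of _ c]) (auto simp: c_def)
  qed
  then obtain c k0 where c: "k0 \<le> n" "c k0 \<noteq> 0" "(\<Sum>k\<le>n. s (c k) ((A ^^ k) x)) = 0" by blast
  define p where "p = (\<Sum>k\<le>n. monom (c k) k)"
  have cp: "coeff p k = (if k \<le> n then c k else 0)" for k
    unfolding p_def by (simp add: coeff_sum)
  have 1: "p \<noteq> 0" using c(1,2) cp[of k0] by auto
  have 2: "degree p \<le> n" by (rule degree_le) (simp add: cp)
  have 3: "(\<Sum>k\<le>n. s (coeff p k) ((A ^^ k) x)) = 0" using c(3) by (simp add: cp)
  show ?thesis
    by (rule eigenvector_of_annihilating_poly[OF vs U closed add scale x 1 2 3])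
qed

section \<open>Pairs from which \<open>V\<close> is induced\<close>

context projective_rep
begin

text \<open>The last clause says that \<open>V\<close> contains the representation induced from \<open>H\<close> acting on \<open>E\<close>.\<close>

definition inducing :: "'a set \<Rightarrow> 'v set \<Rightarrow> bool" where
  "inducing H E \<longleftrightarrow> subgroup H G \<and> invariant H E \<and> fin_dim E \<and> \<not> E \<subseteq> {0} \<and>
     E \<inter> translates E (carrier G - H) \<subseteq> {0}"

lemma inducing_of_saturated:
  assumes fg: "finitely_generated_group G" and nil: "nilpotent_group G"
    and H0: "subgroup H0 G" and E0: "saturated H0 E0" "fin_dim E0" "\<not> E0 \<subseteq> {0}"
  shows "\<exists>H E. inducing H E"
proof -
  define \<H> where "\<H> = {H. subgroup H G \<and> (\<exists>E. saturated H E \<and> fin_dim E \<and> \<not> E \<subseteq> {0})}"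
  have "H0 \<in> \<H>" unfolding \<H>_def using H0 E0 by blast
  moreover have "\<forall>H\<in>\<H>. subgroup H G \<and> H \<subseteq> carrier G" unfolding \<H>_def using subgroup.subset by blast
  ultimately have "\<exists>H\<in>\<H>. \<forall>H'\<in>\<H>. H \<subseteq> H' \<longrightarrow> H' = H"
    using noetherian_finitely_generated_nilpotent[OF fg nil] unfolding noetherian_subset_def by blast
  then obtain H where HH: "H \<in> \<H>" and max: "\<And>H'. H' \<in> \<H> \<Longrightarrow> H \<subseteq> H' \<Longrightarrow> H' = H" by auto
  then obtain E1 where H: "subgroup H G" and E1: "saturated H E1" "fin_dim E1" "\<not> E1 \<subseteq> {0}"
    unfolding \<H>_def by blast
  define P where "P U \<longleftrightarrow> saturated H U \<and> \<not> U \<subseteq> {0}" for U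
  have P: "vs.subspace U" if "P U" for U
    using that subsp_subspace[OF invariant_subsp[OF saturated_invariant]] unfolding P_def by blast
  have "P E1" using E1 unfolding P_def by blast
  then obtain E where PE: "P E" "E \<subseteq> E1" and Pmin: "\<And>U. P U \<Longrightarrow> U \<subseteq> E \<Longrightarrow> U = E"
    using exists_minimal_subspace[of P E1, OF _ P E1(2)] by metis
  have E: "saturated H E \<and> \<not> E \<subseteq> {0}" "E \<subseteq> E1" using PE unfolding P_def by auto
  have fE: "fin_dim E" by (rule fin_dim_mono[OF E1(2) E(2)])
  interpret M: maximal_saturated G s \<alpha> V \<rho> H E
  proof (rule maximal_saturated.intro[OF projective_rep_axioms maximal_saturated_axioms.intro])
    show "H' = H" if "subgroup H' G" "saturated H' E'" "fin_dim E'" "\<not> E' \<subseteq> {0}" "H \<subseteq> H'" for H' E'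
      using max[of H'] that unfolding \<H>_def by blast
    show "E' = E" if "saturated H E'" "\<not> E' \<subseteq> {0}" "E' \<subseteq> E" for E'
      using Pmin[of E'] that unfolding P_def by blast
  qed (use nil H E fE in auto)
  show ?thesis
    using M.independent_over_carrier H M.invariant_E fE E
    unfolding inducing_def M.independent_over_def by blast
qed

text \<open>The products of \<open>a\<close> and \<open>h\<close> in the two orders differ by their
  commutator, which acts as a scalar, and by values of the cocycle. The commutator is applied to
  \<open>\<rho> (h \<otimes> a) u\<close>, so \<open>U\<close> has to contain that vector.\<close>

lemma scalar_commutator:
  assumes G: "a \<in> carrier G" "h \<in> carrier G" and U: "U \<subseteq> V" "\<And>u. u \<in> U \<Longrightarrow> \<rho> (h \<otimes> a) u \<in> U"
    and sc: "\<And>u. u \<in> U \<Longrightarrow> \<rho> (commutator a h) u = s \<kappa> u"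
  shows "\<exists>\<nu>. \<forall>u\<in>U. \<rho> a (\<rho> h u) = s \<nu> (\<rho> h (\<rho> a u))"
proof (intro exI ballI)
  let ?c = "commutator a h"
  fix u assume u: "u \<in> U"
  then have uV: "u \<in> V" using U by blast
  have cG: "?c \<in> carrier G" "h \<otimes> a \<in> carrier G" "a \<otimes> h \<in> carrier G" using G by auto
  have e: "?c \<otimes> (h \<otimes> a) = a \<otimes> h" using G by (simp add: word_simps)
  have nz: "\<alpha> ?c (h \<otimes> a) \<noteq> 0" "\<alpha> h a \<noteq> 0" using cocycle_nonzero cG G by auto
  have "s (\<alpha> ?c (h \<otimes> a)) (\<rho> (a \<otimes> h) u) = s \<kappa> (\<rho> (h \<otimes> a) u)"
    using rho_mult[OF cG(1,2) uV] sc[OF U(2)[OF u]] e by simp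
  then have "s (inverse (\<alpha> ?c (h \<otimes> a))) (s (\<alpha> ?c (h \<otimes> a)) (\<rho> (a \<otimes> h) u))
      = s (inverse (\<alpha> ?c (h \<otimes> a))) (s \<kappa> (\<rho> (h \<otimes> a) u))" by simp
  then have 1: "\<rho> (a \<otimes> h) u = s (\<kappa> / \<alpha> ?c (h \<otimes> a)) (\<rho> (h \<otimes> a) u)"
    using nz by (simp add: divide_inverse mult.commute)
  show "\<rho> a (\<rho> h u) = s (\<alpha> a h * \<kappa> / (\<alpha> ?c (h \<otimes> a) * \<alpha> h a)) (\<rho> h (\<rho> a u))"
    using rho_mult[OF G uV] rho_mult[OF G(2,1) uV] nz 1 by simp
qed

text \<open>Since \<open>\<rho> h\<close> commutes with \<open>\<rho> a\<close> up to a scalar, it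
  maps the eigenspace \<open>E'\<close> into an eigenspace, and a different one unless it stabilizes
  \<open>E'\<close>. The new group is the stabilizer of \<open>E'\<close> in
  \<open>H\<close>.\<close>

lemma inducing_eigenspace:
  assumes ind: "inducing H E" and a: "a \<in> H"
    and sc: "\<And>h. h \<in> H \<Longrightarrow> \<exists>\<nu>. \<forall>u\<in>E. \<rho> a (\<rho> h u) = s \<nu> (\<rho> h (\<rho> a u))"
    and e0: "e0 \<in> E" "e0 \<noteq> 0" "\<rho> a e0 = s \<mu> e0"
  shows "\<exists>H'. inducing H' {u \<in> E. \<rho> a u = s \<mu> u}"
proof -
  have H: "subgroup H G" and E: "invariant H E" and fE: "fin_dim E"
    and indep: "E \<inter> translates E (carrier G - H) \<subseteq> {0}"
    using ind unfolding inducing_def by auto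
  note HG = subgroup.mem_carrier[OF H]
  have aG: "a \<in> carrier G" using HG a by blast
  have sE: "subsp E" by (rule invariant_subsp[OF E])
  have EV: "E \<subseteq> V" using sE unfolding subsp_def by blast
  note sub = subsp_subspace[OF invariant_subsp]
  define Eig where "Eig \<nu> = {u \<in> E. \<rho> a u = s \<nu> u}" for \<nu>
  have sEig: "subsp (Eig \<nu>)" for \<nu>
    unfolding subsp_def
  proof
    show "Eig \<nu> \<subseteq> V" unfolding Eig_def using EV by blast
    show "vs.subspace (Eig \<nu>)"
    proof (rule vs.subspaceI)
      show "0 \<in> Eig \<nu>" unfolding Eig_def using vs.subspace_0[OF sub[OF E]] rho_zero[OF aG] by simp
      show "x + y \<in> Eig \<nu>" if "x \<in> Eig \<nu>" "y \<in> Eig \<nu>" for x y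
        using that vs.subspace_add[OF sub[OF E]] rho_add[OF aG, of x y] EV
        unfolding Eig_def by (auto simp: vs.scale_right_distrib)
      show "s c x \<in> Eig \<nu>" if "x \<in> Eig \<nu>" for c x
        using that vs.subspace_scale[OF sub[OF E]] rho_scale[OF aG, of x c] EV
        unfolding Eig_def by (auto simp: mult.commute)
    qed
  qed
  have iEig: "invariant {a} (Eig \<nu>)" for \<nu>
    unfolding invariant_def
  proof (intro conjI ballI sEig)
    fix k assume k: "k \<in> {a}"
    have "\<rho> k ` Eig \<nu> = s \<nu> ` Eig \<nu>" using k by (intro image_cong refl) (auto simp: Eig_def)
    also have "\<dots> \<subseteq> Eig \<nu>" using vs.subspace_scale[OF subsp_subspace[OF sEig]] by blast
    finally show "\<rho> k ` Eig \<nu> \<subseteq> Eig \<nu>" .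
  qed
  \<comment> \<open>Eigenspaces are treated as disjoint representations of the one-element set
    \<open>{a}\<close>, so that their independence comes from
    \<open>disjoint_family_independent\<close>.\<close>
  have dEig: "disjoint_reps {a} (Eig \<nu>) (Eig \<nu>')" if ne: "\<nu> \<noteq> \<nu>'" for \<nu> \<nu>'
    unfolding disjoint_reps_def
  proof (intro conjI allI impI ballI)
    show "Eig \<nu> \<inter> Eig \<nu>' \<subseteq> {0}" unfolding Eig_def using ne by auto
    fix X w w' assume X: "invariant {a} X" "X \<inter> Eig \<nu> \<subseteq> {0}" "X \<inter> Eig \<nu>' \<subseteq> {0}"
      and w: "w \<in> Eig \<nu>" "w' \<in> Eig \<nu>'" "w + w' \<in> X"
    have wV: "w \<in> V" "w' \<in> V" using w EV unfolding Eig_def by auto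
    have "\<rho> a (w + w') - s \<nu> (w + w') \<in> X"
      using X(1) w(3) by (intro vs.subspace_diff[OF sub[OF X(1)]] vs.subspace_scale[OF sub[OF X(1)]]
          invariant_in[OF X(1)]) auto
    moreover have "\<rho> a (w + w') - s \<nu> (w + w') = s (\<nu>' - \<nu>) w'"
      using w rho_add[OF aG wV] unfolding Eig_def by (simp add: algebra_simps vs.scale_right_distrib vs.scale_left_diff_distrib)
    moreover have "s (\<nu>' - \<nu>) w' \<in> Eig \<nu>'" using vs.subspace_scale[OF subsp_subspace[OF sEig] w(2)] .
    ultimately have "s (\<nu>' - \<nu>) w' = 0" using X(3) by auto
    then have "w' = 0" using ne by simp
    then show "w + w' = 0" using X(2) w by auto
  qed
  define E' where "E' = Eig \<mu>"
  have E'E: "E' \<subseteq> E" unfolding E'_def Eig_def by blast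
  have sE': "subsp E'" unfolding E'_def by (rule sEig)
  have e0E': "e0 \<in> E'" unfolding E'_def Eig_def using e0 by simp
  define H' where "H' = H \<inter> stabilizer_of E'"
  have H': "subgroup H' G"
    unfolding H'_def by (intro subgroups_Inter_pair H stabilizer_of_subgroup sE')
  have iE': "invariant H' E'"
    by (rule invariant_mono[OF invariant_stabilizer_of[OF sE']]) (simp add: H'_def)
  define \<W> where "\<W> = range Eig"
  have key: "\<exists>W\<in>\<W> - {E'}. \<rho> h ` E' \<subseteq> W" if h: "h \<in> H" "h \<notin> H'" for h
  proof -
    have hG: "h \<in> carrier G" using h HG by blast
    obtain \<nu> where \<nu>: "\<And>u. u \<in> E \<Longrightarrow> \<rho> a (\<rho> h u) = s \<nu> (\<rho> h (\<rho> a u))" using sc[OF h(1)] by blast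
    have into: "\<rho> h ` E' \<subseteq> Eig (\<nu> * \<mu>)"
    proof
      fix y assume "y \<in> \<rho> h ` E'"
      then obtain u where u: "u \<in> E'" "y = \<rho> h u" by blast
      have uE: "u \<in> E" "\<rho> a u = s \<mu> u" using u(1) unfolding E'_def Eig_def by auto
      then have "\<rho> a y = s \<nu> (\<rho> h (s \<mu> u))" using \<nu> u(2) by simp
      also have "\<dots> = s (\<nu> * \<mu>) y" using rho_scale[OF hG subsetD[OF EV uE(1)]] u(2) by simp
      finally show "y \<in> Eig (\<nu> * \<mu>)"
        unfolding Eig_def using invariant_in[OF E h(1) uE(1)] u(2) by simp
    qed
    \<comment> \<open>Equality forces \<open>\<nu> * \<mu> = \<mu>\<close>, and \<open>\<mu>\<close>
      is nonzero because \<open>\<rho> a\<close> is injective. So \<open>\<nu> = 1\<close>, the maps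
      \<open>\<rho> h\<close> and \<open>\<rho> a\<close> commute on \<open>E\<close>, and
      \<open>\<rho> h\<close> maps \<open>E'\<close> onto itself, against the choice of
      \<open>h\<close>.\<close>
    have "Eig (\<nu> * \<mu>) \<noteq> E'"
    proof
      assume eq: "Eig (\<nu> * \<mu>) = E'"
      then have "e0 \<in> Eig (\<nu> * \<mu>)" using e0E' by simp
      then have "s \<mu> e0 = s (\<nu> * \<mu>) e0" using e0(3) unfolding Eig_def by simp
      then have \<nu>\<mu>: "\<nu> * \<mu> = \<mu>" using e0(2) by simp
      have "e0 \<in> V" using e0(1) EV by blast
      then have "\<mu> \<noteq> 0" using rho_eq_0_iff[OF aG, of e0] e0(2,3) by auto
      then have "\<nu> = 1" using \<nu>\<mu> by simp
      have "E' \<subseteq> \<rho> h ` E'"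
      proof
        fix y assume y: "y \<in> E'"
        then have "y \<in> \<rho> h ` E" using E'E invariant_image_eq[OF H E h(1)] by blast
        then obtain u where u: "u \<in> E" "y = \<rho> h u" by blast
        have auE: "\<rho> a u \<in> E" by (rule invariant_in[OF E a u(1)])
        have uV: "u \<in> V" "\<rho> a u \<in> V" "s \<mu> u \<in> V"
          using subsetD[OF EV u(1)] subsetD[OF EV auE] vs.subspace_scale[OF subspace_V] by simp_all
        have "\<rho> h (\<rho> a u) = \<rho> a y" using \<nu>[OF u(1)] \<open>\<nu> = 1\<close> u(2) by simp
        also have "\<rho> a y = s \<mu> y" using y unfolding E'_def Eig_def by simp
        also have "s \<mu> y = \<rho> h (s \<mu> u)" unfolding u(2) by (rule rho_scale[OF hG uV(1), symmetric])
        finally have "\<rho> a u = s \<mu> u" using rho_inj_on[OF hG] uV unfolding inj_on_def by blast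
        then show "y \<in> \<rho> h ` E'" using u unfolding E'_def Eig_def by blast
      qed
      then have "\<rho> h ` E' = E'" using into eq by blast
      then show False using h hG unfolding H'_def stabilizer_of_def by blast
    qed
    then show ?thesis using into unfolding \<W>_def by blast
  qed
  have "E' \<inter> translates E' (carrier G - H') \<subseteq> {0}"
  proof
    fix e assume e: "e \<in> E' \<inter> translates E' (carrier G - H')"
    \<comment> \<open>Elements outside \<open>H\<close> are handled by the independence of the
      translates of \<open>E\<close>, elements of \<open>H\<close> outside \<open>H'\<close> by the
      independence of the eigenspaces.\<close>
    have "carrier G - H' = (H - H') \<union> (carrier G - H)"
      using subgroup.subset[OF H] unfolding H'_def by blast
    then have "e \<in> translates E' ((H - H') \<union> (carrier G - H))" using e by simp
    then obtain p q where pq: "p \<in> translates E' (H - H')" "q \<in> translates E' (carrier G - H)" "e = p + q"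
      by (rule translates_Un)
    have "(\<Union>h\<in>H - H'. \<rho> h ` E') \<subseteq> E"
      using E'E invariant_in[OF E] by blast
    from vs.span_minimal[OF this sub[OF E]] have "p \<in> E" using pq(1) unfolding translates_def by blast
    then have "e - p \<in> E" using e E'E by (intro vs.subspace_diff[OF sub[OF E]]) auto
    then have "q \<in> E" using pq(3) by simp
    moreover have "(\<Union>g\<in>carrier G - H. \<rho> g ` E') \<subseteq> (\<Union>g\<in>carrier G - H. \<rho> g ` E)" using E'E by blast
    from vs.span_mono[OF this] have "q \<in> translates E (carrier G - H)"
      using pq(2) unfolding translates_def by blast
    ultimately have "q = 0" using indep by blast
    then have "e = p" using pq(3) by simp
    have "(\<Union>h\<in>H - H'. \<rho> h ` E') \<subseteq> \<Union>(\<W> - {E'})"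
    proof (rule UN_least)
      fix h assume "h \<in> H - H'"
      then obtain W where "W \<in> \<W> - {E'}" "\<rho> h ` E' \<subseteq> W" using key[of h] by blast
      then show "\<rho> h ` E' \<subseteq> \<Union>(\<W> - {E'})" by blast
    qed
    from vs.span_mono[OF this] have "e \<in> vs.span (\<Union>(\<W> - {E'}))"
      using pq(1) \<open>e = p\<close> unfolding translates_def by blast
    moreover have "E' \<inter> vs.span (\<Union>(\<W> - {E'})) \<subseteq> {0}"
    proof (rule disjoint_family_independent[of "{a}" \<W> E'])
      show "{a} \<subseteq> carrier G" using aG by simp
      show "invariant {a} W" if "W \<in> \<W>" for W
        using that unfolding \<W>_def by (elim rangeE) (simp add: iEig)
      show "disjoint_reps {a} W W'" if W: "W \<in> \<W>" "W' \<in> \<W>" "W \<noteq> W'" for W W'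
      proof -
        obtain \<nu> \<nu>' where \<nu>: "W = Eig \<nu>" "W' = Eig \<nu>'" using W(1,2) unfolding \<W>_def by (elim rangeE)
        then have "\<nu> \<noteq> \<nu>'" using W(3) by auto
        then show ?thesis unfolding \<nu> by (rule dEig)
      qed
      show "E' \<in> \<W>" unfolding E'_def \<W>_def by blast
    qed
    ultimately show "e \<in> {0}" using e by blast
  qed
  moreover have "\<not> E' \<subseteq> {0}" using e0E' e0(2) by blast
  ultimately have "inducing H' E'"
    unfolding inducing_def using H' iE' fin_dim_mono[OF fE E'E] by blast
  then show ?thesis unfolding E'_def Eig_def by blast
qed

text \<open>Take \<open>E\<close> of least dimension and let \<open>N\<close> be the elements of
  \<open>H\<close> acting on it by scalars. If \<open>H\<close> is larger, choose \<open>a\<close>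
  outside \<open>N\<close> in the last term of the lower central series whose intersection with
  \<open>H\<close> is not inside \<open>N\<close>. Its commutators with \<open>H\<close> act by
  scalars, so an eigenspace of \<open>\<rho> a\<close> gives a smaller choice. Hence
  \<open>H\<close> acts by scalars, and any line in \<open>E\<close> inherits the property.\<close>

lemma inducing_line:
  assumes nil: "nilpotent_group G" and ind: "inducing H0 E0"
  shows "\<exists>H v. v \<in> V \<and> v \<noteq> 0 \<and> inducing H (vs.span {v})"
proof -
  obtain HE where HE: "(\<lambda>(H, E). inducing H E) HE"
    and min': "\<And>HE'. (\<lambda>(H, E). inducing H E) HE' \<Longrightarrow> vs.dim (snd HE) \<le> vs.dim (snd HE')"
    using ex_has_least_nat[of "\<lambda>(H, E). inducing H E" "(H0, E0)" "\<lambda>HE. vs.dim (snd HE)"] ind by auto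
  obtain H E where HE_eq: "HE = (H, E)" by (cases HE)
  have IHE: "inducing H E" using HE HE_eq by simp
  have min: "vs.dim E \<le> vs.dim E'" if "inducing H' E'" for H' E'
    using min'[of "(H', E')"] that HE_eq by simp
  have H: "subgroup H G" and E: "invariant H E" and fE: "fin_dim E" and E0: "\<not> E \<subseteq> {0}"
    and indep: "E \<inter> translates E (carrier G - H) \<subseteq> {0}"
    using IHE unfolding inducing_def by auto
  note HG = subgroup.mem_carrier[OF H]
  have sE: "subsp E" by (rule invariant_subsp[OF E])
  have EV: "E \<subseteq> V" using sE unfolding subsp_def by blast
  define N where "N = {h \<in> H. \<exists>c. \<forall>u\<in>E. \<rho> h u = s c u}"
  have "H \<subseteq> N"
  proof (rule ccontr)
    assume HN: "\<not> H \<subseteq> N"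
    obtain n where n: "lcs n = {\<one>}" using nil unfolding nilpotent_group_def by blast
    have "H \<inter> lcs 0 = H" using subgroup.subset[OF H] by auto
    then have 0: "\<not> H \<inter> lcs 0 \<subseteq> N" using HN by simp
    have "\<forall>u\<in>E. \<rho> \<one> u = s (\<alpha> \<one> \<one>) u" using rho_one EV by blast
    then have "\<one> \<in> N" unfolding N_def using subgroup.one_closed[OF H] by blast
    then have 1: "H \<inter> lcs n \<subseteq> N" using n by auto
    obtain i where i: "\<not> H \<inter> lcs i \<subseteq> N" "H \<inter> lcs (Suc i) \<subseteq> N"
      using first_failure[of "\<lambda>n. H \<inter> lcs n \<subseteq> N", OF 0 1] by metis
    then obtain a where a: "a \<in> H" "a \<in> lcs i" "a \<notin> N" by blast
    have aG: "a \<in> carrier G" using a HG by blast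
    have sc: "\<exists>\<nu>. \<forall>u\<in>E. \<rho> a (\<rho> h u) = s \<nu> (\<rho> h (\<rho> a u))" if h: "h \<in> H" for h
    proof -
      have hG: "h \<in> carrier G" using h HG by blast
      have "commutator a h \<in> H"
        by (intro subgroup.m_closed[OF H] subgroup.m_inv_closed[OF H] a h)
      then have "commutator a h \<in> N" using lcs_commutator[OF a(2) hG] i(2) by blast
      then obtain c where "\<And>u. u \<in> E \<Longrightarrow> \<rho> (commutator a h) u = s c u" unfolding N_def by blast
      then show ?thesis
        using invariant_in[OF E subgroup.m_closed[OF H h a(1)]] by (intro scalar_commutator[OF aG hG EV])
    qed
    obtain x where x: "x \<in> E" "x \<noteq> 0" using E0 by blast
    obtain B where B: "finite B" "E \<subseteq> vs.span B" using fE unfolding fin_dim_def by blast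
    have "\<exists>\<mu> u. u \<in> E \<and> u \<noteq> 0 \<and> \<rho> a u = s \<mu> u"
      using EV by (intro eigenvector_exists[OF vs.vector_space_axioms subsp_subspace[OF sE] _ _ _ x B]
          invariant_in[OF E a(1)] rho_add[OF aG] rho_scale[OF aG]) auto
    then obtain \<mu> e where e: "e \<in> E" "e \<noteq> 0" "\<rho> a e = s \<mu> e" by blast
    obtain H' where H': "inducing H' {u \<in> E. \<rho> a u = s \<mu> u}"
      using inducing_eigenspace[OF IHE a(1) sc e] by blast
    have "{u \<in> E. \<rho> a u = s \<mu> u} \<noteq> E" using a(1,3) unfolding N_def by blast
    then have "{u \<in> E. \<rho> a u = s \<mu> u} \<subset> E" by blast
    moreover have "vs.subspace {u \<in> E. \<rho> a u = s \<mu> u}"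
      using H' invariant_subsp subsp_subspace unfolding inducing_def by blast
    ultimately have "vs.dim {u \<in> E. \<rho> a u = s \<mu> u} < vs.dim E" by (intro dim_less fE)
    then show False using min[OF H'] by simp
  qed
  obtain v where v: "v \<in> E" "v \<noteq> 0" using E0 by blast
  have sub: "vs.span {v} \<subseteq> E" using v by (intro vs.span_minimal subsp_subspace sE) auto
  have vV: "v \<in> V" using v EV by blast
  have "invariant H (vs.span {v})"
    unfolding invariant_def
  proof (intro conjI ballI)
    show sv: "subsp (vs.span {v})" using vV by (intro subsp_span) simp
    fix h assume h: "h \<in> H"
    then obtain c where c: "\<And>u. u \<in> E \<Longrightarrow> \<rho> h u = s c u" using \<open>H \<subseteq> N\<close> unfolding N_def by blast
    have "\<rho> h ` vs.span {v} = s c ` vs.span {v}" using c sub by (intro image_cong refl) blast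
    also have "\<dots> \<subseteq> vs.span {v}" using vs.span_scale by blast
    finally show "\<rho> h ` vs.span {v} \<subseteq> vs.span {v}" .
  qed
  moreover have "(\<Union>g\<in>carrier G - H. \<rho> g ` vs.span {v}) \<subseteq> (\<Union>g\<in>carrier G - H. \<rho> g ` E)" using sub by blast
  then have "translates (vs.span {v}) (carrier G - H) \<subseteq> translates E (carrier G - H)"
    unfolding translates_def by (rule vs.span_mono)
  then have "vs.span {v} \<inter> translates (vs.span {v}) (carrier G - H) \<subseteq> {0}" using indep sub by blast
  moreover have "v \<in> vs.span {v}" by (intro vs.span_base) simp
  ultimately have "inducing H (vs.span {v})"
    unfolding inducing_def using H fin_dim_mono[OF fE sub] v(2) by blast
  then show ?thesis using vV v(2) by blast
qed

end

section \<open>Matrix coefficients\<close>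

lemma vector_space_complex: "vector_space ((*) :: complex \<Rightarrow> complex \<Rightarrow> complex)"
  by unfold_locales (simp_all add: algebra_simps)

lemma exists_separating_functional:
  fixes s :: "complex \<Rightarrow> 'v \<Rightarrow> 'v::ab_group_add"
  assumes vs: "vector_space s" and C: "module.subspace s C" and v: "v \<notin> C"
  obtains l :: "'v \<Rightarrow> complex" where "Vector_Spaces.linear s (*) l" "l v = 1" "\<And>x. x \<in> C \<Longrightarrow> l x = 0"
proof -
  interpret vp: vector_space_pair s "(*) :: complex \<Rightarrow> complex \<Rightarrow> complex"
    by (intro vector_space_pair.intro vs vector_space_complex)
  obtain B where B: "B \<subseteq> C" "vp.vs1.independent B" "C \<subseteq> vp.vs1.span B"
    using vp.vs1.maximal_independent_subset[of C] by metis
  have "vp.vs1.span B \<subseteq> C" by (rule vp.vs1.span_minimal[OF B(1) C])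
  then have "v \<notin> vp.vs1.span B" using v by blast
  then have ind: "vp.vs1.independent (insert v B)" using B(2) by (rule vp.vs1.independent_insertI)
  obtain l where l: "Vector_Spaces.linear s (*) l" "\<forall>x\<in>insert v B. l x = (if x = v then 1 else 0)"
    using vp.linear_independent_extend[OF ind, of "\<lambda>x. if x = v then 1 else 0"] by metis
  have "v \<notin> B" using B(1) v by blast
  have "l x = 0" if "x \<in> C" for x
  proof -
    have "l b = 0" if "b \<in> B" for b using l(2) that \<open>v \<notin> B\<close> by auto
    then show ?thesis
      using vp.linear_eq_0_on_span[OF l(1)] B(3) that by blast
  qed
  then show ?thesis using l that by simp
qed

context projective_rep
begin

lemma translates_irreducible:
  assumes irr: "irreducible_alpha_rep G \<alpha> s V \<rho>" and E: "subsp E" "\<not> E \<subseteq> {0}"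
  shows "translates E (carrier G) = V"
proof -
  let ?T = "translates E (carrier G)"
  have T: "invariant (carrier G) ?T" by (rule invariant_translates[OF subgroup_self E(1)])
  then have "?T = {0} \<or> ?T = V"
    using irr unfolding irreducible_alpha_rep_def invariant_def subsp_def by blast
  moreover have "E \<subseteq> ?T" by (rule subset_translates[OF E(1) one_closed])
  ultimately show ?thesis using E(2) by blast
qed

lemma subspace_0_or_V:
  assumes irr: "irreducible_alpha_rep G \<alpha> s V \<rho>" and U: "invariant (carrier G) U"
  shows "U = {0} \<or> U = V"
  using irr U unfolding irreducible_alpha_rep_def invariant_def subsp_def by blast

end

text \<open>
  A vector \<open>v\<close> of weight \<open>\<psi>\<close> together with a functional that kills \<open>\<rho> g v\<close> for \<open>g \<notin> H\<close>
  embeds \<open>V\<close> into the induced representation through \<open>u \<mapsto> (\<lambda>x. l (\<rho> x u))\<close>.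
\<close>

locale inducing_vector = projective_rep +
  fixes H :: "'a set" and v :: 'c and \<psi> :: "'a \<Rightarrow> complex" and l :: "'c \<Rightarrow> complex"
  assumes irreducible: "irreducible_alpha_rep G \<alpha> s V \<rho>"
    and H: "subgroup H G" and v: "v \<in> V" "v \<noteq> 0"
    and weight: "\<And>h. h \<in> H \<Longrightarrow> \<rho> h v = s (\<psi> h) v"
    and l: "Vector_Spaces.linear s (*) l" "l v = 1"
    and l_zero: "\<And>x. x \<in> translates (vs.span {v}) (carrier G - H) \<Longrightarrow> l x = 0"
begin

lemma l_add: "l (x + y) = l x + l y"
  using l(1) by (simp add: Vector_Spaces.linear_def module_hom_def module_hom_axioms_def)

lemma l_scale: "l (s c x) = c * l x"
  using l(1) by (simp add: Vector_Spaces.linear_def module_hom_def module_hom_axioms_def)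

lemma HG: "h \<in> H \<Longrightarrow> h \<in> carrier G"
  using subgroup.mem_carrier[OF H] .

lemma weight_nonzero: "h \<in> H \<Longrightarrow> \<psi> h \<noteq> 0"
  using weight[of h] rho_eq_0_iff[OF HG v(1)] v(2) by auto

lemma one_dim: "one_dim_alpha_rep (G\<lparr>carrier := H\<rparr>) \<alpha> \<psi>"
  unfolding one_dim_alpha_rep_def
proof (intro conjI ballI; simp)
  show "\<psi> x \<noteq> 0" if "x \<in> H" for x by (rule weight_nonzero[OF that])
  fix x y assume x: "x \<in> H" and y: "y \<in> H"
  have "\<rho> x (\<rho> y v) = s (\<psi> x * \<psi> y) v"
    using rho_scale[OF HG[OF x] v(1)] weight[OF x] weight[OF y] by (simp add: mult.commute)
  moreover have "\<rho> x (\<rho> y v) = s (\<alpha> x y * \<psi> (x \<otimes> y)) v"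
    using rho_mult[OF HG[OF x] HG[OF y] v(1)] weight[OF subgroup.m_closed[OF H x y]] by simp
  ultimately show "\<psi> x * \<psi> y = \<alpha> x y * \<psi> (x \<otimes> y)" using v(2) by simp
qed

abbreviation line :: "'c set" where
  "line \<equiv> vs.span {v}"

lemma subsp_line: "subsp line"
  using v(1) by (intro subsp_span) simp

lemma line_nonzero: "\<not> line \<subseteq> {0}"
  using v(2) vs.span_base[of v "{v}"] by auto

lemma translates_line: "translates line (carrier G) = V"
  by (rule translates_irreducible[OF irreducible subsp_line line_nonzero])

lemma l_outside:
  assumes "g \<in> carrier G" "g \<notin> H"
  shows "l (\<rho> g v) = 0"
proof (rule l_zero)
  have "\<rho> g v \<in> \<rho> g ` line" using vs.span_base[of v "{v}"] by simp
  then show "\<rho> g v \<in> translates line (carrier G - H)"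
    using translates_superset[of g "carrier G - H" line] assms by blast
qed

text \<open>\<open>V\<close> is the sum of the line and the span \<open>?C\<close> of the translates
  by elements outside \<open>H\<close>. Left multiplication by \<open>h\<close> preserves the
  complement of \<open>H\<close>, so \<open>\<rho> h\<close> respects both summands; it acts by
  \<open>\<psi> h\<close> on the line, and \<open>l\<close> vanishes on \<open>?C\<close>.\<close>

lemma l_equivariant:
  assumes h: "h \<in> H" and y: "y \<in> V"
  shows "l (\<rho> h y) = \<psi> h * l y"
proof -
  let ?C = "translates line (carrier G - H)"
  have CG: "carrier G - H \<subseteq> carrier G" by blast
  have hG: "h \<in> carrier G" by (rule HG[OF h])
  have sC: "subsp ?C" by (rule subsp_translates[OF CG subsp_line])
  have "carrier G = H \<union> (carrier G - H)" using HG by blast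
  then have "y \<in> translates line (H \<union> (carrier G - H))" using y translates_line by simp
  then obtain p q where pq: "p \<in> translates line H" "q \<in> ?C" "y = p + q" by (rule translates_Un)
  have "(\<Union>k\<in>H. \<rho> k ` line) \<subseteq> line"
  proof (intro UN_least subsetI)
    fix k x assume k: "k \<in> H" and "x \<in> \<rho> k ` line"
    then obtain c where "x = \<rho> k (s c v)" unfolding vs.span_singleton by blast
    then have "x = s (c * \<psi> k) v" using rho_scale[OF HG[OF k] v(1)] weight[OF k] by simp
    then show "x \<in> line" by (simp add: vs.span_scale vs.span_base)
  qed
  from vs.span_minimal[OF this vs.subspace_span] have "p \<in> line" using pq(1) unfolding translates_def by blast
  then obtain c where c: "p = s c v" unfolding vs.span_singleton by blast
  have "(\<lambda>a. h \<otimes> a) ` (carrier G - H) \<subseteq> carrier G - H"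
  proof
    fix x assume "x \<in> (\<lambda>a. h \<otimes> a) ` (carrier G - H)"
    then obtain a where a: "a \<in> carrier G" "a \<notin> H" "x = h \<otimes> a" by blast
    have "inv h \<otimes> x = a" using a hG by (simp add: word_simps)
    then have "x \<notin> H" using a(2) subgroup.m_closed[OF H subgroup.m_inv_closed[OF H h]] by metis
    then show "x \<in> carrier G - H" using a hG by simp
  qed
  then have "\<rho> h ` ?C \<subseteq> ?C"
    unfolding image_translates[OF hG CG subsp_line] by (rule translates_mono)
  then have "l (\<rho> h q) = 0" using pq(2) by (intro l_zero) blast
  moreover have "l q = 0" by (rule l_zero[OF pq(2)])
  moreover have pV: "p \<in> V" using c vs.subspace_scale[OF subspace_V v(1)] by simp
  have "\<rho> h p = s (\<psi> h) p" using c rho_scale[OF hG v(1)] weight[OF h] by (simp add: mult.commute)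
  moreover have "\<rho> h y = \<rho> h p + \<rho> h q" using rho_add[OF hG pV subspD[OF sC pq(2)]] pq(3) by simp
  ultimately show ?thesis using pq(3) by (simp add: l_add l_scale)
qed

section \<open>The isomorphism onto the induced representation\<close>

definition matrix_coeff :: "'c \<Rightarrow> 'a \<Rightarrow> complex" where
  "matrix_coeff u = (\<lambda>x. if x \<in> carrier G then l (\<rho> x u) else 0)"

abbreviation ind :: "('a \<Rightarrow> complex) set" where
  "ind \<equiv> ind_space G \<alpha> H (*) UNIV (\<lambda>h z. \<psi> h * z)"

text \<open>\<open>l\<close> vanishes on the translates by elements outside \<open>H\<close>, so
  \<open>x\<close> has to carry some \<open>f\<close> into \<open>H\<close>. This bounds the
  supports of the matrix coefficients.\<close>

lemma l_support:
  assumes "u \<in> translates line F" "F \<subseteq> carrier G" "x \<in> carrier G" "l (\<rho> x u) \<noteq> 0"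
  shows "\<exists>f\<in>F. x \<otimes> f \<in> H"
proof (rule ccontr)
  assume "\<not> (\<exists>f\<in>F. x \<otimes> f \<in> H)"
  then have "(\<lambda>a. x \<otimes> a) ` F \<subseteq> carrier G - H" using assms(2,3) by auto
  then have "\<rho> x ` translates line F \<subseteq> translates line (carrier G - H)"
    unfolding image_translates[OF assms(3,2) subsp_line] by (rule translates_mono)
  then show False using l_zero assms(1,4) by blast
qed

lemma matrix_coeff_in_ind:
  assumes u: "u \<in> V"
  shows "matrix_coeff u \<in> ind"
proof -
  have eq: "matrix_coeff u (h \<otimes> g) = inverse (\<alpha> h g) * (\<psi> h * matrix_coeff u g)"
    if h: "h \<in> H" and g: "g \<in> carrier G" for h g
  proof -
    have hG: "h \<in> carrier G" by (rule HG[OF h])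
    have "l (\<rho> h (\<rho> g u)) = \<alpha> h g * l (\<rho> (h \<otimes> g) u)" by (simp add: rho_mult[OF hG g u] l_scale)
    moreover have "l (\<rho> h (\<rho> g u)) = \<psi> h * l (\<rho> g u)" by (rule l_equivariant[OF h rho_closed[OF g u]])
    ultimately show ?thesis
      using cocycle_nonzero[OF hG g] hG g by (simp add: matrix_coeff_def field_simps)
  qed
  have "fin_dim {u}" unfolding fin_dim_def by (intro exI[of _ "{u}"]) (simp add: vs.span_base)
  moreover have "{u} \<subseteq> translates line (carrier G)" using translates_line u by simp
  ultimately obtain F where F: "finite F" "F \<subseteq> carrier G" "{u} \<subseteq> translates line F"
    by (rule translates_finite_subset)
  \<comment> \<open>\<open>x \<otimes> f \<in> H\<close> means that \<open>x\<close> lies in the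
    right coset of \<open>inv f\<close>.\<close>
  define C where "C = (\<lambda>f. H #> inv f) ` F"
  have "finite C" unfolding C_def using F(1) by simp
  moreover have "C \<subseteq> rcosets H"
    unfolding C_def using F(2) by (intro image_subsetI rcosetsI[OF subgroup.subset[OF H]] inv_closed) blast
  moreover have "{x \<in> carrier G. matrix_coeff u x \<noteq> 0} \<subseteq> \<Union>C"
  proof
    fix x assume "x \<in> {x \<in> carrier G. matrix_coeff u x \<noteq> 0}"
    then have x: "x \<in> carrier G" "l (\<rho> x u) \<noteq> 0" by (auto simp: matrix_coeff_def)
    have "u \<in> translates line F" using F(3) by simp
    then obtain f where f: "f \<in> F" "x \<otimes> f \<in> H" using l_support[OF _ F(2) x] by metis
    have fG: "f \<in> carrier G" using f F by blast
    have "x = x \<otimes> f \<otimes> inv f" using x fG by (simp add: word_simps)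
    then have "x \<in> H #> inv f" unfolding r_coset_def using f(2) by blast
    then show "x \<in> \<Union>C" unfolding C_def using f(1) by blast
  qed
  ultimately have "\<exists>C. finite C \<and> C \<subseteq> rcosets H \<and> {x \<in> carrier G. matrix_coeff u x \<noteq> 0} \<subseteq> \<Union>C" by blast
  moreover have "\<forall>x. x \<notin> carrier G \<longrightarrow> matrix_coeff u x = 0" by (simp add: matrix_coeff_def)
  ultimately show ?thesis
    unfolding ind_space_def using eq by blast
qed

lemma matrix_coeff_add:
  assumes "u \<in> V" "w \<in> V"
  shows "matrix_coeff (u + w) = matrix_coeff u + matrix_coeff w"
  using assms by (auto simp: matrix_coeff_def fun_eq_iff rho_add l_add)

lemma matrix_coeff_scale:
  assumes "u \<in> V"
  shows "matrix_coeff (s c u) = fun_scale (*) c (matrix_coeff u)"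
  using assms by (auto simp: matrix_coeff_def fun_scale_def fun_eq_iff rho_scale l_scale)

lemma matrix_coeff_action:
  assumes "u \<in> V" "g \<in> carrier G"
  shows "matrix_coeff (\<rho> g u) = ind_action G \<alpha> (*) g (matrix_coeff u)"
  using assms by (auto simp: matrix_coeff_def ind_action_def fun_eq_iff rho_mult l_scale)

text \<open>The kernel is an invariant subspace that does not contain \<open>v\<close>, hence zero
  by irreducibility.\<close>

lemma matrix_coeff_inj: "inj_on matrix_coeff V"
proof -
  define U where "U = {u \<in> V. matrix_coeff u = 0}"
  have mz: "matrix_coeff 0 = 0"
    using matrix_coeff_scale[OF v(1), of 0] by (simp add: fun_scale_def fun_eq_iff)
  have "vs.subspace U"
  proof (rule vs.subspaceI)
    show "0 \<in> U" unfolding U_def using vs.subspace_0[OF subspace_V] mz by simp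
    show "x + y \<in> U" if "x \<in> U" "y \<in> U" for x y
      using that vs.subspace_add[OF subspace_V] unfolding U_def by (simp add: matrix_coeff_add)
    show "s c x \<in> U" if "x \<in> U" for c x
      using that vs.subspace_scale[OF subspace_V] unfolding U_def
      by (simp add: matrix_coeff_scale fun_scale_def fun_eq_iff)
  qed
  moreover have "\<rho> g ` U \<subseteq> U" if g: "g \<in> carrier G" for g
    using g rho_closed[OF g] unfolding U_def
    by (auto simp: matrix_coeff_action ind_action_def fun_eq_iff)
  ultimately have "invariant (carrier G) U" unfolding invariant_def subsp_def U_def by blast
  then have "U = {0} \<or> U = V" by (rule subspace_0_or_V[OF irreducible])
  moreover have "matrix_coeff v \<one> \<noteq> 0"
    using rho_one[OF v(1)] cocycle_nonzero[of \<one> \<one>] l(2) by (simp add: matrix_coeff_def l_scale)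
  then have "v \<notin> U" unfolding U_def by auto
  ultimately have U: "U = {0}" using v(1) by blast
  show ?thesis
  proof (rule inj_onI)
    fix x y assume x: "x \<in> V" and y: "y \<in> V" and e: "matrix_coeff x = matrix_coeff y"
    have "matrix_coeff (x + s (- 1) y) = 0"
      using x y e vs.subspace_scale[OF subspace_V y, of "- 1"]
      by (simp only: matrix_coeff_add matrix_coeff_scale) (simp add: fun_scale_def fun_eq_iff)
    then have "x + s (- 1) y \<in> U"
      unfolding U_def using x y vs.subspace_scale[OF subspace_V y] vs.subspace_add[OF subspace_V] by blast
    then show "x = y" using U by simp
  qed
qed

text \<open>One coset of the support is removed at a time. For the coset of \<open>a\<close> this is
  done with a multiple of the matrix coefficient of \<open>\<rho> (inv a) v\<close>, which vanishes
  off that coset and is nonzero at \<open>a\<close>.\<close>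

lemma ind_in_range:
  assumes "finite F" "F \<subseteq> carrier G"
  shows "f \<in> ind \<Longrightarrow> {x \<in> carrier G. f x \<noteq> 0} \<subseteq> (\<Union>a\<in>F. H #> a) \<Longrightarrow> f \<in> matrix_coeff ` V"
  using assms
proof (induction F arbitrary: f)
  case empty
  have "f x = 0" for x using empty.prems by (cases "x \<in> carrier G") (auto simp: ind_space_def)
  moreover have "matrix_coeff 0 x = 0" for x
    using matrix_coeff_scale[OF v(1), of 0] by (simp add: fun_scale_def)
  ultimately have "f = matrix_coeff 0" by (simp add: fun_eq_iff)
  then show ?case using vs.subspace_0[OF subspace_V] by blast
next
  case (insert a F)
  have a: "a \<in> carrier G" and F: "F \<subseteq> carrier G" using insert.prems by auto
  have ia: "inv a \<in> carrier G" using a by simp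
  define w where "w = \<rho> (inv a) v"
  have w: "w \<in> V" unfolding w_def by (rule rho_closed[OF ia v(1)])
  have mw: "matrix_coeff w x = \<alpha> x (inv a) * l (\<rho> (x \<otimes> inv a) v)" if "x \<in> carrier G" for x
    using that unfolding w_def by (simp add: matrix_coeff_def rho_mult[OF _ ia v(1)] l_scale)
  have "l (\<rho> (a \<otimes> inv a) v) = \<alpha> \<one> \<one>" using rho_one[OF v(1)] a l(2) by (simp add: l_scale)
  then have mwa: "matrix_coeff w a \<noteq> 0" using mw[OF a] cocycle_nonzero a by simp
  define c where "c = - f a / matrix_coeff w a"
  define f' where "f' = f + fun_scale (*) c (matrix_coeff w)"
  have rep_H: "alpha_rep (G\<lparr>carrier := H\<rparr>) \<alpha> (*) UNIV (\<lambda>h z. \<psi> h * z)"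
    by (rule one_dim_alpha_rep_imp_alpha_rep[OF one_dim])
  interpret F: vector_space "fun_scale ((*) :: complex \<Rightarrow> complex \<Rightarrow> complex) :: complex \<Rightarrow> ('a \<Rightarrow> complex) \<Rightarrow> _"
    by (rule vector_space_fun_scale[OF vector_space_complex])
  note sub = subspace_ind_space[OF group_axioms H rep_H]
  have f': "f' \<in> ind"
    unfolding f'_def
    by (intro F.subspace_add[OF sub] F.subspace_scale[OF sub] insert.prems(1) matrix_coeff_in_ind w)
  have f'a: "f' a = 0" unfolding f'_def c_def fun_scale_def using mwa by simp
  \<comment> \<open>The zero of \<open>f'\<close> at \<open>a\<close> spreads over the coset of
    \<open>a\<close> by equivariance. Off this coset the coefficient of \<open>w\<close> vanishes,
    so no new support arises.\<close>
  have "{x \<in> carrier G. f' x \<noteq> 0} \<subseteq> (\<Union>a\<in>F. H #> a)"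
  proof
    fix x assume "x \<in> {x \<in> carrier G. f' x \<noteq> 0}"
    then have x: "x \<in> carrier G" "f' x \<noteq> 0" by auto
    have nH: "x \<otimes> inv a \<notin> H"
    proof
      assume h: "x \<otimes> inv a \<in> H"
      have "x = x \<otimes> inv a \<otimes> a" using x a by (simp add: word_simps)
      moreover have "f' (x \<otimes> inv a \<otimes> a) = inverse (\<alpha> (x \<otimes> inv a) a) * (\<psi> (x \<otimes> inv a) * f' a)"
        using f' h a unfolding ind_space_def by blast
      ultimately show False using f'a x(2) by simp
    qed
    then have "matrix_coeff w x = 0" using mw[OF x(1)] l_outside[of "x \<otimes> inv a"] x a by simp
    then have "f x \<noteq> 0" using x(2) unfolding f'_def fun_scale_def by simp
    then have "x \<in> (\<Union>a\<in>insert a F. H #> a)" using insert.prems(2) x(1) by blast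
    moreover have "x \<notin> H #> a"
    proof
      assume "x \<in> H #> a"
      then obtain h where h: "h \<in> H" "x = h \<otimes> a" unfolding r_coset_def by blast
      then have "x \<otimes> inv a = h" using HG[OF h(1)] a by (simp add: word_simps)
      then show False using nH h(1) by simp
    qed
    ultimately show "x \<in> (\<Union>a\<in>F. H #> a)" by blast
  qed
  then obtain u where u: "u \<in> V" "f' = matrix_coeff u" using insert.IH[OF f' _ F] by blast
  have "f = matrix_coeff (u + s (- c) w)"
    using u(2)[symmetric] w u(1) vs.subspace_scale[OF subspace_V w, of "- c"]
    by (simp only: matrix_coeff_add matrix_coeff_scale) (simp add: f'_def fun_scale_def fun_eq_iff)
  moreover have "u + s (- c) w \<in> V"
    using vs.subspace_add[OF subspace_V u(1) vs.subspace_scale[OF subspace_V w]] .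
  ultimately show ?case by blast
qed

lemma matrix_coeff_surj: "matrix_coeff ` V = ind"
proof
  show "matrix_coeff ` V \<subseteq> ind" using matrix_coeff_in_ind by blast
  show "ind \<subseteq> matrix_coeff ` V"
  proof
    fix f assume f: "f \<in> ind"
    then obtain C where C: "finite C" "C \<subseteq> rcosets H" "{x \<in> carrier G. f x \<noteq> 0} \<subseteq> \<Union>C"
      unfolding ind_space_def by auto
    have "C \<subseteq> (\<lambda>a. H #> a) ` carrier G" using C(2) unfolding RCOSETS_def by blast
    then obtain F where F: "F \<subseteq> carrier G" "finite F" "C = (\<lambda>a. H #> a) ` F"
      using finite_subset_image[OF C(1)] by metis
    show "f \<in> matrix_coeff ` V"
      by (rule ind_in_range[OF F(2,1) f]) (use C(3) F(3) in simp)
  qed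
qed

lemma monomial: "monomial_rep G \<alpha> s V \<rho>"
  unfolding monomial_rep_def equivalent_reps_def
proof (intro exI conjI ballI)
  show "subgroup H G" by (rule H)
  show "one_dim_alpha_rep (G\<lparr>carrier := H\<rparr>) \<alpha> \<psi>" by (rule one_dim)
  have bij: "bij_betw matrix_coeff V ind"
    unfolding bij_betw_def using matrix_coeff_inj matrix_coeff_surj by blast
  then show "linear_iso_on s V (fun_scale (*)) ind matrix_coeff"
    unfolding linear_iso_on_def using matrix_coeff_add matrix_coeff_scale by blast
  fix g f assume g: "g \<in> carrier G" and f: "f \<in> ind"
  obtain u where u: "u \<in> V" "f = matrix_coeff u" using f matrix_coeff_surj by blast
  have "the_inv_into V matrix_coeff f = u" unfolding u(2) by (rule the_inv_into_f_f[OF matrix_coeff_inj u(1)])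
  then show "matrix_coeff (\<rho> g (the_inv_into V matrix_coeff f)) = ind_action G \<alpha> (*) g f"
    using matrix_coeff_action[OF u(1) g] u(2) by simp
qed

end

section \<open>From finite weight to monomial\<close>

context projective_rep
begin

lemma monomial_of_finite_weight:
  assumes fg: "finitely_generated_group G" and nil: "nilpotent_group G"
    and irr: "irreducible_alpha_rep G \<alpha> s V \<rho>" and fw: "finite_weight G \<alpha> s V \<rho>"
  shows "monomial_rep G \<alpha> s V \<rho>"
proof -
  obtain H0 \<psi>0 where H0: "subgroup H0 G" and W: "weight_space H0 \<psi>0 s V \<rho> \<noteq> {0}"
    "finite_dim_subspace s (weight_space H0 \<psi>0 s V \<rho>)"
    using fw unfolding finite_weight_def by blast
  define W0 where "W0 = weight_space H0 \<psi>0 s V \<rho>"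
  have sat: "saturated H0 W0"
    unfolding W0_def by (rule saturated_weight_space[OF subgroup.subset[OF H0]])
  have "0 \<in> W0" by (rule vs.subspace_0[OF subsp_subspace[OF invariant_subsp[OF saturated_invariant[OF sat]]]])
  then have nz: "\<not> W0 \<subseteq> {0}" using W(1) unfolding W0_def[symmetric] by blast
  have fd: "fin_dim W0"
    using W(2) unfolding W0_def[symmetric] fin_dim_def finite_dim_subspace_def by auto
  obtain H1 E1 where "inducing H1 E1" using inducing_of_saturated[OF fg nil H0 sat fd nz] by blast
  then obtain H v where v: "v \<in> V" "v \<noteq> 0" and ind: "inducing H (vs.span {v})"
    using inducing_line[OF nil] by blast
  have H: "subgroup H G" and inv: "invariant H (vs.span {v})"
    and indep: "vs.span {v} \<inter> translates (vs.span {v}) (carrier G - H) \<subseteq> {0}"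
    using ind unfolding inducing_def by auto
  have vs: "v \<in> vs.span {v}" by (intro vs.span_base) simp
  have "\<exists>c. \<rho> h v = s c v" if "h \<in> H" for h
    using invariant_in[OF inv that vs] unfolding vs.span_singleton by blast
  then obtain \<psi> where \<psi>: "\<And>h. h \<in> H \<Longrightarrow> \<rho> h v = s (\<psi> h) v" by metis
  have "v \<notin> translates (vs.span {v}) (carrier G - H)" using indep vs v(2) by blast
  moreover have "vs.subspace (translates (vs.span {v}) (carrier G - H))"
    unfolding translates_def by (rule vs.subspace_span)
  ultimately obtain l where l: "Vector_Spaces.linear s (*) l" "l v = 1"
    "\<And>x. x \<in> translates (vs.span {v}) (carrier G - H) \<Longrightarrow> l x = 0"
    using exists_separating_functional[OF vs.vector_space_axioms] by metis
  interpret inducing_vector G s \<alpha> V \<rho> H v \<psi> l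
    by (rule inducing_vector.intro[OF projective_rep_axioms inducing_vector_axioms.intro])
      (fact irr H v \<psi> l)+
  show ?thesis by (rule monomial)
qed

end

section \<open>Schur's lemma and the converse\<close>

text \<open>There are only countably many finite subsets of \<open>D\<close>. If each span received
  finitely many parameters, the complex numbers would be countable.\<close>

lemma (in vector_space) countable_subset_infinite_fiber:
  assumes D: "countable D" and z: "\<And>\<mu>::complex. z \<mu> \<in> span D"
  obtains F where "finite F" "infinite {\<mu>. z \<mu> \<in> span F}"
proof -
  have "\<exists>F. finite F \<and> F \<subseteq> D \<and> z \<mu> \<in> span F" for \<mu>
  proof -
    obtain t r where t: "finite t" "t \<subseteq> D" "z \<mu> = (\<Sum>a\<in>t. r a *s a)"
      using z[of \<mu>] unfolding span_explicit by blast
    have "z \<mu> \<in> span t" unfolding t(3) by (intro span_sum span_scale span_base)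
    then show ?thesis using t by blast
  qed
  then have "(UNIV :: complex set) \<subseteq> (\<Union>F\<in>{F. finite F \<and> F \<subseteq> D}. {\<mu>. z \<mu> \<in> span F})" by auto
  moreover have "countable {F. finite F \<and> F \<subseteq> D}" by (rule countable_Collect_finite_subset[OF D])
  ultimately have "\<exists>F. finite F \<and> F \<subseteq> D \<and> infinite {\<mu>. z \<mu> \<in> span F}"
    using uncountable_UNIV_complex countable_finite
    by (metis (mono_tags, lifting) countable_UN countable_subset mem_Collect_eq)
  then show ?thesis using that by blast
qed

text \<open>
  Schur's lemma by counting: if \<open>A - \<mu>\<close> were invertible for every \<open>\<mu>\<close>, the uncountably many vectors
  \<open>(A - \<mu>)\<^sup>-\<^sup>1 v\<close> could not be linearly independent, and a relation between them yields a
  finite-dimensional invariant subspace, hence an eigenvector of \<open>A\<close>.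
\<close>

lemma no_resolvent:
  fixes s :: "complex \<Rightarrow> 'v \<Rightarrow> 'v::ab_group_add"
  assumes vs: "vector_space s" and V: "module.subspace s V" and D: "countable D" "V \<subseteq> module.span s D"
    and add: "\<And>u w. u \<in> V \<Longrightarrow> w \<in> V \<Longrightarrow> A (u + w) = A u + A w"
    and scale: "\<And>c u. u \<in> V \<Longrightarrow> A (s c u) = s c (A u)"
    and eigen: "\<And>\<mu> u. u \<in> V \<Longrightarrow> A u = s \<mu> u \<Longrightarrow> u = 0"
    and v: "v \<noteq> 0"
    and z: "\<And>\<mu>. z \<mu> \<in> V" "\<And>\<mu>. A (z \<mu>) = s \<mu> (z \<mu>) + v"
  shows False
proof -
  interpret vector_space s by (rule vs)
  obtain F where F: "finite F" "infinite {\<mu>. z \<mu> \<in> span F}"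
    using countable_subset_infinite_fiber[OF D(1), of z] z(1) D(2) by blast
  define M where "M = {\<mu>. z \<mu> \<in> span F}"
  have M: "infinite M" using F(2) unfolding M_def .
  obtain I where I: "I \<subseteq> z ` M" "independent I" "z ` M \<subseteq> span I"
    using maximal_independent_subset[of "z ` M"] by metis
  have "I \<subseteq> span F" using I(1) unfolding M_def by blast
  then have fI: "finite I" using independent_span_bound[OF F(1) I(2)] by blast
  have IV: "I \<subseteq> V" using I(1) z(1) by blast
  have spanIV: "span I \<subseteq> V" by (rule span_minimal[OF IV V])
  \<comment> \<open>Infinitely many parameters then give infinitely many vectors, so some
    \<open>z \<mu>\<close> lies outside the finite set \<open>I\<close>.\<close>
  have inj: "inj z"
  proof (rule injI)
    fix \<mu> \<nu> assume e: "z \<mu> = z \<nu>"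
    then have "s \<mu> (z \<mu>) = s \<nu> (z \<mu>)" using z(2)[of \<mu>] z(2)[of \<nu>] by auto
    moreover have "z \<mu> \<noteq> 0"
    proof
      assume 0: "z \<mu> = 0"
      have "A 0 = 0" using scale[OF z(1)[of \<mu>], of 0] by simp
      then show False using z(2)[of \<mu>] 0 v by simp
    qed
    ultimately show "\<mu> = \<nu>" by (metis scale_cancel_right)
  qed
  have "infinite (z ` M)" using M finite_imageD[OF _ inj_on_subset[OF inj]] by blast
  then obtain \<mu> where \<mu>: "\<mu> \<in> M" "z \<mu> \<notin> I" using fI finite_subset[of "z ` M" I] by blast
  define m where "m b = inv_into UNIV z b" for b
  have zm: "z (m b) = b" if "b \<in> I" for b
    unfolding m_def using that I(1) by (intro f_inv_into_f) blast
  \<comment> \<open>Every vector of \<open>I\<close> is mapped to a multiple of itself plus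
    \<open>v\<close>. As soon as \<open>v\<close> lies in \<open>span I\<close>, this span is
    invariant under \<open>A\<close>.\<close>
  have Ab: "A b = s (m b) b + v" if "b \<in> I" for b using z(2)[of "m b"] zm[OF that] by simp
  have "z \<mu> \<in> span I" using \<mu>(1) I(3) by blast
  then obtain d where d: "z \<mu> = (\<Sum>b\<in>I. s (d b) b)" unfolding span_finite[OF fI] by blast
  have A0: "A 0 = 0" using scale[OF z(1), of 0] by simp
  have Asum: "A (\<Sum>b\<in>J. s (d b) b) = (\<Sum>b\<in>J. s (d b) (A b))" if "finite J" "J \<subseteq> I" for J
    using that
  proof (induction J)
    case (insert b J)
    have b: "b \<in> V" "s (d b) b \<in> V" using insert.prems IV subspace_scale[OF V] by auto
    have "(\<Sum>b\<in>J. s (d b) b) \<in> V"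
      using insert.prems IV by (intro subspace_sum[OF V] subspace_scale[OF V]) auto
    then show ?case using insert add[OF b(2)] scale[OF b(1)] by simp
  qed (simp add: A0)
  have move: "y - d = c - a" if "a + y = c + d" for a y c d :: 'v
  proof -
    have "y = (c + d) - a" unfolding that[symmetric] by simp
    then show ?thesis by simp
  qed
  have "s \<mu> (z \<mu>) + v = A (z \<mu>)" using z(2) by simp
  also have "\<dots> = (\<Sum>b\<in>I. s (d b) (A b))" unfolding d by (rule Asum[OF fI subset_refl])
  also have "\<dots> = (\<Sum>b\<in>I. s (d b * m b) b + s (d b) v)"
    by (intro sum.cong refl) (simp add: Ab scale_right_distrib)
  also have "\<dots> = (\<Sum>b\<in>I. s (d b * m b) b) + s (\<Sum>b\<in>I. d b) v"
    by (simp add: sum.distrib scale_sum_left)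
  finally have e: "s \<mu> (z \<mu>) + v = (\<Sum>b\<in>I. s (d b * m b) b) + s (\<Sum>b\<in>I. d b) v" .
  have \<mu>z: "s \<mu> (z \<mu>) = (\<Sum>b\<in>I. s (d b * \<mu>) b)"
    unfolding d by (simp add: scale_sum_right mult.commute)
  \<comment> \<open>This is the operator \<open>A - \<mu>\<close> applied to the expansion of
    \<open>z \<mu>\<close> in \<open>I\<close>.\<close>
  have "s (1 - (\<Sum>b\<in>I. d b)) v = v - s (\<Sum>b\<in>I. d b) v" by (simp add: scale_left_diff_distrib)
  also have "\<dots> = (\<Sum>b\<in>I. s (d b * m b) b) - s \<mu> (z \<mu>)"
    by (rule move[OF e])
  also have "\<dots> = (\<Sum>b\<in>I. s (d b * (m b - \<mu>)) b)"
    unfolding \<mu>z by (simp add: sum_subtractf right_diff_distrib scale_left_diff_distrib)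
  finally have rel: "s (1 - (\<Sum>b\<in>I. d b)) v = (\<Sum>b\<in>I. s (d b * (m b - \<mu>)) b)" .
  \<comment> \<open>If the coefficients summed to 1, \<open>rel\<close> would be a relation among
    the independent vectors of \<open>I\<close>. Since \<open>m b \<noteq> \<mu>\<close>, all
    \<open>d b\<close> would vanish, and so would their sum.\<close>
  have "(\<Sum>b\<in>I. d b) \<noteq> 1"
  proof
    assume 1: "(\<Sum>b\<in>I. d b) = 1"
    have "d b * (m b - \<mu>) = 0" if "b \<in> I" for b
      using independentD[OF I(2) fI subset_refl _ that, of "\<lambda>b. d b * (m b - \<mu>)"] rel 1 by simp
    moreover have "m b \<noteq> \<mu>" if "b \<in> I" for b using zm[OF that] \<mu>(2) that by auto
    ultimately have "d b = 0" if "b \<in> I" for b using that by simp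
    then show False using 1 by simp
  qed
  then have c: "1 - (\<Sum>b\<in>I. d b) \<noteq> 0" by simp
  have "v = s (inverse (1 - (\<Sum>b\<in>I. d b))) (s (1 - (\<Sum>b\<in>I. d b)) v)" using c by simp
  also have "\<dots> \<in> span I" unfolding rel by (intro span_scale span_sum span_base)
  finally have vI: "v \<in> span I" .
  have closed: "A u \<in> span I" if u: "u \<in> span I" for u
  proof -
    have "u \<in> V \<and> A u \<in> span I"
      using u
    proof (induction rule: span_induct_alt)
      case base
      then show ?case using A0 subspace_0[OF V] by (simp add: span_zero)
    next
      case (step c b y)
      have b: "b \<in> V" "s c b \<in> V" using step(1) IV subspace_scale[OF V] by auto
      have "A (s c b + y) = s c (s (m b) b + v) + A y"
        using add[OF b(2)] scale[OF b(1)] step Ab by simp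
      also have "\<dots> \<in> span I"
        using step vI by (intro span_add span_scale) (auto intro: span_base)
      finally show ?case using subspace_add[OF V b(2)] step by blast
    qed
    then show ?thesis by blast
  qed
  have "\<exists>\<mu> u. u \<in> span I \<and> u \<noteq> 0 \<and> A u = s \<mu> u"
    using spanIV by (intro eigenvector_exists[OF vs subspace_span closed _ _ vI v fI subset_refl] add scale) auto
  then show False using eigen spanIV by blast
qed

section \<open>Countable generation and endomorphisms\<close>

lemma (in group) countable_generate:
  assumes "countable S" "S \<subseteq> carrier G"
  shows "countable (generate G S)"
proof -
  define f where "f xs = foldr (\<lambda>x y. x \<otimes> y) xs \<one>" for xs
  have fc: "f xs \<in> carrier G" if "set xs \<subseteq> carrier G" for xs
    using that unfolding f_def by (induction xs) auto
  have fapp: "f (xs @ ys) = f xs \<otimes> f ys" if "set xs \<subseteq> carrier G" "set ys \<subseteq> carrier G" for xs ys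
    using that(1)
  proof (induction xs)
    case Nil
    then show ?case using fc[OF that(2)] by (simp add: f_def)
  next
    case (Cons x xs)
    then show ?case using fc[of xs] fc[OF that(2)] by (simp add: f_def m_assoc)
  qed
  define T where "T = S \<union> (\<lambda>x. inv x) ` S"
  have T: "T \<subseteq> carrier G" unfolding T_def using assms(2) by auto
  have fl: "f [x] = x" if "x \<in> T" for x using that T by (auto simp: f_def)
  have "\<exists>xs\<in>lists T. g = f xs" if "g \<in> generate G S" for g
    using that
  proof induction
    case one
    show ?case by (intro bexI[of _ "[]"]) (auto simp: f_def)
  next
    case (incl h)
    then have "h \<in> T" unfolding T_def by blast
    then show ?case using fl[of h] by (intro bexI[of _ "[h]"]) simp_all
  next
    case (inv h)
    then have "inv h \<in> T" unfolding T_def by blast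
    then show ?case using fl[of "inv h"] by (intro bexI[of _ "[inv h]"]) simp_all
  next
    case (eng h1 h2)
    then obtain xs ys where "xs \<in> lists T" "h1 = f xs" "ys \<in> lists T" "h2 = f ys" by blast
    moreover from this have "set xs \<subseteq> carrier G" "set ys \<subseteq> carrier G" using T by auto
    ultimately show ?case by (intro bexI[of _ "xs @ ys"]) (simp_all add: fapp)
  qed
  then have "generate G S \<subseteq> f ` lists T" by blast
  moreover have "countable (lists T)" using assms(1) unfolding T_def by simp
  ultimately show ?thesis by (meson countable_subset countable_image)
qed

context projective_rep
begin

text \<open>If \<open>A\<close> is not scalar, the invariant subspaces given by the kernel and range
  of \<open>A - \<mu>\<close> are zero and \<open>V\<close>, so every equation
  \<open>(A - \<mu>) z = v\<close> is solvable. \<open>V\<close> is spanned by the countable orbit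
  of \<open>v\<close>, and \<open>no_resolvent\<close> applies.\<close>

lemma schur:
  assumes irr: "irreducible_alpha_rep G \<alpha> s V \<rho>" and count: "countable (carrier G)"
    and A: "Vector_Spaces.linear s s A" and AV: "\<And>u. u \<in> V \<Longrightarrow> A u \<in> V"
    and comm: "\<And>g u. g \<in> carrier G \<Longrightarrow> u \<in> V \<Longrightarrow> A (\<rho> g u) = \<rho> g (A u)"
  shows "\<exists>\<mu>. \<forall>u\<in>V. A u = s \<mu> u"
proof (rule ccontr)
  assume neg: "\<nexists>\<mu>. \<forall>u\<in>V. A u = s \<mu> u"
  have add: "A (x + y) = A x + A y" and scale: "A (s c x) = s c (A x)" for x y c
    using A by (simp_all add: Vector_Spaces.linear_def module_hom_def module_hom_axioms_def)
  have V0: "V \<noteq> {0}" using irr unfolding irreducible_alpha_rep_def by blast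
  then obtain v where v: "v \<in> V" "v \<noteq> 0" using vs.subspace_0[OF subspace_V] by blast
  have inv: "invariant (carrier G) {u \<in> V. A u = s \<mu> u}" for \<mu>
    unfolding invariant_def subsp_def
  proof (intro conjI ballI)
    show "vs.subspace {u \<in> V. A u = s \<mu> u}"
    proof (rule vs.subspaceI)
      show "0 \<in> {u \<in> V. A u = s \<mu> u}" using scale[of 0 0] vs.subspace_0[OF subspace_V] by simp
      show "x + y \<in> {u \<in> V. A u = s \<mu> u}" if "x \<in> {u \<in> V. A u = s \<mu> u}" "y \<in> {u \<in> V. A u = s \<mu> u}" for x y
        using that vs.subspace_add[OF subspace_V] by (simp add: add vs.scale_right_distrib)
      show "s c x \<in> {u \<in> V. A u = s \<mu> u}" if "x \<in> {u \<in> V. A u = s \<mu> u}" for c x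
        using that vs.subspace_scale[OF subspace_V] by (simp add: scale mult.commute)
    qed
    show "\<rho> g ` {u \<in> V. A u = s \<mu> u} \<subseteq> {u \<in> V. A u = s \<mu> u}" if g: "g \<in> carrier G" for g
      using rho_closed[OF g] comm[OF g] rho_scale[OF g] by auto
  qed blast
  have eigen: "u = 0" if "u \<in> V" "A u = s \<mu> u" for \<mu> u
  proof -
    have "{u \<in> V. A u = s \<mu> u} = {0} \<or> {u \<in> V. A u = s \<mu> u} = V"
      by (rule subspace_0_or_V[OF irr inv])
    moreover have "{u \<in> V. A u = s \<mu> u} \<noteq> V" using neg by blast
    ultimately have "{u \<in> V. A u = s \<mu> u} = {0}" by blast
    then show ?thesis using that by blast
  qed
  have surj: "\<exists>z. z \<in> V \<and> A z = s \<mu> z + v" for \<mu>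
  proof -
    define R where "R = (\<lambda>u. A u - s \<mu> u) ` V"
    have R: "invariant (carrier G) R"
      unfolding invariant_def subsp_def
    proof (intro conjI ballI)
      show "R \<subseteq> V"
        unfolding R_def using AV vs.subspace_diff[OF subspace_V] vs.subspace_scale[OF subspace_V] by blast
      show "vs.subspace R"
      proof (rule vs.subspaceI)
        have "0 = A 0 - s \<mu> 0" using scale[of 0 0] by simp
        then show "0 \<in> R" unfolding R_def using vs.subspace_0[OF subspace_V] by blast
        fix x y assume "x \<in> R" "y \<in> R"
        then obtain u w where u: "u \<in> V" "x = A u - s \<mu> u" and w: "w \<in> V" "y = A w - s \<mu> w"
          unfolding R_def by blast
        have "x + y = A (u + w) - s \<mu> (u + w)" using u w by (simp add: add vs.scale_right_distrib)
        then show "x + y \<in> R" unfolding R_def using vs.subspace_add[OF subspace_V u(1) w(1)] by blast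
      next
        fix c x assume "x \<in> R"
        then obtain u where u: "u \<in> V" "x = A u - s \<mu> u" unfolding R_def by blast
        have "s c x = A (s c u) - s \<mu> (s c u)"
          using u by (simp add: scale vs.scale_right_diff_distrib mult.commute)
        then show "s c x \<in> R" unfolding R_def using vs.subspace_scale[OF subspace_V u(1)] by blast
      qed
      show "\<rho> g ` R \<subseteq> R" if g: "g \<in> carrier G" for g
      proof
        fix y assume "y \<in> \<rho> g ` R"
        then obtain u where u: "u \<in> V" "y = \<rho> g (A u - s \<mu> u)" unfolding R_def by blast
        have "y = A (\<rho> g u) - s \<mu> (\<rho> g u)"
          using u rho_diff[OF g AV[OF u(1)] vs.subspace_scale[OF subspace_V u(1)]] comm[OF g u(1)]
            rho_scale[OF g u(1)] by simp
        then show "y \<in> R" unfolding R_def using rho_closed[OF g u(1)] by blast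
      qed
    qed
    have "A v - s \<mu> v \<in> R" unfolding R_def using v by blast
    moreover have "A v - s \<mu> v \<noteq> 0" using eigen[OF v(1), of \<mu>] v(2) by auto
    ultimately have "R = V" using subspace_0_or_V[OF irr R] by blast
    then obtain z where "z \<in> V" "v = A z - s \<mu> z" using v(1) unfolding R_def by blast
    then show ?thesis by (intro exI[of _ z]) simp
  qed
  then obtain z where z: "\<And>\<mu>. z \<mu> \<in> V" "\<And>\<mu>. A (z \<mu>) = s \<mu> (z \<mu>) + v" by metis
  define D where "D = (\<lambda>g. \<rho> g v) ` carrier G"
  have sl: "subsp (vs.span {v})" using v(1) by (intro subsp_span) simp
  have "v \<in> vs.span {v}" by (intro vs.span_base) simp
  then have "translates (vs.span {v}) (carrier G) = V"
    using v(2) by (intro translates_irreducible[OF irr sl]) blast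
  moreover have "\<rho> g ` vs.span {v} \<subseteq> vs.span D" if g: "g \<in> carrier G" for g
  proof
    fix x assume "x \<in> \<rho> g ` vs.span {v}"
    then obtain c where "x = \<rho> g (s c v)" unfolding vs.span_singleton by blast
    then have "x = s c (\<rho> g v)" using rho_scale[OF g v(1)] by simp
    moreover have "\<rho> g v \<in> vs.span D" unfolding D_def using g by (intro vs.span_base imageI)
    ultimately show "x \<in> vs.span D" by (simp add: vs.span_scale)
  qed
  then have "translates (vs.span {v}) (carrier G) \<subseteq> vs.span D"
    unfolding translates_def by (intro vs.span_minimal UN_least vs.subspace_span)
  ultimately have VD: "V \<subseteq> vs.span D" by simp
  have cD: "countable D" unfolding D_def using count by simp
  show False
    by (rule no_resolvent[OF vs.vector_space_axioms subspace_V cD VD add scale eigen v(2) z])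
qed

text \<open>
  A basis consisting of vectors \<open>\<rho> x v\<close> meets every coset \<open>g H\<close>: otherwise applying \<open>\<rho> (inv g)\<close> would
  put \<open>v\<close> into the span excluded by the last hypothesis.
\<close>

lemma endomorphism_of_weight_vector:
  assumes H: "subgroup H G"
    and v: "v \<in> V" "\<And>h. h \<in> H \<Longrightarrow> \<rho> h v = s (\<psi> h) v"
    and w: "w \<in> V" "\<And>h. h \<in> H \<Longrightarrow> \<rho> h w = s (\<psi> h) w"
    and indep: "v \<notin> vs.span ((\<lambda>g. \<rho> g v) ` (carrier G - H))"
  obtains A where "Vector_Spaces.linear s s A" "\<And>g. g \<in> carrier G \<Longrightarrow> A (\<rho> g v) = \<rho> g w"
proof -
  interpret vp: vector_space_pair s s by unfold_locales
  let ?O = "(\<lambda>g. \<rho> g v) ` carrier G"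
  obtain B where B: "B \<subseteq> ?O" "vs.independent B" "?O \<subseteq> vs.span B"
    using vs.maximal_independent_subset[of ?O] by metis
  have "\<forall>b\<in>B. \<exists>x. x \<in> carrier G \<and> b = \<rho> x v" using B(1) by blast
  then obtain x where x: "\<And>b. b \<in> B \<Longrightarrow> x b \<in> carrier G" "\<And>b. b \<in> B \<Longrightarrow> b = \<rho> (x b) v" by metis
  obtain A where A: "Vector_Spaces.linear s s A" "\<forall>b\<in>B. A b = \<rho> (x b) w"
    using vp.linear_independent_extend[OF B(2), of "\<lambda>b. \<rho> (x b) w"] by blast
  have scale: "A (s c u) = s c (A u)" for u c
    using A(1) by (simp add: Vector_Spaces.linear_def module_hom_def module_hom_axioms_def)
  have "A (\<rho> g v) = \<rho> g w" if g: "g \<in> carrier G" for g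
  proof -
    have ig: "inv g \<in> carrier G" using g by simp
    have "\<exists>b\<in>B. inv g \<otimes> x b \<in> H"
    proof (rule ccontr)
      assume neg: "\<not> (\<exists>b\<in>B. inv g \<otimes> x b \<in> H)"
      have BV: "B \<subseteq> V" using B(1) rho_closed v(1) by blast
      have "\<rho> g v \<in> vs.span B" using B(3) g by blast
      then have "\<rho> (inv g) (\<rho> g v) \<in> vs.span (\<rho> (inv g) ` B)" using image_span[OF ig BV] by blast
      also have "\<dots> \<subseteq> vs.span ((\<lambda>g. \<rho> g v) ` (carrier G - H))"
      proof (rule vs.span_minimal[OF _ vs.subspace_span], rule image_subsetI)
        fix b assume b: "b \<in> B"
        have "\<rho> (inv g \<otimes> x b) v \<in> (\<lambda>g. \<rho> g v) ` (carrier G - H)" using neg b ig x(1) by blast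
        then have "s (\<alpha> (inv g) (x b)) (\<rho> (inv g \<otimes> x b) v) \<in> vs.span ((\<lambda>g. \<rho> g v) ` (carrier G - H))"
          by (intro vs.span_scale vs.span_base)
        then show "\<rho> (inv g) b \<in> vs.span ((\<lambda>g. \<rho> g v) ` (carrier G - H))"
          using rho_mult[OF ig x(1)[OF b] v(1)] x(2)[OF b] by simp
      qed
      finally have "s (\<alpha> (inv g) g * \<alpha> \<one> \<one>) v \<in> vs.span ((\<lambda>g. \<rho> g v) ` (carrier G - H))"
        using rho_mult[OF ig g v(1)] rho_one[OF v(1)] g by simp
      from vs.span_scale[OF this, of "inverse (\<alpha> (inv g) g * \<alpha> \<one> \<one>)"]
      have "s (inverse (\<alpha> (inv g) g * \<alpha> \<one> \<one>) * (\<alpha> (inv g) g * \<alpha> \<one> \<one>)) v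
          \<in> vs.span ((\<lambda>g. \<rho> g v) ` (carrier G - H))" by (simp only: vs.scale_scale)
      moreover have nz: "\<alpha> (inv g) g * \<alpha> \<one> \<one> \<noteq> 0" using cocycle_nonzero g by simp
      ultimately show False using indep unfolding left_inverse[OF nz] by simp
    qed
    then obtain b where b: "b \<in> B" "inv g \<otimes> x b \<in> H" by blast
    have hG: "inv g \<otimes> x b \<in> carrier G" using x(1)[OF b(1)] g by simp
    have e: "g \<otimes> (inv g \<otimes> x b) = x b" using x(1)[OF b(1)] g by (simp add: word_simps)
    \<comment> \<open>A vector of weight \<open>\<psi>\<close> has proportional images under
      \<open>\<rho> g\<close> and \<open>\<rho> (x b)\<close>, with factors that do not depend on
      the vector. Comparing \<open>v\<close> with \<open>w\<close> carries the prescribed value of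
      \<open>A\<close> at \<open>\<rho> (x b) v\<close> over to \<open>\<rho> g v\<close>.\<close>
    have c: "s (\<psi> (inv g \<otimes> x b)) (\<rho> g u) = s (\<alpha> g (inv g \<otimes> x b)) (\<rho> (x b) u)"
      if u: "u \<in> V" "\<rho> (inv g \<otimes> x b) u = s (\<psi> (inv g \<otimes> x b)) u" for u
      using rho_mult[OF g hG u(1)] u(2) rho_scale[OF g u(1)] e by simp
    have "s (\<psi> (inv g \<otimes> x b)) (A (\<rho> g v)) = s (\<alpha> g (inv g \<otimes> x b)) (A (\<rho> (x b) v))"
      using c[OF v(1) v(2)[OF b(2)]] by (simp only: scale[symmetric])
    also have "A (\<rho> (x b) v) = \<rho> (x b) w" using A(2) b(1) x(2)[OF b(1)] by simp
    also have "s (\<alpha> g (inv g \<otimes> x b)) (\<rho> (x b) w) = s (\<psi> (inv g \<otimes> x b)) (\<rho> g w)"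
      by (rule c[OF w(1) w(2)[OF b(2)], symmetric])
    finally have "s (\<psi> (inv g \<otimes> x b)) (A (\<rho> g v)) = s (\<psi> (inv g \<otimes> x b)) (\<rho> g w)" .
    moreover have "v \<noteq> 0" using indep vs.span_zero by blast
    then have "\<psi> (inv g \<otimes> x b) \<noteq> 0" using rho_eq_0_iff[OF hG v(1)] v(2)[OF b(2)] by auto
    ultimately show ?thesis by simp
  qed
  then show ?thesis using that A(1) by blast
qed

text \<open>The function equal to \<open>\<psi>\<close> on \<open>H\<close> and zero elsewhere
  corresponds to a vector \<open>v\<close> of weight \<open>\<psi>\<close>. Each \<open>w\<close> of
  weight \<open>\<psi>\<close> is the image of \<open>v\<close> under an endomorphism of
  \<open>V\<close>, which is scalar by \<open>schur\<close>, so the weight space is a line.\<close>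

lemma finite_weight_of_monomial:
  assumes count: "countable (carrier G)"
    and irr: "irreducible_alpha_rep G \<alpha> s V \<rho>" and mono: "monomial_rep G \<alpha> s V \<rho>"
  shows "finite_weight G \<alpha> s V \<rho>"
proof -
  obtain H \<psi> T where H: "subgroup H G" and \<psi>: "one_dim_alpha_rep (G\<lparr>carrier := H\<rparr>) \<alpha> \<psi>"
    and T: "linear_iso_on s V (fun_scale (*)) (ind_space G \<alpha> H (*) UNIV (\<lambda>h z. \<psi> h * z)) T"
    and int: "\<forall>g\<in>carrier G. \<forall>w\<in>ind_space G \<alpha> H (*) UNIV (\<lambda>h z. \<psi> h * z).
      T (\<rho> g (the_inv_into V T w)) = ind_action G \<alpha> (*) g w"
    using mono unfolding monomial_rep_def equivalent_reps_def by blast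
  note HG = subgroup.mem_carrier[OF H]
  define W where "W = ind_space G \<alpha> H (*) UNIV (\<lambda>h z. \<psi> h * z)"
  have bij: "bij_betw T V W" using T unfolding linear_iso_on_def W_def by blast
  have injT: "inj_on T V" by (rule bij_betw_imp_inj_on[OF bij])
  have Tadd: "T (x + y) = T x + T y" if "x \<in> V" "y \<in> V" for x y
    using T that unfolding linear_iso_on_def by blast
  have Tscale: "T (s c x) = fun_scale (*) c (T x)" if "x \<in> V" for x c
    using T that unfolding linear_iso_on_def by blast
  have Tact: "T (\<rho> g u) = ind_action G \<alpha> (*) g (T u)" if "g \<in> carrier G" "u \<in> V" for g u
    using int that the_inv_into_f_f[OF injT that(2)] bij_betwE[OF bij] unfolding W_def by metis
  have \<psi>mult: "\<psi> x * \<psi> y = \<alpha> x y * \<psi> (x \<otimes> y)" if "x \<in> H" "y \<in> H" for x y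
    using \<psi> that unfolding one_dim_alpha_rep_def by simp
  have \<psi>nz: "\<psi> x \<noteq> 0" if "x \<in> H" for x using \<psi> that unfolding one_dim_alpha_rep_def by simp
  have mem_iff: "h \<otimes> x \<in> H \<longleftrightarrow> x \<in> H" if h: "h \<in> H" and x: "x \<in> carrier G" for h x
  proof
    assume "h \<otimes> x \<in> H"
    then have "inv h \<otimes> (h \<otimes> x) \<in> H" by (rule subgroup.m_closed[OF H subgroup.m_inv_closed[OF H h]])
    then show "x \<in> H" using x HG[OF h] by (simp add: word_simps)
  qed (rule subgroup.m_closed[OF H h])
  have mem_iff': "x \<otimes> h \<in> H \<longleftrightarrow> x \<in> H" if h: "h \<in> H" and x: "x \<in> carrier G" for h x
  proof
    assume "x \<otimes> h \<in> H"
    then have "x \<otimes> h \<otimes> inv h \<in> H" by (rule subgroup.m_closed[OF H _ subgroup.m_inv_closed[OF H h]])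
    then show "x \<in> H" using x HG[OF h] by (simp add: word_simps)
  qed (rule subgroup.m_closed[OF H _ h])
  define f0 where "f0 x = (if x \<in> H then \<psi> x else 0)" for x
  have "f0 (h \<otimes> g) = inverse (\<alpha> h g) * (\<psi> h * f0 g)" if h: "h \<in> H" and g: "g \<in> carrier G" for h g
    using mem_iff[OF h g] \<psi>mult[OF h] cocycle_nonzero[OF HG[OF h] g] by (auto simp: f0_def field_simps)
  moreover have "\<forall>x. x \<notin> carrier G \<longrightarrow> f0 x = 0" using HG by (auto simp: f0_def)
  moreover have "H \<in> rcosets H" using subgroup.subgroup_in_rcosets[OF H group_axioms] .
  then have "\<exists>C. finite C \<and> C \<subseteq> rcosets H \<and> {x \<in> carrier G. f0 x \<noteq> 0} \<subseteq> \<Union>C"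
    by (intro exI[of _ "{H}"]) (auto simp: f0_def split: if_splits)
  ultimately have f0: "f0 \<in> W" unfolding W_def ind_space_def by blast
  then obtain v where v: "v \<in> V" "T v = f0" using bij unfolding bij_betw_def by blast
  have one: "\<one> \<in> H" by (rule subgroup.one_closed[OF H])
  have T0: "T 0 = (\<lambda>x. 0)" using Tscale[OF v(1), of 0] by (simp add: fun_scale_def)
  have v0: "v \<noteq> 0"
  proof
    assume "v = 0"
    then have "f0 \<one> = T 0 \<one>" using v(2) by simp
    then show False using one \<psi>nz[OF one] T0 by (simp add: f0_def)
  qed
  have weight: "\<rho> h v = s (\<psi> h) v" if h: "h \<in> H" for h
  proof -
    have "ind_action G \<alpha> (*) h f0 = fun_scale (*) (\<psi> h) f0"
    proof
      fix x
      show "ind_action G \<alpha> (*) h f0 x = fun_scale (*) (\<psi> h) f0 x"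
        using mem_iff'[OF h, of x] \<psi>mult[OF _ h, of x] HG[of x]
        by (auto simp: ind_action_def fun_scale_def f0_def mult.commute)
    qed
    then have "T (\<rho> h v) = T (s (\<psi> h) v)" using Tact[OF HG[OF h] v(1)] Tscale[OF v(1)] v(2) by simp
    then show ?thesis
      using injT rho_closed[OF HG[OF h] v(1)] vs.subspace_scale[OF subspace_V v(1)] unfolding inj_on_def by blast
  qed
  \<comment> \<open>Evaluation at the unit element separates \<open>v\<close> from its translates by
    elements outside \<open>H\<close>: the translate by \<open>g\<close> has there a multiple of
    \<open>f0 g\<close> as its value.\<close>
  have zero: "T u \<one> = 0" if "u \<in> vs.span ((\<lambda>g. \<rho> g v) ` (carrier G - H))" for u
  proof -
    have "u \<in> V \<and> T u \<one> = 0"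
      using that
    proof (induction rule: vs.span_induct_alt)
      case base
      then show ?case using T0 vs.subspace_0[OF subspace_V] by simp
    next
      case (step c x y)
      then obtain g where g: "g \<in> carrier G" "g \<notin> H" "x = \<rho> g v" by blast
      have x: "x \<in> V" "s c x \<in> V" using g rho_closed[OF _ v(1)] vs.subspace_scale[OF subspace_V] by auto
      have "T x \<one> = 0" using Tact[OF g(1) v(1)] v(2) g by (simp add: ind_action_def f0_def)
      then have "T (s c x + y) \<one> = 0" using Tadd[OF x(2)] Tscale[OF x(1)] step by (simp add: fun_scale_def)
      then show ?case using vs.subspace_add[OF subspace_V x(2)] step by blast
    qed
    then show ?thesis by blast
  qed
  have indep: "v \<notin> vs.span ((\<lambda>g. \<rho> g v) ` (carrier G - H))"
    using zero[of v] v(2) one \<psi>nz[OF one] by (auto simp: f0_def)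
  have sub: "weight_space H \<psi> s V \<rho> \<subseteq> vs.span {v}"
  proof
    fix w assume "w \<in> weight_space H \<psi> s V \<rho>"
    then have w: "w \<in> V" "\<And>h. h \<in> H \<Longrightarrow> \<rho> h w = s (\<psi> h) w" unfolding weight_space_def by auto
    obtain A where A: "Vector_Spaces.linear s s A" "\<And>g. g \<in> carrier G \<Longrightarrow> A (\<rho> g v) = \<rho> g w"
      using endomorphism_of_weight_vector[OF H v(1) weight w indep] by metis
    have Aadd: "A (x + y) = A x + A y" and Ascale: "A (s c x) = s c (A x)" for x y c
      using A(1) by (simp_all add: Vector_Spaces.linear_def module_hom_def module_hom_axioms_def)
    \<comment> \<open>\<open>A\<close> is controlled only on the orbit of \<open>v\<close>. The
      translates of the line through \<open>v\<close> span \<open>V\<close>, so invariance of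
      \<open>V\<close> and compatibility with the action follow by induction over spans.\<close>
    have key: "u \<in> V \<and> A u \<in> V \<and> (\<forall>g\<in>carrier G. A (\<rho> g u) = \<rho> g (A u))"
      if "u \<in> vs.span (\<Union>x\<in>carrier G. \<rho> x ` vs.span {v})" for u
      using that
    proof (induction rule: vs.span_induct_alt)
      case base
      then show ?case using vs.subspace_0[OF subspace_V] Ascale[of 0 0] rho_zero by simp
    next
      case (step c b y)
      then obtain x d where x: "x \<in> carrier G" "b = \<rho> x (s d v)" unfolding vs.span_singleton by blast
      have b: "b = s d (\<rho> x v)" using x rho_scale[OF x(1) v(1)] by simp
      have xv: "\<rho> x v \<in> V" "\<rho> x w \<in> V" using rho_closed[OF x(1)] v(1) w(1) by auto
      have bV: "s c b \<in> V" unfolding b by (intro vs.subspace_scale[OF subspace_V] xv)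
      have Ab: "A (s c b) = s (c * d) (\<rho> x w)" unfolding b using Ascale A(2)[OF x(1)] by simp
      have "A (\<rho> g (s c b)) = \<rho> g (A (s c b))" if g: "g \<in> carrier G" for g
      proof -
        have "A (\<rho> g (s c b)) = A (s (c * d * \<alpha> g x) (\<rho> (g \<otimes> x) v))"
          unfolding b using rho_scale[OF g xv(1)] rho_mult[OF g x(1) v(1)] by simp
        also have "\<dots> = s (c * d * \<alpha> g x) (\<rho> (g \<otimes> x) w)" using Ascale A(2) g x(1) by simp
        also have "\<dots> = \<rho> g (A (s c b))" unfolding Ab using rho_scale[OF g xv(2)] rho_mult[OF g x(1) w(1)] by simp
        finally show ?thesis .
      qed
      moreover have AbV: "A (s c b) \<in> V" unfolding Ab by (intro vs.subspace_scale[OF subspace_V] xv)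
      ultimately show ?case
        using step bV vs.subspace_add[OF subspace_V] by (simp add: Aadd rho_add)
    qed
    have sl: "subsp (vs.span {v})" using v(1) by (intro subsp_span) simp
    have vs: "v \<in> vs.span {v}" by (intro vs.span_base) simp
    have "translates (vs.span {v}) (carrier G) = V"
      using v0 vs by (intro translates_irreducible[OF irr sl]) blast
    then have key: "A u \<in> V" "g \<in> carrier G \<Longrightarrow> A (\<rho> g u) = \<rho> g (A u)" if "u \<in> V" for u g
      using key that unfolding translates_def by auto
    obtain \<mu> where \<mu>: "\<And>u. u \<in> V \<Longrightarrow> A u = s \<mu> u" using schur[OF irr count A(1) key] by blast
    \<comment> \<open>The cocycle is not normalized, so the unit element acts by
      \<open>\<alpha> \<one> \<one>\<close>; this factor is nonzero and cancels.\<close>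
    have "A (\<rho> \<one> v) = \<rho> \<one> w" by (rule A(2)[OF one_closed])
    then have "s (\<alpha> \<one> \<one>) (A v) = s (\<alpha> \<one> \<one>) w" using rho_one v(1) w(1) Ascale by simp
    then have "A v = w" using cocycle_nonzero[of \<one> \<one>] by simp
    then have "w = s \<mu> v" using \<mu>[OF v(1)] by simp
    then show "w \<in> vs.span {v}" using vs by (simp add: vs.span_scale)
  qed
  have vw: "v \<in> weight_space H \<psi> s V \<rho>" unfolding weight_space_def using v(1) weight by blast
  have "vs.subspace (weight_space H \<psi> s V \<rho>)"
    using saturated_weight_space[OF subgroup.subset[OF H]] saturated_invariant invariant_subsp subsp_subspace by blast
  then have "vs.span {v} = weight_space H \<psi> s V \<rho>"
    using sub vw vs.span_minimal[of "{v}"] by blast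
  then have "finite_dim_subspace s (weight_space H \<psi> s V \<rho>)"
    unfolding finite_dim_subspace_def using vw by (intro exI[of _ "{v}"]) simp
  moreover have "weight_space H \<psi> s V \<rho> \<noteq> {0}" using vw v0 by blast
  ultimately show ?thesis unfolding finite_weight_def using H \<psi> by blast
qed

end

theorem theorem1p3:
  fixes G :: "('g, 'm) monoid_scheme"
    and \<alpha> :: "'g \<Rightarrow> 'g \<Rightarrow> complex"
    and s :: "complex \<Rightarrow> 'v \<Rightarrow> 'v::ab_group_add"
    and V :: "'v set"
    and \<rho> :: "'g \<Rightarrow> 'v \<Rightarrow> 'v"
  assumes "finitely_generated_group G"
    and "nilpotent_group G"
    and "cocycle2 G \<alpha>"
    and "irreducible_alpha_rep G \<alpha> s V \<rho>"
  shows "monomial_rep G \<alpha> s V \<rho> \<longleftrightarrow> finite_weight G \<alpha> s V \<rho>"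
proof -
  have G: "group G" using assms(2) unfolding nilpotent_group_def by blast
  have rep: "alpha_rep G \<alpha> s V \<rho>" using assms(4) unfolding irreducible_alpha_rep_def by blast
  interpret projective_rep G s \<alpha> V \<rho>
  proof (intro projective_rep.intro projective_rep_axioms.intro G assms(3) rep)
    show "vector_space s" using rep unfolding alpha_rep_def complex_space_def by blast
  qed
  obtain S where "finite S" "S \<subseteq> carrier G" "generate G S = carrier G"
    using assms(1) unfolding finitely_generated_group_def by blast
  then have "countable (carrier G)" using countable_generate[of S] countable_finite by metis
  then show ?thesis
    using monomial_of_finite_weight[OF assms(1,2,4)] finite_weight_of_monomial[OF _ assms(4)] by blast
qed

end
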